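(* Let $A\in\mathbb{C}^{n\times n}$ be quasi-sectorial and $B\in\mathbb{C}^{n\times n}$ be semi-sectorial, with phase centers $\gamma(A)$ and $\gamma(B)$ respectively. Let $C=AB$. Then: 1. $C$ has $r=\mathrm{rank}(C^2)$ nonzero eigenvalues (counted with algebraic multiplicity) $\lambda_{\neq 0}(C)=\begin{bmatrix}\lambda_1(C)&\cdots&\lambda_r(C)\end{bmatrix}$. 2. The arguments $\angle\lambda_i(C)$ can take values so that (with the eigenvalues suitably ordered) $$\gamma(A)+\gamma(B)-\pi<\angle\lambda_r(C)\leq\dots\leq\angle\lambda_1(C)<\gamma(A)+\gamma(B)+\pi.$$ 3. There exists an $n\times r$ isometry $U$ (i.e. $U^*U=I_r$) such that $U^*AU$ is sectorial, $U^*BU$ is nonsingular and semi-sectorial, and, with the arguments taking the values in item 2, $$\angle\lambda_{\neq 0}(C)\prec\phi(U^*AU)+\phi(U^*BU).$$ Here the phases of $U^*AU$ are selected in $[\underline{\phi}(A),\overline{\phi}(A)]$ and those of $U^*BU$ in $[\underline{\phi}(B),\overline{\phi}(B)]$.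
   Context: For $C\in\mathbb{C}^{n\times n}$, the numerical range is $W(C)=\{x^*Cx:\|x\|=1\}$ and the angular numerical range is $W'(C)=\{x^*Cx:x\in\mathbb{C}^n,x\neq0\}$, a convex cone. The field angle $\delta(C)$ is the angle subtended by $W'(C)$ if $W'(C)$ contains no line through the origin, $\pi$ if it contains exactly one line through the origin, and $2\pi$ if it is all of $\mathbb{C}$. $C$ is sectorial if $0\notin W(C)$, quasi-sectorial if $\delta(C)<\pi$, and semi-sectorial if $\delta(C)\leq\pi$. The zero matrix is quasi-sectorial. Phases. A sectorial $C$ can be written $C=T^*DT$ with $T$ nonsingular and $D$ diagonal unitary, the diagonal entries of $D$ being unique up to permutation and lying in an arc of length less than $\pi$; the phases $\overline{\phi}(C)=\phi_1(C)\geq\dots\geq\phi_n(C)=\underline{\phi}(C)$ are the arguments of the diagonal entries of $D$, selected so that $\overline{\phi}(C)-\underline{\phi}(C)<\pi$. A quasi-sectorial $C$ of rank $r$ has a decomposition $C=U\begin{bmatrix}0&0\\0&C_s\end{bmatrix}U^*$ with $U$ unitary and $C_s\in\mathbb{C}^{r\times r}$ sectorial; its $r$ phases are those of $C_s$. A semi-sectorial $C$ of rank $r$ with $\delta(C)=\pi$ is of one of two kinds. (i) Rotated Hermitian: $W(C)$ is a straight segment with the origin in its relative interior, $C=T^*\mathrm{diag}\{0_{n-r},e^{j(\theta_0+\pi/2)}I,e^{j(\theta_0-\pi/2)}I\}T$ with $T$ nonsingular, and its phases are the corresponding copies of $\theta_0+\pi/2$ and $\theta_0-\pi/2$. (ii)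 Otherwise $C=T^*\,\mathrm{diag}\{0_{n-r},D,E\}\,T$ with $T$ nonsingular, $D=\mathrm{diag}\{e^{j\theta_1},\dots,e^{j\theta_m}\}$, $\theta_0+\pi/2\geq\theta_1\geq\cdots\geq\theta_m\geq\theta_0-\pi/2$, and $E$ block diagonal with $(r-m)/2$ blocks $e^{j\theta_0}\begin{bmatrix}1&2\\0&1\end{bmatrix}$; its phases are $\theta_1,\dots,\theta_m$ together with $(r-m)/2$ copies of each of $\theta_0+\pi/2$ and $\theta_0-\pi/2$. So a semi-sectorial matrix of rank $r$ has $r$ phases. The largest and smallest are denoted $\overline{\phi}(C),\underline{\phi}(C)$; $\phi(C)$ is the vector of phases in non-increasing order. The phase center is $\gamma(C)=[\overline{\phi}(C)+\underline{\phi}(C)]/2$ ($=\theta_0$ when $\delta(C)=\pi$). Phases are determined only up to the choice of the phase center (modulo $2\pi$; modulo $\pi$ in the rotated Hermitian case); fixing $\gamma(C)\in\mathbb{R}$ fixes the phases. $\lambda_{\neq0}(C)$ is the vector of nonzero eigenvalues of $C$; $\angle$ is the argument, applied element-wise. For $x,y\in\mathbb{R}^r$, $x\prec y$ (majorization) means that, with entries sorted non-increasingly, $\sum_{i=1}^kx_i^\downarrow\leq\sum_{i=1}^ky_i^\downarrow$ for $k=1,\dots,r-1$, with equality for $k=r$. *)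

theory Defs
  imports
    "HOL-Analysis.Complex_Transcendental"
    "HOL-Analysis.Line_Segment"
    "Jordan_Normal_Form.Schur_Decomposition"
    "Jordan_Normal_Form.DL_Rank"
begin

text \<open>All notions below are meant for square matrices, of size \<open>dim_row C\<close>. Matrices of size 0
  are allowed; a compression \<open>U\<^sup>* A U\<close> by a matrix \<open>U\<close> without columns is of this kind.\<close>

definition numerical_range :: "complex mat \<Rightarrow> complex set" where
  "numerical_range C =
     {(C *\<^sub>v x) \<bullet>c x | x. x \<in> carrier_vec (dim_row C) \<and> x \<bullet>c x = 1}"

definition angular_numerical_range :: "complex mat \<Rightarrow> complex set" where
  "angular_numerical_range C =
     {(C *\<^sub>v x) \<bullet>c x | x. x \<in> carrier_vec (dim_row C) \<and> x \<noteq> 0\<^sub>v (dim_row C)}"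

definition line_through_origin :: "complex set \<Rightarrow> bool" where
  "line_through_origin L \<longleftrightarrow> (\<exists>z. z \<noteq> 0 \<and> L = range (\<lambda>t :: real. of_real t * z))"

text \<open>The angle subtended by a cone is the opening angle of the smallest sector containing it;
  it is 0 for the cones \<open>{}\<close> and \<open>{0}\<close>.\<close>

definition sector :: "real \<Rightarrow> real \<Rightarrow> complex set" where
  "sector a b = {of_real \<rho> * cis t | \<rho> t. 0 \<le> \<rho> \<and> a \<le> t \<and> t \<le> b}"

definition subtended_angle :: "complex set \<Rightarrow> real" where
  "subtended_angle K = Inf {b - a | a b. a \<le> b \<and> K \<subseteq> sector a b}"

text \<open>The angular numerical range is a convex cone. If it contains more than one line through the
  origin, it is therefore the whole plane, which is the last case.\<close>

definition field_angle :: "complex mat \<Rightarrow> real" where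
  "field_angle C =
     (let W = angular_numerical_range C in
      if \<not> (\<exists>L. line_through_origin L \<and> L \<subseteq> W) then subtended_angle W
      else if \<exists>!L. line_through_origin L \<and> L \<subseteq> W then pi
      else 2 * pi)"

definition sectorial :: "complex mat \<Rightarrow> bool" where
  "sectorial C \<longleftrightarrow> 0 \<notin> numerical_range C"

definition quasi_sectorial :: "complex mat \<Rightarrow> bool" where
  "quasi_sectorial C \<longleftrightarrow> field_angle C < pi"

definition semi_sectorial :: "complex mat \<Rightarrow> bool" where
  "semi_sectorial C \<longleftrightarrow> field_angle C \<le> pi"

definition isometry :: "complex mat \<Rightarrow> bool" where
  "isometry U \<longleftrightarrow> mat_adjoint U * U = 1\<^sub>m (dim_col U)"

definition congruent_mat :: "complex mat \<Rightarrow> complex mat \<Rightarrow> bool" where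
  "congruent_mat C M \<longleftrightarrow>
     (\<exists>n T. C \<in> carrier_mat n n \<and> M \<in> carrier_mat n n \<and> T \<in> carrier_mat n n \<and>
       invertible_mat T \<and> C = mat_adjoint T * M * T)"

text \<open>Phases are determined only up to the choice of the phase center, so being a vector of phases
  is a relation. A vector of phases is a non-increasing list.\<close>

definition sectorial_phases :: "complex mat \<Rightarrow> real list \<Rightarrow> bool" where
  "sectorial_phases C \<phi> \<longleftrightarrow>
     sectorial C \<and> sorted_wrt (\<ge>) \<phi> \<and> (\<forall>s \<in> set \<phi>. \<forall>t \<in> set \<phi>. s - t < pi) \<and>
     congruent_mat C (mk_diagonal (map cis \<phi>))"

text \<open>In the next three definitions the rank of \<open>C\<close> is necessarily \<open>length \<phi>\<close>.\<close>

definition quasi_sectorial_phases :: "complex mat \<Rightarrow> real list \<Rightarrow> bool" where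
  "quasi_sectorial_phases C \<phi> \<longleftrightarrow>
     (\<exists>n r U Cs. r \<le> n \<and> C \<in> carrier_mat n n \<and> U \<in> carrier_mat n n \<and> isometry U \<and>
       Cs \<in> carrier_mat r r \<and> sectorial_phases Cs \<phi> \<and>
       C = U * diag_block_mat [0\<^sub>m (n - r) (n - r), Cs] * mat_adjoint U)"

definition rotated_hermitian :: "complex mat \<Rightarrow> bool" where
  "rotated_hermitian C \<longleftrightarrow>
     (\<exists>a b. numerical_range C = closed_segment a b \<and> 0 \<in> open_segment a b)"

definition rotated_hermitian_phases :: "complex mat \<Rightarrow> real list \<Rightarrow> bool" where
  "rotated_hermitian_phases C \<phi> \<longleftrightarrow>
     (\<exists>\<theta>\<^sub>0 z p q. \<phi> = replicate p (\<theta>\<^sub>0 + pi / 2) @ replicate q (\<theta>\<^sub>0 - pi / 2) \<and>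
       congruent_mat C (diag_block_mat [0\<^sub>m z z, mk_diagonal (map cis \<phi>)]))"

text \<open>Here \<open>k\<close> is the number of non-diagonal blocks; each contributes two phases.\<close>

definition general_semi_sectorial_phases :: "complex mat \<Rightarrow> real list \<Rightarrow> bool" where
  "general_semi_sectorial_phases C \<phi> \<longleftrightarrow>
     (\<exists>\<theta>\<^sub>0 z \<theta> k. sorted_wrt (\<ge>) \<theta> \<and> set \<theta> \<subseteq> {\<theta>\<^sub>0 - pi / 2 .. \<theta>\<^sub>0 + pi / 2} \<and>
       \<phi> = replicate k (\<theta>\<^sub>0 + pi / 2) @ \<theta> @ replicate k (\<theta>\<^sub>0 - pi / 2) \<and>
       congruent_mat C
         (diag_block_mat
           ([0\<^sub>m z z, mk_diagonal (map cis \<theta>)] @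
            replicate k (cis \<theta>\<^sub>0 \<cdot>\<^sub>m mat_of_rows_list 2 [[1, 2], [0, 1]]))))"

text \<open>\<open>has_phases C \<gamma> \<phi>\<close>: \<open>\<phi>\<close> is the vector of phases of the semi-sectorial matrix \<open>C\<close>
  for the phase center \<open>\<gamma>\<close>. The zero matrix has no phases and any real number as phase center.\<close>

definition has_phases :: "complex mat \<Rightarrow> real \<Rightarrow> real list \<Rightarrow> bool" where
  "has_phases C \<gamma> \<phi> \<longleftrightarrow>
     (if field_angle C < pi then quasi_sectorial_phases C \<phi>
      else field_angle C = pi \<and>
        (if rotated_hermitian C then rotated_hermitian_phases C \<phi>
         else general_semi_sectorial_phases C \<phi>)) \<and>
     (\<phi> \<noteq> [] \<longrightarrow> \<gamma> = (hd \<phi> + last \<phi>) / 2)"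

text \<open>The interval from the smallest to the largest phase.\<close>

definition phase_interval :: "real list \<Rightarrow> real set" where
  "phase_interval \<phi> = {last \<phi> .. hd \<phi>}"

text \<open>Eigenvalues with algebraic multiplicity.\<close>

definition nonzero_eigenvalues :: "complex mat \<Rightarrow> complex multiset" where
  "nonzero_eigenvalues C = filter_mset (\<lambda>z. z \<noteq> 0) (proots (char_poly C))"

definition majorized_by :: "real list \<Rightarrow> real list \<Rightarrow> bool" (infix \<open>\<preceq>\<^sub>m\<close> 50) where
  "x \<preceq>\<^sub>m y \<longleftrightarrow> length x = length y \<and>
     (\<forall>k < length x. sum_list (take k (rev (sort x))) \<le> sum_list (take k (rev (sort y)))) \<and>
     sum_list x = sum_list y"

end

theory Submission
  imports Defs
begin

text \<open>Compressing to the range of \<open>A\<close>, and then to the range of the resulting compression of \<open>B\<close>, keeps the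
  nonzero eigenvalues of \<open>A B\<close> and makes both factors nonsingular; this works because an accretive
  matrix has the same kernel as its adjoint. For nonsingular factors take a Schur triangularization
  \<open>A B X = X \<Lambda>\<close> with prescribed order of the eigenvalues. With \<open>Y = B X\<close> the leading blocks satisfy
  \<open>(Y\<^sup>* A Y)\<^sub>k = (X\<^sup>* B X)\<^sub>k\<^sup>* \<Lambda>\<^sub>k\<close>, so that \<open>\<lambda>\<^sub>1 \<dots> \<lambda>\<^sub>k\<close> has the argument of a product of two leading
  minors. The argument of the leading minor of order \<open>k\<close> is the sum of the phases of the leading block.
  By interlacing, the increments of these sums from \<open>k - 1\<close> to \<open>k\<close> stay between the extreme phases,
  which fixes all arguments exactly rather than modulo \<open>2 \<pi>\<close>, and the partial sums are bounded by the
  sums of the \<open>k\<close> largest phases. Interlacing itself is a dimension count: the number of phases on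
  either side of \<open>\<alpha>\<close> is the dimension of a subspace on which the imaginary part of \<open>e\<^sup>-\<^sup>i\<^sup>\<alpha> M\<close> is
  definite.\<close>

unbundle no vec_syntax

subsection \<open>Adjoints and quadratic forms\<close>

text \<open>Two difficulties shape the development. Arguments exist only modulo
  \<open>2 * pi\<close>, so \<open>A\<close> and \<open>B\<close> are each assigned one half-plane,
  and the phases of all their compressions are measured around its fixed centre. Sums of phases of
  different leading blocks then become comparable as real numbers. This requires phases for every
  leading block, so the canonical form under congruence has to be constructed for any nonsingular
  matrix whose form stays in a half-plane; the hypotheses supply it for \<open>A\<close> and
  \<open>B\<close> only. The second difficulty is that \<open>B\<close> is merely semi-sectorial:
  its form may vanish at nonzero vectors, so definiteness does not make its leading minors nonzero.
  They inherit this property from the minors on the side of \<open>A\<close>, where the compressed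
  form is definite. The asymmetry of the hypotheses returns in the width of the window: the sector
  of \<open>A\<close> has angle less than pi and that of \<open>B\<close> at most pi, so the sums of
  phases fill a closed interval shorter than \<open>2 * pi\<close>. Both the strict bounds on the
  arguments and the possibility of sorting the eigenvalues come from there.\<close>

abbreviation adj :: "complex mat \<Rightarrow> complex mat" where "adj \<equiv> mat_adjoint"

lemma conjugate_complex_cnj [simp]: "conjugate (z::complex) = cnj z"
  by (simp add: conjugate_complex_def)

lemma dim_adj [simp]: "dim_row (adj A) = dim_col A" "dim_col (adj A) = dim_row A"
  by (simp_all add: mat_adjoint_def)

lemma adj_carrier [simp]: "A \<in> carrier_mat n m \<Longrightarrow> adj A \<in> carrier_mat m n"
  by auto

lemma index_adj [simp]: "i < dim_col A \<Longrightarrow> j < dim_row A \<Longrightarrow> adj A $$ (i, j) = cnj (A $$ (j, i))"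
  by (simp add: mat_adjoint_def mat_of_rows_index)

lemma adj_adj [simp]: "adj (adj A) = A"
  by (rule eq_matI) auto

lemma adj_one [simp]: "adj (1\<^sub>m n) = 1\<^sub>m n"
  by (rule eq_matI) auto

lemma adj_zero [simp]: "adj (0\<^sub>m n m) = 0\<^sub>m m n"
  by (rule eq_matI) auto

lemma adj_mult: "dim_col A = dim_row B \<Longrightarrow> adj (A * B) = adj B * adj A"
  by (rule eq_matI) (auto simp: scalar_prod_def mult.commute)

lemma adj_four_block:
  assumes "A \<in> carrier_mat n1 m1" "B \<in> carrier_mat n1 m2" "C \<in> carrier_mat n2 m1" "D \<in> carrier_mat n2 m2"
  shows "adj (four_block_mat A B C D) = four_block_mat (adj A) (adj C) (adj B) (adj D)"
  using assms by (intro eq_matI) (auto simp: Let_def)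

lemma mult_assoc_dim:
  fixes A B C :: "complex mat"
  shows "dim_col A = dim_row B \<Longrightarrow> dim_col B = dim_row C \<Longrightarrow> (A * B) * C = A * (B * C)"
  by (rule assoc_mult_mat[of _ "dim_row A" "dim_row B" _ "dim_row C" _ "dim_col C"]) auto

lemma mult_vec_assoc_dim:
  fixes A B :: "complex mat"
  shows "dim_col A = dim_row B \<Longrightarrow> dim_col B = dim_vec x \<Longrightarrow> (A * B) *\<^sub>v x = A *\<^sub>v (B *\<^sub>v x)"
  by (rule assoc_mult_mat_vec[of _ "dim_row A" "dim_row B" _ "dim_vec x"]) auto

lemma mult_cancel_inverse:
  fixes A B C :: "complex mat"
  assumes "A * B = 1\<^sub>m n" "dim_col A = dim_row B" "dim_col B = dim_row C"
  shows "A * (B * C) = C"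
proof -
  have "n = dim_row C" using assms by (metis index_mult_mat(3) index_one_mat(3))
  then show ?thesis using assms by (metis mult_assoc_dim left_mult_one_mat' )
qed

lemma one_mult_dim [simp]:
  fixes A :: "complex mat"
  shows "dim_row A = n \<Longrightarrow> 1\<^sub>m n * A = A" "dim_col A = n \<Longrightarrow> A * 1\<^sub>m n = A"
  by auto

lemma cscalar_prod_adj:
  assumes "A \<in> carrier_mat n m" "x \<in> carrier_vec m" "y \<in> carrier_vec n"
  shows "(A *\<^sub>v x) \<bullet>c y = x \<bullet>c (adj A *\<^sub>v y)"
proof -
  have "(A *\<^sub>v x) \<bullet>c y = (\<Sum>i<n. (\<Sum>j<m. A $$ (i,j) * x $ j) * cnj (y $ i))"
    using assms by (auto simp: scalar_prod_def lessThan_atLeast0 intro!: sum.cong)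
  also have "\<dots> = (\<Sum>i<n. \<Sum>j<m. x $ j * cnj (cnj (A $$ (i,j)) * y $ i))"
    by (auto simp: sum_distrib_right intro!: sum.cong)
  also have "\<dots> = (\<Sum>j<m. \<Sum>i<n. x $ j * cnj (cnj (A $$ (i,j)) * y $ i))"
    by (rule sum.swap)
  also have "\<dots> = x \<bullet>c (adj A *\<^sub>v y)"
    using assms by (auto simp: scalar_prod_def lessThan_atLeast0 sum_distrib_left intro!: sum.cong)
  finally show ?thesis .
qed

text \<open>Since \<open>\<bullet>c\<close> conjugates its second argument, this is
  \<open>x^* M x\<close>.\<close>

definition quad_form :: "complex mat \<Rightarrow> complex vec \<Rightarrow> complex" where
  "quad_form M x = (M *\<^sub>v x) \<bullet>c x"

lemma quad_form_congruence:
  assumes "P \<in> carrier_mat n m" "M \<in> carrier_mat n n" "x \<in> carrier_vec m"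
  shows "quad_form (adj P * M * P) x = quad_form M (P *\<^sub>v x)"
proof -
  have "(adj P * M * P) *\<^sub>v x = adj P *\<^sub>v (M *\<^sub>v (P *\<^sub>v x))"
    using assms by (simp add: mult_vec_assoc_dim mult_assoc_dim)
  then show ?thesis
    unfolding quad_form_def using assms
    by (simp add: cscalar_prod_adj[of "adj P" m n])
qed

lemma quad_form_smult_mat:
  assumes "M \<in> carrier_mat n n" "x \<in> carrier_vec n"
  shows "quad_form (c \<cdot>\<^sub>m M) x = c * quad_form M x"
  using assms unfolding quad_form_def
  by (auto simp: scalar_prod_def sum_distrib_left mult.assoc intro!: sum.cong)

lemma quad_form_smult_vec:
  assumes "M \<in> carrier_mat n n" "x \<in> carrier_vec n"
  shows "quad_form M (c \<cdot>\<^sub>v x) = (c * cnj c) * quad_form M x"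
  using assms unfolding quad_form_def
  by (auto simp: scalar_prod_def sum_distrib_left sum_distrib_right mult_ac intro!: sum.cong)

lemma cscalar_prod_self:
  fixes x :: "complex vec"
  shows "x \<bullet>c x = of_real (\<Sum>i<dim_vec x. (cmod (x $ i))\<^sup>2)"
  unfolding of_real_sum
  by (auto simp: scalar_prod_def lessThan_atLeast0 complex_norm_square simp del: of_real_power intro!: sum.cong)

lemma cscalar_prod_self_eq_0:
  fixes x :: "complex vec"
  assumes "x \<in> carrier_vec n"
  shows "x \<bullet>c x = 0 \<longleftrightarrow> x = 0\<^sub>v n"
  using conjugate_square_eq_0_vec[OF assms] by blast

lemma cscalar_prod_nonzero:
  fixes x :: "complex vec"
  assumes "x \<in> carrier_vec n" "x \<noteq> 0\<^sub>v n"
  obtains c :: real where "c > 0" "x \<bullet>c x = of_real c"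
proof -
  have "(\<Sum>i<dim_vec x. (cmod (x $ i))\<^sup>2) \<noteq> 0"
    using assms cscalar_prod_self_eq_0[OF assms(1)] cscalar_prod_self[of x] by (metis of_real_0)
  moreover have "(\<Sum>i<dim_vec x. (cmod (x $ i))\<^sup>2) \<ge> 0" by (simp add: sum_nonneg)
  ultimately show thesis using that cscalar_prod_self[of x] by (metis less_eq_real_def)
qed

section \<open>Determinants, kernels and one-sided inverses\<close>

lemma det_nonzero_inverse:
  fixes A :: "complex mat"
  assumes "A \<in> carrier_mat n n" "det A \<noteq> 0"
  obtains B where "B \<in> carrier_mat n n" "A * B = 1\<^sub>m n" "B * A = 1\<^sub>m n"
proof -
  have "A \<in> Units (ring_mat TYPE(complex) n undefined)"
    using det_non_zero_imp_unit[OF assms] .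
  then show thesis using that by (auto simp: Units_def ring_mat_def)
qed

lemma det_inverse:
  fixes A :: "complex mat"
  assumes "A \<in> carrier_mat n n" "B \<in> carrier_mat n n" "A * B = 1\<^sub>m n"
  shows "det A \<noteq> 0"
  using det_mult[OF assms(1,2)] assms(3) by auto

lemma invertible_mat_iff_det:
  fixes A :: "complex mat"
  assumes "A \<in> carrier_mat n n"
  shows "invertible_mat A \<longleftrightarrow> det A \<noteq> 0"
proof
  assume "invertible_mat A"
  then obtain B where B: "A * B = 1\<^sub>m (dim_row A)" "B * A = 1\<^sub>m (dim_row B)"
    unfolding invertible_mat_def inverts_mat_def by auto
  have "B \<in> carrier_mat n n"
    using B assms by (metis carrier_matD(1,2) carrier_matI index_mult_mat(2,3) index_one_mat(2,3))
  then show "det A \<noteq> 0" using det_inverse assms B by auto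
next
  assume "det A \<noteq> 0"
  then obtain B where "B \<in> carrier_mat n n" "A * B = 1\<^sub>m n" "B * A = 1\<^sub>m n"
    using det_nonzero_inverse assms by blast
  then show "invertible_mat A"
    using assms unfolding invertible_mat_def inverts_mat_def by auto
qed

lemma det_nonzeroI:
  fixes A :: "complex mat"
  assumes "A \<in> carrier_mat n n" "\<And>x. x \<in> carrier_vec n \<Longrightarrow> A *\<^sub>v x = 0\<^sub>v n \<Longrightarrow> x = 0\<^sub>v n"
  shows "det A \<noteq> 0"
  using det_0_iff_vec_prod_zero[OF assms(1)] assms(2) by blast

lemma det_nonzeroD:
  fixes A :: "complex mat"
  assumes "A \<in> carrier_mat n n" "det A \<noteq> 0" "x \<in> carrier_vec n" "A *\<^sub>v x = 0\<^sub>v n"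
  shows "x = 0\<^sub>v n"
  using det_0_iff_vec_prod_zero[OF assms(1)] assms by blast

lemma det_adj:
  assumes "A \<in> carrier_mat n n"
  shows "det (adj A) = cnj (det A)"
proof -
  have "adj A = map_mat cnj (transpose_mat A)"
    by (rule eq_matI) auto
  moreover have "det (map_mat cnj (transpose_mat A)) = cnj (det (transpose_mat A))"
  proof -
    have "det (map_mat cnj (transpose_mat A)) =
      (\<Sum>p | p permutes {0..<n}. signof p * (\<Prod>i = 0..<n. map_mat cnj (transpose_mat A) $$ (i, p i)))"
      using assms by (simp add: det_def)
    also have "\<dots> = (\<Sum>p | p permutes {0..<n}. cnj (signof p * (\<Prod>i = 0..<n. transpose_mat A $$ (i, p i))))"
      using assms by (intro sum.cong refl) (auto simp: sign_def permutes_in_image intro!: prod.cong)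
    also have "\<dots> = cnj (det (transpose_mat A))"
      using assms by (simp add: det_def)
    finally show ?thesis .
  qed
  ultimately show ?thesis using assms det_transpose by metis
qed

lemma wide_mat_kernel:
  fixes A :: "complex mat"
  assumes "A \<in> carrier_mat m n" "m < n"
  obtains x where "x \<in> carrier_vec n" "x \<noteq> 0\<^sub>v n" "A *\<^sub>v x = 0\<^sub>v m"
proof -
  \<comment> \<open>Zero rows pad \<open>A\<close> to a square matrix. As \<open>m < n\<close>, row
    \<open>n - 1\<close> is one of them; it is singled out because \<open>det_row_0\<close> expects
    the zero row in this form.\<close>
  define A' where "A' = mat\<^sub>r n n (\<lambda>i. if i = n - 1 then 0\<^sub>v n else if i < m then row A i else 0\<^sub>v n)"
  have "det A' = 0" unfolding A'_def using assms by (intro det_row_0) (auto)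
  moreover have A': "A' \<in> carrier_mat n n" by (auto simp: A'_def)
  ultimately obtain x where x: "x \<in> carrier_vec n" "x \<noteq> 0\<^sub>v n" "A' *\<^sub>v x = 0\<^sub>v n"
    using det_0_iff_vec_prod_zero[OF A'] by blast
  have "A *\<^sub>v x = 0\<^sub>v m"
  proof (rule eq_vecI)
    fix i assume i: "i < dim_vec (0\<^sub>v m :: complex vec)"
    have "row A' i = row A i" using i assms by (intro eq_vecI) (auto simp: A'_def)
    then have "(A *\<^sub>v x) $ i = (A' *\<^sub>v x) $ i"
      using i assms A' by simp
    then show "(A *\<^sub>v x) $ i = 0\<^sub>v m $ i" using x(3) i assms by auto
  qed (use assms in auto)
  then show thesis using that x by blast
qed

lemma mult_mat_vec_zero:
  fixes A :: "complex mat"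
  shows "dim_col A = n \<Longrightarrow> A *\<^sub>v 0\<^sub>v n = 0\<^sub>v (dim_row A)"
  by (rule eq_vecI) auto

lemma index_mult_sum:
  fixes A B :: "complex mat"
  assumes "A \<in> carrier_mat n m" "B \<in> carrier_mat m k" "i < n" "j < k"
  shows "(A * B) $$ (i,j) = (\<Sum>l<m. A $$ (i,l) * B $$ (l,j))"
  using assms by (simp add: scalar_prod_def lessThan_atLeast0)

lemma left_inverse_dim_le:
  fixes A :: "complex mat"
  assumes "A \<in> carrier_mat n m" "L \<in> carrier_mat m n" "L * A = 1\<^sub>m m"
  shows "m \<le> n"
proof (rule ccontr)
  assume "\<not> m \<le> n"
  then obtain x where x: "x \<in> carrier_vec m" "x \<noteq> 0\<^sub>v m" "A *\<^sub>v x = 0\<^sub>v n"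
    using wide_mat_kernel[OF assms(1)] by auto
  have "(L * A) *\<^sub>v x = L *\<^sub>v (A *\<^sub>v x)"
    by (intro mult_vec_assoc_dim) (use assms(1,2) x in auto)
  also have "\<dots> = 0\<^sub>v m" using assms x(3) mult_mat_vec_zero[of L n] by simp
  finally have "1\<^sub>m m *\<^sub>v x = 0\<^sub>v m" using assms(3) by simp
  then show False using x by simp
qed

text \<open>The Gram matrix \<open>adj A * A\<close> is nonsingular, because the squared norm of
  \<open>A x\<close> is the inner product of \<open>x\<close> with the Gram matrix applied to
  \<open>x\<close>. The left inverse is the inverse Gram matrix times \<open>adj A\<close>.\<close>

lemma injective_left_inverse:
  fixes A :: "complex mat"
  assumes A: "A \<in> carrier_mat n m"
    and inj: "\<And>x. x \<in> carrier_vec m \<Longrightarrow> A *\<^sub>v x = 0\<^sub>v n \<Longrightarrow> x = 0\<^sub>v m"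
  obtains L where "L \<in> carrier_mat m n" "L * A = 1\<^sub>m m"
proof -
  let ?G = "adj A * A"
  have G: "?G \<in> carrier_mat m m" using A by auto
  have "det ?G \<noteq> 0"
  proof (rule det_nonzeroI[OF G])
    fix x :: "complex vec" assume x: "x \<in> carrier_vec m" "?G *\<^sub>v x = 0\<^sub>v m"
    have "(A *\<^sub>v x) \<bullet>c (A *\<^sub>v x) = x \<bullet>c (?G *\<^sub>v x)"
      using A x by (simp add: cscalar_prod_adj[OF A] mult_vec_assoc_dim)
    then have "A *\<^sub>v x = 0\<^sub>v n"
      using x A cscalar_prod_self_eq_0[of "A *\<^sub>v x" n] by simp
    then show "x = 0\<^sub>v m" using inj x by blast
  qed
  then obtain H where "H \<in> carrier_mat m m" "H * ?G = 1\<^sub>m m" using det_nonzero_inverse[OF G] by blast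
  then show thesis using that[of "H * adj A"] A by (auto simp: mult_assoc_dim)
qed

text \<open>The columns of \<open>W\<close> complete \<open>v\<close> to an orthogonal basis, so
  \<open>W * adj W\<close> is the orthogonal projection onto the complement of \<open>v\<close>, and
  a matrix that kills \<open>v\<close> absorbs it. Deflating kernel vectors in this way keeps the
  accumulated matrix an isometry.\<close>

lemma unit_complement:
  assumes v: "v \<in> carrier_vec n" "v \<noteq> 0\<^sub>v n"
  obtains W where "W \<in> carrier_mat n (n - 1)" "adj W * W = 1\<^sub>m (n - 1)"
    "\<And>k M. M \<in> carrier_mat k n \<Longrightarrow> M *\<^sub>v v = 0\<^sub>v k \<Longrightarrow> M * (W * adj W) = M"
proof -
  interpret cof_vec_space n "TYPE(complex)" .
  define ws where "ws = gram_schmidt n (basis_completion v)"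
  note bc = basis_completion[OF v]
  note gs = gram_schmidt_result[OF bc(2,4,5) ws_def]
  have n: "n > 0" using v by (cases n) auto
  have len: "length ws = n" using gs(4) bc(6) by simp
  have ws0: "ws ! 0 = v"
  proof -
    have "basis_completion v \<noteq> []" using bc(6) n by auto
    then have "basis_completion v = v # tl (basis_completion v)" using bc(7) by (metis list.collapse)
    then have "hd ws = v" unfolding ws_def using gram_schmidt_hd v by metis
    then show ?thesis using len n by (metis hd_conv_nth length_0_conv neq0_conv)
  qed
  have wsc: "ws ! i \<in> carrier_vec n" if "i < n" for i using gs(3) len that by auto
  have orth: "ws ! i \<bullet>c ws ! j = 0 \<longleftrightarrow> i \<noteq> j" if "i < n" "j < n" for i j
    using corthogonalD[OF gs(2)] that len by auto
  have ex: "\<exists>c::real. c > 0 \<and> ws ! i \<bullet>c ws ! i = of_real c" if "i < n" for i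
  proof -
    have "ws ! i \<noteq> 0\<^sub>v n" using orth[OF that that] by auto
    then show ?thesis using cscalar_prod_nonzero[OF wsc[OF that]] by metis
  qed
  then obtain c where c: "\<And>i. i < n \<Longrightarrow> c i > 0 \<and> ws ! i \<bullet>c ws ! i = of_real (c i :: real)" by metis
  \<comment> \<open>\<open>gram_schmidt\<close> orthogonalizes without normalizing;
    \<open>c j\<close> is the squared norm of vector \<open>j\<close>.\<close>
  define U where "U = mat n n (\<lambda>(i,j). (ws ! j) $ i / of_real (sqrt (c j)))"
  have U: "U \<in> carrier_mat n n" by (simp add: U_def)
  have ipr: "(\<Sum>k<n. cnj (ws ! i $ k) * ws ! j $ k) = (if i = j then of_real (c i) else 0)"
    if "i < n" "j < n" for i j
  proof -
    have "ws ! j \<bullet>c ws ! i = (\<Sum>k<n. cnj (ws ! i $ k) * ws ! j $ k)"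
      using wsc[OF that(1)] wsc[OF that(2)]
      by (auto simp: scalar_prod_def lessThan_atLeast0 mult.commute intro!: sum.cong)
    then show ?thesis using c[OF that(1)] orth[OF that(2,1)] by auto
  qed
  have UU: "adj U * U = 1\<^sub>m n"
  proof (rule eq_matI)
    fix i j assume "i < dim_row (1\<^sub>m n :: complex mat)" "j < dim_col (1\<^sub>m n :: complex mat)"
    then have ij: "i < n" "j < n" by auto
    have "(adj U * U) $$ (i,j) = (\<Sum>k<n. cnj (ws ! i $ k) * ws ! j $ k) / (of_real (sqrt (c i)) * of_real (sqrt (c j)))"
      using ij U by (auto simp: scalar_prod_def lessThan_atLeast0 U_def sum_divide_distrib intro!: sum.cong)
    also have "\<dots> = (if i = j then 1 else 0)"
      using ipr[OF ij] c[OF ij(1)] by (auto simp flip: of_real_mult)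
    finally show "(adj U * U) $$ (i,j) = 1\<^sub>m n $$ (i,j)" using ij by simp
  qed (auto simp: U_def)
  then have UU': "U * adj U = 1\<^sub>m n"
    using mat_mult_left_right_inverse[of "adj U" n U] U by auto
  define W where "W = mat n (n - 1) (\<lambda>(i,j). U $$ (i, Suc j))"
  have W: "W \<in> carrier_mat n (n - 1)" by (simp add: W_def)
  have WW: "adj W * W = 1\<^sub>m (n - 1)"
  proof (rule eq_matI)
    fix i j assume "i < dim_row (1\<^sub>m (n-1) :: complex mat)" "j < dim_col (1\<^sub>m (n-1) :: complex mat)"
    then have ij: "i < n - 1" "j < n - 1" by auto
    then have "(adj W * W) $$ (i,j) = (adj U * U) $$ (Suc i, Suc j)"
      using U by (auto simp: scalar_prod_def W_def intro!: sum.cong)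
    then show "(adj W * W) $$ (i,j) = 1\<^sub>m (n-1) $$ (i,j)" using UU ij by simp
  qed (auto simp: W_def)
  have "M * (W * adj W) = M" if M: "M \<in> carrier_mat k n" and Mv: "M *\<^sub>v v = 0\<^sub>v k" for k M
  proof -
    have "M * (W * adj W) = (M * W) * adj W" using M W by (simp add: mult_assoc_dim)
    also have "\<dots> = (M * U) * adj U"
    proof (rule eq_matI)
      fix i j assume "i < dim_row (M * U * adj U)" "j < dim_col (M * U * adj U)"
      then have ij: "i < k" "j < n" using M U by auto
      \<comment> \<open>Column 0 of \<open>U\<close> is a multiple of \<open>v\<close>, so the sums
        over the columns of \<open>U\<close> and of \<open>W\<close> differ by a zero term
        only.\<close>
      have MU0: "(M * U) $$ (i, 0) = 0"
      proof -
        have "(M * U) $$ (i, 0) = (M *\<^sub>v v) $ i / of_real (sqrt (c 0))"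
          using ij M n wsc[OF n] ws0 by (auto simp: scalar_prod_def U_def sum_divide_distrib intro!: sum.cong)
        then show ?thesis using Mv ij by simp
      qed
      have MW: "(M * W) $$ (i, l) = (M * U) $$ (i, Suc l)" if "l < n - 1" for l
        using that ij M U W by (auto simp: scalar_prod_def W_def intro!: sum.cong)
      have "(M * U * adj U) $$ (i,j) = (\<Sum>l<n. (M * U) $$ (i,l) * cnj (U $$ (j,l)))"
        using ij M U by (subst index_mult_sum[of _ k n _ n]) (auto simp del: index_mult_mat(1))
      also have "\<dots> = (\<Sum>l<n-1. (M * U) $$ (i,Suc l) * cnj (U $$ (j,Suc l)))"
        using n MU0 by (cases n) (auto simp del: index_mult_mat(1) sum.lessThan_Suc simp: sum.lessThan_Suc_shift)
      also have "\<dots> = (\<Sum>l<n-1. (M * W) $$ (i,l) * cnj (W $$ (j,l)))"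
        using MW ij by (intro sum.cong refl) (auto simp: W_def simp del: index_mult_mat(1))
      also have "\<dots> = (M * W * adj W) $$ (i,j)"
        using ij M W by (subst index_mult_sum[of "M * W" k "n - 1" _ n]) (auto simp del: index_mult_mat(1) intro!: sum.cong)
      finally show "(M * W * adj W) $$ (i,j) = (M * U * adj U) $$ (i,j)" by simp
    qed (use M W U in auto)
    also have "\<dots> = M" using M U UU' by (simp add: mult_assoc_dim)
    finally show ?thesis .
  qed
  then show thesis using that W WW by blast
qed

subsection \<open>Rank factorizations and the spectrum of products\<close>

text \<open>The one-sided inverses express full column rank of \<open>F\<close> and full row rank of
  \<open>G\<close> in a form that can be multiplied out. A kernel vector of \<open>M\<close> is
  removed by passing to its orthogonal complement, which lowers the number of columns; if there is
  none, \<open>M\<close> itself is the left factor.\<close>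

lemma rank_factorization:
  fixes M :: "complex mat"
  assumes "M \<in> carrier_mat k n"
  obtains m F G L R where "F \<in> carrier_mat k m" "G \<in> carrier_mat m n"
    "L \<in> carrier_mat m k" "R \<in> carrier_mat n m" "M = F * G" "L * F = 1\<^sub>m m" "G * R = 1\<^sub>m m"
proof -
  have "\<exists>m F G L R. F \<in> carrier_mat k m \<and> G \<in> carrier_mat m n \<and> L \<in> carrier_mat m k \<and>
    R \<in> carrier_mat n m \<and> M = F * G \<and> L * F = 1\<^sub>m m \<and> G * R = 1\<^sub>m m"
    using assms
  proof (induction n arbitrary: M)
    case (0 M)
    show ?case
      using 0 by (intro exI[of _ 0] exI[of _ M] exI[of _ "1\<^sub>m 0"] exI[of _ "0\<^sub>m 0 k"]) auto
  next
    case (Suc n M)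
    show ?case
    proof (cases "\<forall>x. x \<in> carrier_vec (Suc n) \<longrightarrow> M *\<^sub>v x = 0\<^sub>v k \<longrightarrow> x = 0\<^sub>v (Suc n)")
      case True
      then obtain L where "L \<in> carrier_mat (Suc n) k" "L * M = 1\<^sub>m (Suc n)"
        using injective_left_inverse[OF Suc.prems] by blast
      then show ?thesis using Suc.prems
        by (intro exI[of _ "Suc n"] exI[of _ M] exI[of _ "1\<^sub>m (Suc n)"] exI[of _ L]) auto
    next
      case False
      then obtain v where v: "v \<in> carrier_vec (Suc n)" "M *\<^sub>v v = 0\<^sub>v k" "v \<noteq> 0\<^sub>v (Suc n)" by blast
      obtain W where W: "W \<in> carrier_mat (Suc n) n" "adj W * W = 1\<^sub>m n"
        and MW: "\<And>k M. M \<in> carrier_mat k (Suc n) \<Longrightarrow> M *\<^sub>v v = 0\<^sub>v k \<Longrightarrow> M * (W * adj W) = M"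
        using unit_complement[OF v(1,3)] by (metis diff_Suc_1)
      have "M * W \<in> carrier_mat k n" using W Suc.prems by auto
      from Suc.IH[OF this] obtain m F G L R where
        *: "F \<in> carrier_mat k m" "G \<in> carrier_mat m n" "L \<in> carrier_mat m k" "R \<in> carrier_mat n m"
          "M * W = F * G" "L * F = 1\<^sub>m m" "G * R = 1\<^sub>m m" by blast
      have "M = (M * W) * adj W" using MW[OF Suc.prems v(2)] W Suc.prems by (simp add: mult_assoc_dim)
      also have "\<dots> = F * (G * adj W)" using * W by (simp add: mult_assoc_dim)
      finally have M: "M = F * (G * adj W)" .
      have "(G * adj W) * (W * R) = 1\<^sub>m m"
        using * W by (simp add: mult_assoc_dim mult_cancel_inverse[OF W(2)])
      moreover have "G * adj W \<in> carrier_mat m (Suc n)" "W * R \<in> carrier_mat (Suc n) m"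
        using *(2,4) W(1) by auto
      ultimately show ?thesis using *(1,3,6) M by blast
    qed
  qed
  then show thesis using that by blast
qed

text \<open>\<open>E = 1 - P * L\<close> is the projection onto the kernel of \<open>L\<close> along
  the range of \<open>P\<close>. Its full-rank factorization \<open>Q * K\<close> supplies the
  complement, and \<open>E * P = 0\<close>, \<open>L * E = 0\<close>, \<open>E * E = E\<close> turn
  into the stated identities once \<open>Q\<close> and \<open>K\<close> are cancelled.\<close>

lemma oblique_complement:
  fixes P L :: "complex mat"
  assumes P: "P \<in> carrier_mat n p" and L: "L \<in> carrier_mat p n" and LP: "L * P = 1\<^sub>m p"
  obtains q Q K where "Q \<in> carrier_mat n q" "K \<in> carrier_mat q n" "n = p + q"
    "K * Q = 1\<^sub>m q" "L * Q = 0\<^sub>m p q" "K * P = 0\<^sub>m q p" "P * L + Q * K = 1\<^sub>m n"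
proof -
  define E where "E = 1\<^sub>m n - P * L"
  have PLc: "P * L \<in> carrier_mat n n" using P L by auto
  have E: "E \<in> carrier_mat n n" unfolding E_def using PLc by (rule minus_carrier_mat)
  have EP: "E * P = 0\<^sub>m n p"
  proof -
    have "E * P = 1\<^sub>m n * P - P * L * P" unfolding E_def
      using P PLc by (intro minus_mult_distrib_mat) auto
    also have "P * L * P = P" using P L LP by (simp add: mult_assoc_dim)
    finally show ?thesis using P by auto
  qed
  have LE: "L * E = 0\<^sub>m p n"
  proof -
    have "L * E = L * 1\<^sub>m n - L * (P * L)" unfolding E_def
      using L PLc by (intro mult_minus_distrib_mat) auto
    also have "L * (P * L) = L" using P L by (simp add: mult_cancel_inverse[OF LP])
    finally show ?thesis using L by auto
  qed
  have EE: "E * E = E"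
  proof -
    have "E * E = E * 1\<^sub>m n - E * (P * L)" 
      by (subst (2) E_def, rule mult_minus_distrib_mat[OF E _ PLc]) auto
    also have "E * (P * L) = 0\<^sub>m n n" using EP P L E by (simp flip: mult_assoc_dim)
    finally show ?thesis using E by auto
  qed
  obtain q Q K L' R' where *: "Q \<in> carrier_mat n q" "K \<in> carrier_mat q n"
    "L' \<in> carrier_mat q n" "R' \<in> carrier_mat n q" "E = Q * K" "L' * Q = 1\<^sub>m q" "K * R' = 1\<^sub>m q"
    using rank_factorization[OF E] .
  have canc: "X = Y" if "X \<in> carrier_mat q m" "Y \<in> carrier_mat q m" "Q * X = Q * Y" for X Y m
  proof -
    have "L' * (Q * X) = X"
      by (rule mult_cancel_inverse[OF *(6)]) (use that(1,2) *(1,3) in auto)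
    moreover have "L' * (Q * Y) = Y"
      by (rule mult_cancel_inverse[OF *(6)]) (use that(1,2) *(1,3) in auto)
    ultimately show ?thesis using that(3) by metis
  qed
  have canc': "X = Y" if "X \<in> carrier_mat m q" "Y \<in> carrier_mat m q" "X * K = Y * K" for X Y m
  proof -
    have "X * (K * R') = (X * K) * R'" "Y * (K * R') = (Y * K) * R'"
      by (rule mult_assoc_dim[symmetric]; use that(1,2) *(2,4) in auto)+
    then have "X * 1\<^sub>m q = Y * 1\<^sub>m q" using that(3) *(7) by metis
    then show ?thesis using that(1,2) by auto
  qed
  have KQ: "K * Q = 1\<^sub>m q"
  proof (rule canc'[of _ q])
    show "K * Q * K = 1\<^sub>m q * K"
    proof (rule canc[of _ n])
      show "Q * (K * Q * K) = Q * (1\<^sub>m q * K)"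
        using EE *(1,2) unfolding *(5) by (simp add: mult_assoc_dim)
    qed (use *(1,2) in auto)
  qed (use *(1,2) in auto)
  have KP: "K * P = 0\<^sub>m q p"
  proof (rule canc[of _ p])
    show "Q * (K * P) = Q * 0\<^sub>m q p"
      using EP *(1,2) P unfolding *(5) by (simp add: mult_assoc_dim)
  qed (use *(2) P in auto)
  have LQ: "L * Q = 0\<^sub>m p q"
  proof (rule canc'[of _ p])
    show "L * Q * K = 0\<^sub>m p q * K"
      using LE *(1,2) L unfolding *(5) by (simp add: mult_assoc_dim)
  qed (use *(1) L in auto)
  have sum: "P * L + Q * K = 1\<^sub>m n"
    unfolding *(5)[symmetric] E_def using P L by (intro eq_matI) auto
  \<comment> \<open>\<open>S\<close> is \<open>[P Q]\<close> and \<open>T\<close> is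
    \<open>L\<close> stacked on \<open>K\<close>; empty blocks turn both into four-block matrices.
    The two products with identity result give one inequality each between \<open>n\<close> and
    \<open>p + q\<close>.\<close>
  define S where "S = four_block_mat P Q (0\<^sub>m 0 p) (0\<^sub>m 0 q)"
  define T where "T = four_block_mat L (0\<^sub>m p 0) K (0\<^sub>m q 0)"
  have S: "S \<in> carrier_mat (n + 0) (p + q)" unfolding S_def using P * by (intro four_block_carrier_mat) auto
  have T: "T \<in> carrier_mat (p + q) (n + 0)" unfolding T_def using L * by auto
  have "T * S = four_block_mat (L * P + 0\<^sub>m p 0 * 0\<^sub>m 0 p) (L * Q + 0\<^sub>m p 0 * 0\<^sub>m 0 q)
     (K * P + 0\<^sub>m q 0 * 0\<^sub>m 0 p) (K * Q + 0\<^sub>m q 0 * 0\<^sub>m 0 q)"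
    unfolding S_def T_def using P L * by (intro mult_four_block_mat) auto
  also have "\<dots> = 1\<^sub>m (p + q)"
    unfolding LP LQ KP KQ by (intro eq_matI) (auto simp: scalar_prod_def)
  finally have TS: "T * S = 1\<^sub>m (p + q)" .
  have le1: "p + q \<le> n" using left_inverse_dim_le[OF S T] TS by simp
  have "S * T = four_block_mat (P * L + Q * K) (P * 0\<^sub>m p 0 + Q * 0\<^sub>m q 0)
     (0\<^sub>m 0 p * L + 0\<^sub>m 0 q * K) (0\<^sub>m 0 p * 0\<^sub>m p 0 + 0\<^sub>m 0 q * 0\<^sub>m q 0)"
    unfolding S_def T_def using P L * by (intro mult_four_block_mat) auto
  also have "\<dots> = 1\<^sub>m (n + 0)"
    unfolding sum by (intro eq_matI) auto
  finally have "S * T = 1\<^sub>m (n + 0)" .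
  then have le2: "n \<le> p + q" using left_inverse_dim_le[OF T S] by simp
  show thesis using that[of Q q K] * KQ LQ KP sum le1 le2 by auto
qed

text \<open>This is the bridge from one-sided inverses to \<open>vec_space.rank\<close>: the right
  inverse of \<open>G\<close> shows that \<open>F * G\<close> and \<open>F\<close> have the same
  column space, and the left inverse of \<open>F\<close> that its columns are independent.\<close>

lemma rank_product:
  fixes F G :: "complex mat"
  assumes F: "F \<in> carrier_mat n r" and G: "G \<in> carrier_mat r m"
    and L: "L \<in> carrier_mat r n" "L * F = 1\<^sub>m r" and R: "R \<in> carrier_mat m r" "G * R = 1\<^sub>m r"
  shows "vec_space.rank n (F * G) = r"
proof -
  interpret vec_space "TYPE(complex)" n .
  have FG: "F * G \<in> carrier_mat n m" using F G by auto
  have "col_space (F * G) = col_space F"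
  proof -
    have "\<exists>y\<in>carrier_vec r. F *\<^sub>v y = (F * G) *\<^sub>v x" if "x \<in> carrier_vec m" for x
      using that F G by (intro bexI[of _ "G *\<^sub>v x"]) (auto simp: mult_vec_assoc_dim)
    moreover have "\<exists>x\<in>carrier_vec m. (F * G) *\<^sub>v x = F *\<^sub>v y" if y: "y \<in> carrier_vec r" for y
    proof -
      have "(F * G) *\<^sub>v (R *\<^sub>v y) = F *\<^sub>v ((G * R) *\<^sub>v y)"
        using y F G R(1) by (simp add: mult_vec_assoc_dim del: R(2))
      then show ?thesis using y R by (intro bexI[of _ "R *\<^sub>v y"]) auto
    qed
    ultimately show ?thesis
      unfolding col_space_eq[OF FG] col_space_eq[OF F] using F G by fastforce
  qed
  then have "rank (F * G) = rank F" by (simp add: rank_def col_space_def)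
  also have "\<dots> = r"
  proof (rule lin_indpt_full_rank[OF F])
    show dist: "distinct (cols F)"
    proof (unfold distinct_conv_nth, intro allI impI)
      fix i j assume ij: "i < length (cols F)" "j < length (cols F)" "i \<noteq> j"
      then have ij': "i < r" "j < r" using F by auto
      show "cols F ! i \<noteq> cols F ! j"
      proof
        assume "cols F ! i = cols F ! j"
        then have "L *\<^sub>v col F i = L *\<^sub>v col F j" using ij by simp
        then have "col (L * F) i = col (L * F) j" 
          using ij' by (simp only: col_mult2[OF L(1) F])
        then have "col (L * F) i $ i = col (L * F) j $ i" by simp
        then show False using ij' ij(3) L(2) by simp
      qed
    qed
    show "lin_indpt (set (cols F))"
    proof
      assume "lin_dep (set (cols F))"
      then obtain v where v: "v \<in> carrier_vec r" "v \<noteq> 0\<^sub>v r" "F *\<^sub>v v = 0\<^sub>v n"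
        using lin_depE[OF F _ dist] by blast
      have "(L * F) *\<^sub>v v = L *\<^sub>v (F *\<^sub>v v)" using v F L(1) by (simp add: mult_vec_assoc_dim)
      then show False using v L mult_mat_vec_zero[of L n] by auto
    qed
  qed
  finally show ?thesis .
qed

section \<open>Characteristic polynomials and nonzero eigenvalues\<close>

lemma complex_char_poly_linear:
  fixes A :: "complex mat"
  assumes "A \<in> carrier_mat n n"
  shows "\<exists>es. char_poly A = (\<Prod>a\<leftarrow>es. [:- a, 1:])"
  using char_poly_factorized[OF assms] by blast

lemma proots_linear_factors: "proots (\<Prod>a\<leftarrow>es. [:- a, 1:]) = mset (es :: complex list)"
proof (induction es)
  case (Cons a es)
  have "(\<Prod>a\<leftarrow>es. [:- a, 1:]) \<noteq> (0 :: complex poly)"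
    by (auto simp: prod_list_zero_iff)
  then show ?case using Cons by (simp add: proots_mult del: mult_pCons_left)
qed simp

text \<open>The block matrices \<open>[[X Y, 0], [Y, 0]]\<close> and
  \<open>[[0, 0], [Y, Y X]]\<close> are similar through \<open>[[1, X], [0, 1]]\<close>. The
  characteristic polynomials of the zero blocks compensate the difference in size.\<close>

lemma char_poly_swap:
  fixes X Y :: "complex mat"
  assumes X: "X \<in> carrier_mat n m" and Y: "Y \<in> carrier_mat m n"
  shows "char_poly (X * Y) * char_poly (0\<^sub>m m m) = char_poly (0\<^sub>m n n) * char_poly (Y * X)"
proof -
  define S where "S = four_block_mat (1\<^sub>m n) X (0\<^sub>m m n) (1\<^sub>m m)"
  define S' where "S' = four_block_mat (1\<^sub>m n) (- X) (0\<^sub>m m n) (1\<^sub>m m)"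
  define M1 where "M1 = four_block_mat (X * Y) (0\<^sub>m n m) Y (0\<^sub>m m m)"
  define M2 where "M2 = four_block_mat (0\<^sub>m n n) (0\<^sub>m n m) Y (Y * X)"
  have c: "S \<in> carrier_mat (n+m) (n+m)" "S' \<in> carrier_mat (n+m) (n+m)"
    "M1 \<in> carrier_mat (n+m) (n+m)" "M2 \<in> carrier_mat (n+m) (n+m)"
    using X Y unfolding S_def S'_def M1_def M2_def by auto
  have nX: "- X \<in> carrier_mat n m" using X by auto
  have one: "four_block_mat (1\<^sub>m n) (0\<^sub>m n m) (0\<^sub>m m n) (1\<^sub>m m) = (1\<^sub>m (n+m) :: complex mat)"
    by (rule four_block_one_mat)
  have SS': "S * S' = 1\<^sub>m (n+m)"
  proof -
    have "S * S' = four_block_mat (1\<^sub>m n * 1\<^sub>m n + X * 0\<^sub>m m n) (1\<^sub>m n * (- X) + X * 1\<^sub>m m)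
      (0\<^sub>m m n * 1\<^sub>m n + 1\<^sub>m m * 0\<^sub>m m n) (0\<^sub>m m n * (- X) + 1\<^sub>m m * 1\<^sub>m m)"
      unfolding S_def S'_def using X nX by (intro mult_four_block_mat) auto
    also have "\<dots> = four_block_mat (1\<^sub>m n) (0\<^sub>m n m) (0\<^sub>m m n) (1\<^sub>m m)"
      using X by (intro arg_cong4[of _ _ _ _ _ _ _ _ four_block_mat]) (auto intro!: eq_matI)
    finally show ?thesis using one by simp
  qed
  have S'S: "S' * S = 1\<^sub>m (n+m)"
    using mat_mult_left_right_inverse[OF c(1,2) SS'] .
  have XYX: "X * Y * X = X * (Y * X)" using X Y by (simp add: mult_assoc_dim)
  have "M1 * S = four_block_mat (X * Y * 1\<^sub>m n + 0\<^sub>m n m * 0\<^sub>m m n) (X * Y * X + 0\<^sub>m n m * 1\<^sub>m m)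
     (Y * 1\<^sub>m n + 0\<^sub>m m m * 0\<^sub>m m n) (Y * X + 0\<^sub>m m m * 1\<^sub>m m)"
    unfolding S_def M1_def using X Y by (intro mult_four_block_mat) auto
  also have "\<dots> = four_block_mat (X * Y) (X * (Y * X)) Y (Y * X)"
    unfolding XYX using X Y by (intro arg_cong4[of _ _ _ _ _ _ _ _ four_block_mat]) (auto simp: mult_carrier_mat)
  also have "\<dots> = four_block_mat (1\<^sub>m n * 0\<^sub>m n n + X * Y) (1\<^sub>m n * 0\<^sub>m n m + X * (Y * X))
     (0\<^sub>m m n * 0\<^sub>m n n + 1\<^sub>m m * Y) (0\<^sub>m m n * 0\<^sub>m n m + 1\<^sub>m m * (Y * X))"
    using X Y by (intro arg_cong4[of _ _ _ _ _ _ _ _ four_block_mat]) auto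
  also have "\<dots> = S * M2"
    unfolding S_def M2_def using X Y by (intro mult_four_block_mat[symmetric]) auto
  finally have MS: "M1 * S = S * M2" .
  have "M1 = M1 * (S * S')" using SS' c by simp
  also have "\<dots> = (M1 * S) * S'" using c by (simp add: mult_assoc_dim)
  also have "\<dots> = S * M2 * S'" using MS by simp
  finally have "similar_mat M1 M2"
    using c SS' S'S by (intro similar_matI[of _ _ S S' "n+m"]) auto
  then have "char_poly M1 = char_poly M2" by (rule char_poly_similar)
  moreover have "char_poly M1 = char_poly (X * Y) * char_poly (0\<^sub>m m m)"
    using X Y by (intro char_poly_0_block'[OF M1_def] complex_char_poly_linear[of _ n]
      complex_char_poly_linear[of _ m]) auto
  moreover have "char_poly M2 = char_poly (0\<^sub>m n n) * char_poly (Y * X)"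
    using X Y by (intro char_poly_0_block'[OF M2_def] complex_char_poly_linear[of _ n]
      complex_char_poly_linear[of _ m]) auto
  ultimately show ?thesis by simp
qed

lemma char_poly_nonzero: "(A :: complex mat) \<in> carrier_mat n n \<Longrightarrow> char_poly A \<noteq> 0"
  using degree_monic_char_poly[of A n] by auto

text \<open>In \<open>char_poly_swap\<close> the zero blocks contribute only the root 0, which the
  filter discards.\<close>

lemma nonzero_eigenvalues_swap:
  fixes X Y :: "complex mat"
  assumes X: "X \<in> carrier_mat n m" and Y: "Y \<in> carrier_mat m n"
  shows "nonzero_eigenvalues (X * Y) = nonzero_eigenvalues (Y * X)"
proof -
  have nz: "char_poly (X * Y) \<noteq> 0" "char_poly (Y * X) \<noteq> 0" 
    "char_poly (0\<^sub>m k k) \<noteq> (0 :: complex poly)" for k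
    using X Y char_poly_nonzero[of _ n] char_poly_nonzero[of _ m] char_poly_nonzero[of _ k] by auto
  have z: "filter_mset (\<lambda>z. z \<noteq> 0) (proots (char_poly (0\<^sub>m k k :: complex mat))) = {#}" for k
  proof -
    have "char_poly (0\<^sub>m k k :: complex mat) = (\<Prod>a\<leftarrow>diag_mat (0\<^sub>m k k). [:- a, 1:])"
      by (rule char_poly_upper_triangular) auto
    then have "proots (char_poly (0\<^sub>m k k :: complex mat)) = mset (diag_mat (0\<^sub>m k k))"
      by (simp only: proots_linear_factors)
    then show ?thesis 
      by (intro multiset_eqI) (auto simp: diag_mat_def count_eq_zero_iff)
  qed
  from char_poly_swap[OF X Y] have "proots (char_poly (X * Y)) + proots (char_poly (0\<^sub>m m m)) =
    proots (char_poly (0\<^sub>m n n)) + proots (char_poly (Y * X))"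
    using nz by (metis proots_mult)
  then have "filter_mset (\<lambda>z. z \<noteq> 0) (proots (char_poly (X * Y)) + proots (char_poly (0\<^sub>m m m))) =
    filter_mset (\<lambda>z. z \<noteq> 0) (proots (char_poly (0\<^sub>m n n)) + proots (char_poly (Y * X)))" by simp
  then show ?thesis unfolding nonzero_eigenvalues_def by (simp add: z)
qed

lemma nonzero_eigenvalues_invertible:
  fixes N :: "complex mat"
  assumes N: "N \<in> carrier_mat r r" and "det N \<noteq> 0"
    and es: "char_poly N = (\<Prod>a\<leftarrow>es. [:- a, 1:])"
  shows "nonzero_eigenvalues N = mset es" "length es = r" "0 \<notin> set es"
proof -
  have "poly (char_poly N) 0 \<noteq> 0"
  proof
    assume "poly (char_poly N) 0 = 0"
    then have "eigenvalue N 0" using eigenvalue_root_char_poly[OF N] by simp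
    then obtain v where "v \<in> carrier_vec r" "v \<noteq> 0\<^sub>v r" "N *\<^sub>v v = 0 \<cdot>\<^sub>v v"
      using N unfolding eigenvalue_def eigenvector_def by auto
    moreover from this have "0 \<cdot>\<^sub>v v = 0\<^sub>v r" by (intro eq_vecI) auto
    ultimately show False using det_nonzeroD[OF N assms(2), of v] by auto
  qed
  then show es0: "0 \<notin> set es" unfolding es by (auto simp: poly_prod_list prod_list_zero_iff)
  have "filter_mset (\<lambda>z. z \<noteq> 0) (mset es) = mset es"
    unfolding filter_mset_eq_conv using es0 by auto
  then show "nonzero_eigenvalues N = mset es"
    unfolding nonzero_eigenvalues_def es proots_linear_factors .
  have "degree (char_poly N) = length es" unfolding es by (rule degree_linear_factors)
  then show "length es = r" using degree_monic_char_poly[OF N] by simp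
qed

subsection \<open>Accretive matrices\<close>

text \<open>The geometric content is a closed half-plane around \<open>cis \<gamma>\<close> that
  contains the angular numerical range. The centre is a parameter, so that a matrix and its
  compressions can be studied with the same one.\<close>

definition accretive :: "real \<Rightarrow> complex mat \<Rightarrow> bool" where
  "accretive \<gamma> M \<longleftrightarrow> (\<forall>x \<in> carrier_vec (dim_row M). 0 \<le> Re (cis (- \<gamma>) * quad_form M x))"

lemma cscalar_prod_swap:
  fixes x y :: "complex vec"
  assumes "x \<in> carrier_vec n" "y \<in> carrier_vec n"
  shows "y \<bullet>c x = cnj (x \<bullet>c y)"
  using assms by (auto simp: scalar_prod_def mult.commute intro!: sum.cong)

lemma quad_form_adj:
  assumes "M \<in> carrier_mat n n" "x \<in> carrier_vec n"
  shows "quad_form (adj M) x = cnj (quad_form M x)"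
  unfolding quad_form_def
  using assms cscalar_prod_adj[of "adj M" n n x x] cscalar_prod_swap[of "M *\<^sub>v x" n x] by simp

lemma quad_form_add_mat:
  assumes "M \<in> carrier_mat n n" "N \<in> carrier_mat n n" "x \<in> carrier_vec n"
  shows "quad_form (M + N) x = quad_form M x + quad_form N x"
  using assms unfolding quad_form_def
  by (auto simp: add_mult_distrib_mat_vec[of _ n n] intro!: add_scalar_prod_distrib[of _ n])

lemma mult_mat_vec_add:
  fixes M :: "complex mat"
  assumes "M \<in> carrier_mat n m" "x \<in> carrier_vec m" "y \<in> carrier_vec m"
  shows "M *\<^sub>v (x + s \<cdot>\<^sub>v y) = M *\<^sub>v x + s \<cdot>\<^sub>v (M *\<^sub>v y)"
  using assms by (simp add: mult_add_distrib_mat_vec mult_mat_vec)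

lemma quad_form_add_smult:
  assumes "M \<in> carrier_mat n n" "x \<in> carrier_vec n" "y \<in> carrier_vec n"
  shows "quad_form M (x + s \<cdot>\<^sub>v y) =
    quad_form M x + cnj s * ((M *\<^sub>v x) \<bullet>c y) + s * ((M *\<^sub>v y) \<bullet>c x) + s * cnj s * quad_form M y"
proof -
  have "conjugate (x + s \<cdot>\<^sub>v y) = conjugate x + cnj s \<cdot>\<^sub>v conjugate y"
    using assms by (simp add: conjugate_add_vec[of _ n] conjugate_smult_vec)
  then have "quad_form M (x + s \<cdot>\<^sub>v y) =
    (M *\<^sub>v x + s \<cdot>\<^sub>v (M *\<^sub>v y)) \<bullet> (conjugate x + cnj s \<cdot>\<^sub>v conjugate y)"
    unfolding quad_form_def by (simp add: mult_mat_vec_add[OF assms])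
  also have "\<dots> = (M *\<^sub>v x) \<bullet> (conjugate x + cnj s \<cdot>\<^sub>v conjugate y)
      + s * ((M *\<^sub>v y) \<bullet> (conjugate x + cnj s \<cdot>\<^sub>v conjugate y))"
    using assms by (subst add_scalar_prod_distrib[of _ n]) auto
  also have "\<dots> = quad_form M x + cnj s * ((M *\<^sub>v x) \<bullet>c y) + s * ((M *\<^sub>v y) \<bullet>c x) + s * cnj s * quad_form M y"
    unfolding quad_form_def using assms
    by (subst (1 2) scalar_prod_add_distrib[of _ n]) (auto simp: algebra_simps)
  finally show ?thesis .
qed

text \<open>A step from \<open>x\<close> against \<open>y = N x\<close> lowers the form at first
  order by \<open>2 * t * d\<close>, where \<open>d\<close> is the squared norm of \<open>y\<close>,
  and the second-order term cannot make up for it when \<open>t\<close> is small.\<close>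

lemma psd_kernel:
  assumes N: "N \<in> carrier_mat n n" and herm: "adj N = N"
    and psd: "\<And>x. x \<in> carrier_vec n \<Longrightarrow> 0 \<le> Re (quad_form N x)"
    and x: "x \<in> carrier_vec n" "Re (quad_form N x) = 0"
  shows "N *\<^sub>v x = 0\<^sub>v n"
proof (rule ccontr)
  define y where "y = N *\<^sub>v x"
  assume "N *\<^sub>v x \<noteq> 0\<^sub>v n"
  then have y: "y \<in> carrier_vec n" "y \<noteq> 0\<^sub>v n" using N x by (auto simp: y_def)
  obtain d :: real where d: "d > 0" "y \<bullet>c y = of_real d" using cscalar_prod_nonzero[OF y] .
  have 1: "(N *\<^sub>v x) \<bullet>c y = of_real d" using d by (simp add: y_def)
  have 2: "(N *\<^sub>v y) \<bullet>c x = of_real d"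
    using cscalar_prod_adj[OF N y(1) x(1)] herm d by (simp add: y_def)
  define h where "h = Re (quad_form N y)"
  \<comment> \<open>With this size \<open>t * h \<le> d\<close>, whereas nonnegativity of the form
    would force \<open>2 * d \<le> t * h\<close>. The summand 1 keeps the denominator positive when
    \<open>h = 0\<close>.\<close>
  define t where "t = d / (h + 1)"
  have h: "h \<ge> 0" using psd y by (simp add: h_def)
  have t: "t > 0" using d h by (simp add: t_def)
  have "0 \<le> Re (quad_form N (x + of_real (- t) \<cdot>\<^sub>v y))"
    using x y by (intro psd) auto
  also have "\<dots> = - 2 * t * d + t * t * h"
    by (subst quad_form_add_smult[OF N x(1) y(1)]) (simp add: 1 2 x(2) h_def)
  finally have "t * (2 * d) \<le> t * (t * h)" by (simp add: mult_ac)
  then have "2 * d \<le> t * h" using t by simp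
  moreover have "t * h \<le> t * (h + 1)" using t by simp
  moreover have "t * (h + 1) = d" using h by (simp add: t_def)
  ultimately show False using d by linarith
qed

lemma smult_mat_vec:
  fixes M :: "complex mat"
  assumes "M \<in> carrier_mat n m" "x \<in> carrier_vec m"
  shows "(c \<cdot>\<^sub>m M) *\<^sub>v x = c \<cdot>\<^sub>v (M *\<^sub>v x)"
  using assms by (intro eq_vecI) (auto simp: scalar_prod_def sum_distrib_left mult.assoc)

text \<open>\<open>N\<close> is twice the Hermitian part of the rotated matrix. It is positive
  semidefinite by accretivity, so a vector at which its form vanishes lies in its kernel.\<close>

lemma accretive_isotropic:
  assumes M: "M \<in> carrier_mat n n" and acc: "accretive \<gamma> M"
    and x: "x \<in> carrier_vec n" "Re (cis (- \<gamma>) * quad_form M x) = 0"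
  shows "cis (- \<gamma>) \<cdot>\<^sub>v (M *\<^sub>v x) + cis \<gamma> \<cdot>\<^sub>v (adj M *\<^sub>v x) = 0\<^sub>v n"
proof -
  define N where "N = cis (- \<gamma>) \<cdot>\<^sub>m M + cis \<gamma> \<cdot>\<^sub>m adj M"
  have N: "N \<in> carrier_mat n n" using M by (auto simp: N_def)
  have q: "Re (quad_form N y) = 2 * Re (cis (- \<gamma>) * quad_form M y)" if "y \<in> carrier_vec n" for y
    unfolding N_def using M that
    by (subst quad_form_add_mat[of _ n]) (auto simp: quad_form_smult_mat[of _ n] quad_form_adj[of _ n])
  have "N *\<^sub>v x = 0\<^sub>v n"
  proof (rule psd_kernel[OF N])
    show "adj N = N" unfolding N_def using M by (intro eq_matI) (auto simp: cis_cnj)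
    show "0 \<le> Re (quad_form N y)" if "y \<in> carrier_vec n" for y
      using acc that M q[OF that] by (auto simp: accretive_def)
  qed (use x q in auto)
  moreover have "N *\<^sub>v x = cis (- \<gamma>) \<cdot>\<^sub>v (M *\<^sub>v x) + cis \<gamma> \<cdot>\<^sub>v (adj M *\<^sub>v x)"
    unfolding N_def using M x(1)
    by (subst add_mult_distrib_mat_vec[of _ n n]) (auto simp: smult_mat_vec[of _ n n])
  ultimately show ?thesis by simp
qed

text \<open>A kernel vector is isotropic, and in the equation of \<open>accretive_isotropic\<close>
  the term with \<open>M\<close> drops out.\<close>

lemma accretive_kernel_adj:
  assumes M: "M \<in> carrier_mat n n" and acc: "accretive \<gamma> M"
    and x: "x \<in> carrier_vec n" "M *\<^sub>v x = 0\<^sub>v n"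
  shows "adj M *\<^sub>v x = 0\<^sub>v n"
proof -
  have q: "quad_form M x = 0" using x by (simp add: quad_form_def)
  have Mx: "adj M *\<^sub>v x \<in> carrier_vec n"
    by (rule mult_mat_vec_carrier[OF adj_carrier[OF M] x(1)])
  have "cis (- \<gamma>) \<cdot>\<^sub>v (M *\<^sub>v x) + cis \<gamma> \<cdot>\<^sub>v (adj M *\<^sub>v x) = 0\<^sub>v n"
    using accretive_isotropic[OF M acc x(1)] q by simp
  moreover have "cis (- \<gamma>) \<cdot>\<^sub>v 0\<^sub>v n = 0\<^sub>v n" by (intro eq_vecI) auto
  ultimately have z: "cis \<gamma> \<cdot>\<^sub>v (adj M *\<^sub>v x) = 0\<^sub>v n" using x(2) Mx by simp
  show ?thesis
  proof (rule eq_vecI)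
    fix i assume i: "i < dim_vec (0\<^sub>v n :: complex vec)"
    have "(cis \<gamma> \<cdot>\<^sub>v (adj M *\<^sub>v x)) $ i = 0" using z i by simp
    then show "(adj M *\<^sub>v x) $ i = 0\<^sub>v n $ i" using i Mx M by (simp del: index_mult_mat_vec)
  qed (use Mx M in auto)
qed

lemma accretive_compression:
  assumes "M \<in> carrier_mat n n" "accretive \<gamma> M" "P \<in> carrier_mat n m"
  shows "accretive \<gamma> (adj P * M * P)"
  unfolding accretive_def
  using assms by (auto simp: quad_form_congruence[of P n m] accretive_def)

text \<open>A kernel vector of \<open>M\<close> is one of \<open>adj M\<close> as well, so
  \<open>M\<close> is unchanged when it is projected on both sides onto the orthogonal complement.
  Repeating this leaves a nonsingular core between one isometry and its own adjoint, whereas a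
  full-rank factorization of a general matrix has unrelated outer factors.\<close>

lemma accretive_factorization:
  assumes "M \<in> carrier_mat n n" "accretive \<gamma> M"
  obtains m V N where "V \<in> carrier_mat n m" "N \<in> carrier_mat m m" "adj V * V = 1\<^sub>m m"
    "det N \<noteq> 0" "M = V * N * adj V"
proof -
  have "\<exists>m V N. V \<in> carrier_mat n m \<and> N \<in> carrier_mat m m \<and> adj V * V = 1\<^sub>m m
    \<and> det N \<noteq> 0 \<and> M = V * N * adj V"
    using assms
  proof (induction n arbitrary: M)
    case (0 M)
    then have "det M = 1" by (simp add: det_dim_zero)
    then show ?case using 0
      by (intro exI[of _ 0] exI[of _ "1\<^sub>m 0"] exI[of _ M]) auto
  next
    case (Suc n M)
    note M = Suc.prems(1)
    show ?case
    proof (cases "det M = 0")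
      case False
      then show ?thesis using M by (intro exI[of _ "Suc n"] exI[of _ "1\<^sub>m (Suc n)"] exI[of _ M]) auto
    next
      case True
      then obtain v where v: "v \<in> carrier_vec (Suc n)" "M *\<^sub>v v = 0\<^sub>v (Suc n)" "v \<noteq> 0\<^sub>v (Suc n)"
        using det_0_iff_vec_prod_zero[OF M] by blast
      have v': "adj M *\<^sub>v v = 0\<^sub>v (Suc n)" using accretive_kernel_adj[OF Suc.prems v(1,2)] .
      obtain W where W: "W \<in> carrier_mat (Suc n) n" "adj W * W = 1\<^sub>m n"
        and MW: "\<And>k M. M \<in> carrier_mat k (Suc n) \<Longrightarrow> M *\<^sub>v v = 0\<^sub>v k \<Longrightarrow> M * (W * adj W) = M"
        using unit_complement[OF v(1,3)] by (metis diff_Suc_1)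
      have 1: "M * (W * adj W) = M" using MW[OF M v(2)] .
      \<comment> \<open>The projection is self-adjoint, so taking adjoints turns its absorption on
        the right of \<open>adj M\<close> into absorption on the left of \<open>M\<close>.\<close>
      have "adj (adj M * (W * adj W)) = M" using MW[OF _ v'] M by simp
      then have 2: "W * adj W * M = M" using W M by (simp add: adj_mult mult_assoc_dim)
      define M' where "M' = adj W * M * W"
      have M': "M' \<in> carrier_mat n n" using W M by (auto simp: M'_def)
      have "accretive \<gamma> M'" unfolding M'_def using Suc.prems W by (intro accretive_compression) auto
      from Suc.IH[OF M' this] obtain m V N where
        *: "V \<in> carrier_mat n m" "N \<in> carrier_mat m m" "adj V * V = 1\<^sub>m m" "det N \<noteq> 0" "M' = V * N * adj V"
        by blast
      have "M = W * M' * adj W"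
      proof -
        have "W * M' * adj W = (W * adj W * M) * (W * adj W)"
          unfolding M'_def using W M by (simp add: mult_assoc_dim)
        then show ?thesis using 1 2 by simp
      qed
      also have "\<dots> = (W * V) * N * adj (W * V)"
        using * W by (simp add: adj_mult mult_assoc_dim)
      finally have "M = (W * V) * N * adj (W * V)" .
      moreover have "adj (W * V) * (W * V) = 1\<^sub>m m"
        using * W by (simp add: adj_mult mult_assoc_dim mult_cancel_inverse[OF W(2)])
      moreover have "W * V \<in> carrier_mat (Suc n) m" using * W by auto
      ultimately show ?thesis using * by blast
    qed
  qed
  then show thesis using that by blast
qed

subsection \<open>Congruence and block sums\<close>

lemma congruent_matI:
  assumes "M \<in> carrier_mat n n" "D \<in> carrier_mat n n" "T \<in> carrier_mat n n" "det T \<noteq> 0"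
    "M = adj T * D * T"
  shows "congruent_mat M D"
  unfolding congruent_mat_def using assms invertible_mat_iff_det[OF assms(3)] by blast

lemma congruent_matE:
  assumes "congruent_mat M D"
  obtains n T where "M \<in> carrier_mat n n" "D \<in> carrier_mat n n" "T \<in> carrier_mat n n" "det T \<noteq> 0"
    "M = adj T * D * T"
  using assms unfolding congruent_mat_def by (metis invertible_mat_iff_det)

lemma congruent_mat_refl: "M \<in> carrier_mat n n \<Longrightarrow> congruent_mat M M"
  by (rule congruent_matI[of _ n _ "1\<^sub>m n"]) auto

lemma congruent_mat_trans:
  assumes "congruent_mat A B" "congruent_mat B C"
  shows "congruent_mat A C"
proof -
  obtain n T where 1: "A \<in> carrier_mat n n" "B \<in> carrier_mat n n" "T \<in> carrier_mat n n" "det T \<noteq> 0"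
    "A = adj T * B * T" using assms(1) by (rule congruent_matE)
  obtain m S where 2: "B \<in> carrier_mat m m" "C \<in> carrier_mat m m" "S \<in> carrier_mat m m" "det S \<noteq> 0"
    "B = adj S * C * S" using assms(2) by (rule congruent_matE)
  have [simp]: "m = n" using 1 2 by auto
  have "A = adj (S * T) * C * (S * T)"
    unfolding 1(5) 2(5) using 1(3) 2(2,3) by (simp add: adj_mult mult_assoc_dim)
  moreover have "det (S * T) \<noteq> 0" using 1 2 by (simp add: det_mult[of _ n])
  ultimately show ?thesis using 1(1,3) 2(2,3) by (intro congruent_matI[of _ n _ "S * T"]) auto
qed

text \<open>All sizes are read off the arguments, so the recursion equations of
  \<open>diag_block_mat\<close> in terms of this operation hold without dimension
  hypotheses.\<close>

definition block_sum :: "complex mat \<Rightarrow> complex mat \<Rightarrow> complex mat" where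
  "block_sum A B = four_block_mat A (0\<^sub>m (dim_row A) (dim_col B)) (0\<^sub>m (dim_row B) (dim_col A)) B"

lemma diag_block_mat_Cons: "diag_block_mat (A # As) = block_sum A (diag_block_mat As)"
  by (simp add: block_sum_def Let_def)

lemma diag_block_mat_app: "diag_block_mat (As @ Bs) = block_sum (diag_block_mat As) (diag_block_mat Bs)"
  by (simp add: block_sum_def Let_def diag_block_mat_append)

lemma block_sum_carrier [simp]:
  "A \<in> carrier_mat n m \<Longrightarrow> B \<in> carrier_mat k l \<Longrightarrow> block_sum A B \<in> carrier_mat (n + k) (m + l)"
  unfolding block_sum_def by auto

lemma mult_block_sum:
  assumes "A \<in> carrier_mat n m" "B \<in> carrier_mat n' m'" "C \<in> carrier_mat m k" "D \<in> carrier_mat m' k'"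
  shows "block_sum A B * block_sum C D = block_sum (A * C) (B * D)"
proof -
  have "block_sum A B * block_sum C D =
    four_block_mat (A * C + 0\<^sub>m n m' * 0\<^sub>m m' k) (A * 0\<^sub>m m k' + 0\<^sub>m n m' * D)
      (0\<^sub>m n' m * C + B * 0\<^sub>m m' k) (0\<^sub>m n' m * 0\<^sub>m m k' + B * D)"
    unfolding block_sum_def using assms
    by (simp only: carrier_matD, intro mult_four_block_mat) auto
  also have "\<dots> = block_sum (A * C) (B * D)"
    unfolding block_sum_def using assms by (intro arg_cong4[of _ _ _ _ _ _ _ _ four_block_mat]) auto
  finally show ?thesis .
qed

lemma adj_block_sum: "adj (block_sum A B) = block_sum (adj A) (adj B)"
  unfolding block_sum_def
  by (subst adj_four_block[of _ "dim_row A" "dim_col A" _ "dim_col B" _ "dim_row B"]) auto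

lemma det_block_sum:
  assumes "A \<in> carrier_mat n n" "B \<in> carrier_mat m m"
  shows "det (block_sum A B) = det A * det B"
  unfolding block_sum_def using assms
  by (intro det_four_block_mat_upper_right_zero[of _ n _ m]) auto

lemma block_sum_mult_vec:
  assumes "A \<in> carrier_mat n p" "B \<in> carrier_mat m q" "x \<in> carrier_vec p" "y \<in> carrier_vec q"
  shows "block_sum A B *\<^sub>v (x @\<^sub>v y) = (A *\<^sub>v x) @\<^sub>v (B *\<^sub>v y)"
proof -
  have "block_sum A B *\<^sub>v (x @\<^sub>v y) = (A *\<^sub>v x + 0\<^sub>m n q *\<^sub>v y) @\<^sub>v (0\<^sub>m m p *\<^sub>v x + B *\<^sub>v y)"
    unfolding block_sum_def using assms by (simp add: four_block_mat_mult_vec[of _ n p _ q _ m])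
  also have "\<dots> = (A *\<^sub>v x) @\<^sub>v (B *\<^sub>v y)" using assms by auto
  finally show ?thesis .
qed

lemma quad_form_block_sum:
  assumes "A \<in> carrier_mat n n" "B \<in> carrier_mat m m" "x \<in> carrier_vec n" "y \<in> carrier_vec m"
  shows "quad_form (block_sum A B) (x @\<^sub>v y) = quad_form A x + quad_form B y"
proof -
  have "conjugate (x @\<^sub>v y) = conjugate x @\<^sub>v conjugate y"
    by (intro eq_vecI) (auto simp: index_append_vec)
  then show ?thesis unfolding quad_form_def block_sum_mult_vec[OF assms] using assms
    by (simp add: scalar_prod_append[of _ n _ m])
qed

lemma congruent_block_sum:
  assumes "congruent_mat A A'" "congruent_mat B B'"
  shows "congruent_mat (block_sum A B) (block_sum A' B')"
proof -
  obtain n T where 1: "A \<in> carrier_mat n n" "A' \<in> carrier_mat n n" "T \<in> carrier_mat n n" "det T \<noteq> 0"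
    "A = adj T * A' * T" using assms(1) by (rule congruent_matE)
  obtain m S where 2: "B \<in> carrier_mat m m" "B' \<in> carrier_mat m m" "S \<in> carrier_mat m m" "det S \<noteq> 0"
    "B = adj S * B' * S" using assms(2) by (rule congruent_matE)
  show ?thesis
  proof (rule congruent_matI)
    show "block_sum A B = adj (block_sum T S) * block_sum A' B' * block_sum T S"
    proof -
      have "block_sum (adj T) (adj S) * block_sum A' B' = block_sum (adj T * A') (adj S * B')"
        by (rule mult_block_sum[of _ n n _ m m _ n _ m]) (use 1(2,3) 2(2,3) in auto)
      moreover have "\<dots> * block_sum T S = block_sum (adj T * A' * T) (adj S * B' * S)"
        by (rule mult_block_sum[of _ n n _ m m _ n _ m]) (use 1(2,3) 2(2,3) in auto)
      ultimately show ?thesis using 1(5) 2(5) by (simp add: adj_block_sum)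
    qed
    show "det (block_sum T S) \<noteq> 0" using 1(3,4) 2(3,4) by (simp add: det_block_sum)
  qed (use 1(1-3) 2(1-3) in \<open>auto intro!: block_sum_carrier\<close>)
qed

lemma congruent_block_sum_swap:
  assumes A: "A \<in> carrier_mat n n" and B: "B \<in> carrier_mat m m"
  shows "congruent_mat (block_sum A B) (block_sum B A)"
proof -
  \<comment> \<open>The block permutation matrix that exchanges the two groups of
    coordinates.\<close>
  define T where "T = four_block_mat (0\<^sub>m m n) (1\<^sub>m m) (1\<^sub>m n) (0\<^sub>m n m :: complex mat)"
  have T: "T \<in> carrier_mat (m + n) (n + m)" unfolding T_def by (intro four_block_carrier_mat) auto
  have T': "T \<in> carrier_mat (n + m) (n + m)" using T by (simp add: add.commute)
  have aT: "adj T = four_block_mat (0\<^sub>m n m) (1\<^sub>m n) (1\<^sub>m m) (0\<^sub>m m n)"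
    unfolding T_def by (subst adj_four_block[of _ m n _ m _ n]) auto
  have DT: "block_sum B A * T = four_block_mat (0\<^sub>m m n) B A (0\<^sub>m n m)"
  proof -
    have "block_sum B A * T = four_block_mat (B * 0\<^sub>m m n + 0\<^sub>m m n * 1\<^sub>m n) (B * 1\<^sub>m m + 0\<^sub>m m n * 0\<^sub>m n m)
      (0\<^sub>m n m * 0\<^sub>m m n + A * 1\<^sub>m n) (0\<^sub>m n m * 1\<^sub>m m + A * 0\<^sub>m n m)"
      unfolding T_def block_sum_def using A B by (simp only: carrier_matD, intro mult_four_block_mat) auto
    then show ?thesis using A B by simp
  qed
  have "adj T * (block_sum B A * T) = four_block_mat (0\<^sub>m n m * 0\<^sub>m m n + 1\<^sub>m n * A) (0\<^sub>m n m * B + 1\<^sub>m n * 0\<^sub>m n m)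
      (1\<^sub>m m * 0\<^sub>m m n + 0\<^sub>m m n * A) (1\<^sub>m m * B + 0\<^sub>m m n * 0\<^sub>m n m)"
    unfolding aT DT using A B by (intro mult_four_block_mat) auto
  also have "\<dots> = block_sum A B" using A B by (simp add: block_sum_def)
  finally have eq: "adj T * (block_sum B A * T) = block_sum A B" .
  have "adj T * T = four_block_mat (0\<^sub>m n m * 0\<^sub>m m n + 1\<^sub>m n * 1\<^sub>m n) (0\<^sub>m n m * 1\<^sub>m m + 1\<^sub>m n * 0\<^sub>m n m)
      (1\<^sub>m m * 0\<^sub>m m n + 0\<^sub>m m n * 1\<^sub>m n) (1\<^sub>m m * 1\<^sub>m m + 0\<^sub>m m n * 0\<^sub>m n m)"
    unfolding aT by (subst T_def, intro mult_four_block_mat) auto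
  also have "\<dots> = 1\<^sub>m (n + m)" by simp
  finally have "adj T * T = 1\<^sub>m (n + m)" .
  then have "det (adj T) * det T = 1" using T' by (metis adj_carrier det_mult det_one)
  then have "det T \<noteq> 0" by auto
  moreover have "block_sum B A \<in> carrier_mat (n + m) (n + m)" using A B by (metis add.commute block_sum_carrier)
  ultimately show ?thesis using A B T' eq
    by (intro congruent_matI[of _ "n + m" _ T]) (auto simp: mult_assoc_dim)
qed

lemma diag_block_mat_carrier:
  assumes "\<forall>A \<in> set As. square_mat A"
  shows "diag_block_mat As \<in> carrier_mat (sum_list (map dim_row As)) (sum_list (map dim_row As))"
proof -
  have "map dim_col As = map dim_row As" using assms by auto
  then show ?thesis using dim_diag_block_mat[of As] by (metis carrier_matI)
qed

lemma congruent_diag_block_perm: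
  assumes "mset As = mset Bs" "\<forall>A \<in> set As. square_mat (A :: complex mat)"
  shows "congruent_mat (diag_block_mat As) (diag_block_mat Bs)"
  using assms
proof (induction As arbitrary: Bs)
  case Nil
  then show ?case by (auto intro: congruent_mat_refl[of _ 0])
next
  case (Cons A As)
  then have "A \<in> set Bs" by (metis list.set_intros(1) mset_eq_setD)
  then obtain B1 B2 where Bs: "Bs = B1 @ A # B2" by (meson split_list)
  have ms: "mset As = mset (B2 @ B1)" using Cons.prems(1) Bs by simp
  have sq: "\<forall>B\<in>set Bs. square_mat B" using Cons.prems by (metis mset_eq_setD)
  have sqA: "A \<in> carrier_mat (dim_row A) (dim_row A)" using Cons.prems(2) by auto
  have 1: "congruent_mat (diag_block_mat (A # As)) (diag_block_mat (A # B2 @ B1))"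
    unfolding diag_block_mat_Cons using Cons.IH[OF ms] Cons.prems(2) congruent_mat_refl[OF sqA]
    by (intro congruent_block_sum) auto
  have "congruent_mat (diag_block_mat ((A # B2) @ B1)) (diag_block_mat (B1 @ A # B2))"
    unfolding diag_block_mat_app using sq Bs
    by (intro congruent_block_sum_swap[OF diag_block_mat_carrier diag_block_mat_carrier]) auto
  then show ?case using 1 Bs by (simp add: congruent_mat_trans)
qed

lemma gram_index:
  assumes "P \<in> carrier_mat n p" "M \<in> carrier_mat n n" "i < p" "j < p"
  shows "(adj P * M * P) $$ (i,j) = (M *\<^sub>v col P j) \<bullet>c col P i"
proof -
  have "adj P * M * P = adj P * (M * P)" using assms by (simp add: mult_assoc_dim)
  moreover have "(adj P * (M * P)) $$ (i,j) = row (adj P) i \<bullet> col (M * P) j"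
    by (rule index_mult_mat(1)) (use assms in auto)
  ultimately have "(adj P * M * P) $$ (i,j) = row (adj P) i \<bullet> (M *\<^sub>v col P j)"
    using col_mult2[OF assms(2,1,4)] by simp
  also have "row (adj P) i = conjugate (col P i)" using assms by (intro eq_vecI) auto
  also have "\<dots> \<bullet> (M *\<^sub>v col P j) = (M *\<^sub>v col P j) \<bullet>c col P i"
    using assms by (intro comm_scalar_prod[of _ n]) auto
  finally show ?thesis .
qed

lemma adj_mult_vec_index:
  assumes "P \<in> carrier_mat n p" "z \<in> carrier_vec n" "i < p"
  shows "(adj P *\<^sub>v z) $ i = z \<bullet>c col P i"
proof -
  have "row (adj P) i = conjugate (col P i)" using assms by (intro eq_vecI) auto
  then show ?thesis using assms by (simp add: comm_scalar_prod[of "conjugate (col P i)" n z])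
qed

text \<open>For a Hermitian matrix a subspace with nondegenerate compression always splits off. In
  general the left and the right complement of the range of \<open>P\<close> with respect to
  \<open>M\<close> differ; \<open>two\<close> asks that the right one lies in the left one. A basis
  \<open>Q\<close> of it then makes both off-diagonal blocks vanish.\<close>

lemma congruence_split:
  fixes M P :: "complex mat"
  assumes M: "M \<in> carrier_mat n n" and P: "P \<in> carrier_mat n p"
    and G: "det (adj P * M * P) \<noteq> 0"
    and two: "\<And>w. w \<in> carrier_vec n \<Longrightarrow> adj P *\<^sub>v (M *\<^sub>v w) = 0\<^sub>v p \<Longrightarrow> adj P *\<^sub>v (adj M *\<^sub>v w) = 0\<^sub>v p"
  obtains q Q where "n = p + q" "Q \<in> carrier_mat n q"
    "congruent_mat M (block_sum (adj P * M * P) (adj Q * M * Q))"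
proof -
  define G where "G = adj P * M * P"
  have Gc: "G \<in> carrier_mat p p" using M P by (auto simp: G_def)
  obtain H where H: "H \<in> carrier_mat p p" "H * G = 1\<^sub>m p" "G * H = 1\<^sub>m p"
    using det_nonzero_inverse[OF Gc] G by (metis G_def)
  \<comment> \<open>\<open>P * L\<close> is the projection onto the range of \<open>P\<close> along
    the kernel of \<open>adj P * M\<close>, so the complement \<open>Q\<close> obtained below is the
    one to which \<open>two\<close> applies.\<close>
  define L where "L = H * (adj P * M)"
  have L: "L \<in> carrier_mat p n" using H P M by (auto simp: L_def)
  have LP: "L * P = 1\<^sub>m p"
  proof -
    have "L * P = H * G" unfolding L_def G_def using H(1) P M by (simp add: mult_assoc_dim)
    then show ?thesis using H by simp
  qed
  obtain q Q K where Q: "Q \<in> carrier_mat n q" and K: "K \<in> carrier_mat q n" and n: "n = p + q"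
    and KQ: "K * Q = 1\<^sub>m q" and LQ: "L * Q = 0\<^sub>m p q" and KP: "K * P = 0\<^sub>m q p"
    and sum: "P * L + Q * K = 1\<^sub>m n"
    by (rule oblique_complement[OF P L LP])
  define M' where "M' = adj Q * M * Q"
  have M': "M' \<in> carrier_mat q q" using M Q by (auto simp: M'_def)
  have PMQ: "adj P * (M * Q) = 0\<^sub>m p q"
  proof -
    have "G * (L * Q) = adj P * (M * Q)"
      unfolding L_def using P M Q H(1) Gc by (simp add: mult_assoc_dim mult_cancel_inverse[OF H(3)])
    then show ?thesis using LQ Gc by simp
  qed
  have "adj P * (adj M * Q) = 0\<^sub>m p q"
  proof (rule eq_matI)
    fix i j assume "i < dim_row (0\<^sub>m p q :: complex mat)" "j < dim_col (0\<^sub>m p q :: complex mat)"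
    then have ij: "i < p" "j < q" by auto
    have w: "col Q j \<in> carrier_vec n" using Q ij by auto
    have c: "col (adj P * (X * Q)) j = adj P *\<^sub>v (X *\<^sub>v col Q j)" if "X \<in> carrier_mat n n" for X
      using col_mult2[OF that Q ij(2)] col_mult2[OF adj_carrier[OF P] mult_carrier_mat[OF that Q] ij(2)]
      by simp
    have "adj P *\<^sub>v (M *\<^sub>v col Q j) = 0\<^sub>v p"
      using c[OF M] PMQ ij by simp
    then have "col (adj P * (adj M * Q)) j = 0\<^sub>v p" using two[OF w] c[of "adj M"] M by simp
    then have "col (adj P * (adj M * Q)) j $ i = 0" using ij by simp
    then show "(adj P * (adj M * Q)) $$ (i,j) = 0\<^sub>m p q $$ (i,j)" using ij P Q by simp
  qed (use P Q in auto)
  then have "adj (adj P * (adj M * Q)) = 0\<^sub>m q p" by simp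
  then have QMP: "adj Q * (M * P) = 0\<^sub>m q p" using P Q M by (simp add: adj_mult mult_assoc_dim)
  \<comment> \<open>The adjoint of the resolution of the identity, to be inserted on the left of
    \<open>M * P\<close> and \<open>M * Q\<close>.\<close>
  have sum': "adj L * adj P + adj K * adj Q = 1\<^sub>m n"
  proof -
    have "adj (P * L + Q * K) = adj (P * L) + adj (Q * K)"
      using P Q K L by (intro eq_matI) auto
    then show ?thesis using sum P Q K L by (simp add: adj_mult)
  qed
  have ins: "X = adj L * (adj P * X) + adj K * (adj Q * X)" if X: "X \<in> carrier_mat n k" for X k
  proof -
    have "X = (adj L * adj P + adj K * adj Q) * X" unfolding sum' using X by simp
    also have "\<dots> = adj L * adj P * X + adj K * adj Q * X"
      using L P K Q X by (intro add_mult_distrib_mat[of _ n n]) auto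
    finally show ?thesis using L P K Q X by (simp add: mult_assoc_dim)
  qed
  have MP: "M * P = adj L * G"
  proof -
    have "M * P = adj L * (adj P * (M * P)) + adj K * (adj Q * (M * P))"
      by (rule ins[of _ p]) (use M P in auto)
    also have "adj K * (adj Q * (M * P)) = 0\<^sub>m n p" unfolding QMP using K by auto
    also have "adj P * (M * P) = G" unfolding G_def using P M by (simp add: mult_assoc_dim)
    finally show ?thesis using right_add_zero_mat[of "adj L * G" n p] L Gc by auto
  qed
  have MQ: "M * Q = adj K * M'"
  proof -
    have "M * Q = adj L * (adj P * (M * Q)) + adj K * (adj Q * (M * Q))"
      by (rule ins[of _ q]) (use M Q in auto)
    also have "adj L * (adj P * (M * Q)) = 0\<^sub>m n q" unfolding PMQ using L by auto
    also have "adj Q * (M * Q) = M'" unfolding M'_def using Q M by (simp add: mult_assoc_dim)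
    finally show ?thesis using left_add_zero_mat[of "adj K * M'" n q] K M' by auto
  qed
  have Mdec: "M = adj L * G * L + adj K * M' * K"
  proof -
    have "M = M * (P * L + Q * K)" unfolding sum using M by simp
    also have "\<dots> = M * (P * L) + M * (Q * K)"
      using M P L Q K by (intro mult_add_distrib_mat[of _ n n]) auto
    also have "\<dots> = (M * P) * L + (M * Q) * K" using M P L Q K by (simp add: mult_assoc_dim)
    finally show ?thesis unfolding MP MQ .
  qed
  define S where "S = four_block_mat P Q (0\<^sub>m 0 p) (0\<^sub>m 0 q)"
  define T where "T = four_block_mat L (0\<^sub>m p 0) K (0\<^sub>m q 0)"
  have S0: "S \<in> carrier_mat (n + 0) (p + q)" unfolding S_def using P Q by (intro four_block_carrier_mat) auto
  have T0: "T \<in> carrier_mat (p + q) (n + 0)" unfolding T_def using L K by (intro four_block_carrier_mat) auto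
  have "T * S = four_block_mat (L * P + 0\<^sub>m p 0 * 0\<^sub>m 0 p) (L * Q + 0\<^sub>m p 0 * 0\<^sub>m 0 q)
     (K * P + 0\<^sub>m q 0 * 0\<^sub>m 0 p) (K * Q + 0\<^sub>m q 0 * 0\<^sub>m 0 q)"
    unfolding S_def T_def using P L Q K by (intro mult_four_block_mat) auto
  also have "\<dots> = 1\<^sub>m (p + q)"
    unfolding LP LQ KP KQ by (intro eq_matI) (auto simp: scalar_prod_def)
  finally have TS: "T * S = 1\<^sub>m n" using n by simp
  have ST: "S \<in> carrier_mat n n" "T \<in> carrier_mat n n" using S0 T0 n by auto
  have "adj T = four_block_mat (adj L) (adj K) (0\<^sub>m 0 p) (0\<^sub>m 0 q)"
    unfolding T_def using L K by (subst adj_four_block[of _ p n _ 0 _ q]) auto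
  moreover have "block_sum G M' * T = four_block_mat (G * L) (0\<^sub>m p 0) (M' * K) (0\<^sub>m q 0)"
  proof -
    have "block_sum G M' * T = four_block_mat (G * L + 0\<^sub>m p q * K) (G * 0\<^sub>m p 0 + 0\<^sub>m p q * 0\<^sub>m q 0)
      (0\<^sub>m q p * L + M' * K) (0\<^sub>m q p * 0\<^sub>m p 0 + M' * 0\<^sub>m q 0)"
      unfolding T_def block_sum_def using Gc M' L K
      by (simp only: carrier_matD, intro mult_four_block_mat) auto
    then show ?thesis using Gc M' L K by simp
  qed
  ultimately have "adj T * (block_sum G M' * T) =
    four_block_mat (adj L) (adj K) (0\<^sub>m 0 p) (0\<^sub>m 0 q) * four_block_mat (G * L) (0\<^sub>m p 0) (M' * K) (0\<^sub>m q 0)" by simp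
  also have "\<dots> = four_block_mat (adj L * (G * L) + adj K * (M' * K)) (adj L * 0\<^sub>m p 0 + adj K * 0\<^sub>m q 0)
      (0\<^sub>m 0 p * (G * L) + 0\<^sub>m 0 q * (M' * K)) (0\<^sub>m 0 p * 0\<^sub>m p 0 + 0\<^sub>m 0 q * 0\<^sub>m q 0)"
    using L K Gc M' by (intro mult_four_block_mat) auto
  also have "\<dots> = four_block_mat M (0\<^sub>m n 0) (0\<^sub>m 0 n) (0\<^sub>m 0 0)"
  proof -
    have "adj L * (G * L) + adj K * (M' * K) = adj L * G * L + adj K * M' * K"
      using L K Gc M' by (simp add: mult_assoc_dim)
    also have "\<dots> = M" by (rule Mdec[symmetric])
    finally show ?thesis using L K Gc M' by (intro arg_cong4[of _ _ _ _ _ _ _ _ four_block_mat]) auto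
  qed
  also have "\<dots> = M" using M by (intro eq_matI) auto
  finally have "M = adj T * block_sum G M' * T"
    using ST Gc M' n by (simp add: mult_assoc_dim[of "adj T"] carrier_matD[OF block_sum_carrier[OF Gc M']])
  then have "congruent_mat M (block_sum G M')"
    using M ST Gc M' n det_inverse[OF ST(2,1) TS]
    by (intro congruent_matI[of _ n _ T]) auto
  then show thesis using that[OF n Q] by (simp add: G_def M'_def)
qed

subsection \<open>Canonical form of accretive matrices\<close>

abbreviation scalar_mat1 :: "complex \<Rightarrow> complex mat" where
  "scalar_mat1 z \<equiv> mat (Suc 0) (Suc 0) (\<lambda>_. z)"

text \<open>The entry 2 is the borderline value: the real part of the form is the squared modulus of
  the sum of the two coordinates, and at the vector \<open>(1, -1)\<close> the whole form is
  0.\<close>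

abbreviation jordan_block2 :: "complex mat" where
  "jordan_block2 \<equiv> mat_of_rows_list 2 [[1, 2], [0, 1]]"

lemma jordan_block2_carrier [simp]: "jordan_block2 \<in> carrier_mat 2 2"
  unfolding mat_of_rows_list_def by auto

lemma jordan_block2_index:
  "jordan_block2 $$ (0,0) = 1" "jordan_block2 $$ (0,1) = 2" "jordan_block2 $$ (1,0) = 0" "jordan_block2 $$ (1,1) = 1"
  "jordan_block2 $$ (0,Suc 0) = 2" "jordan_block2 $$ (Suc 0,0) = 0" "jordan_block2 $$ (Suc 0,Suc 0) = 1"
  by (simp_all add: mat_of_rows_list_def)

text \<open>Polarization over the complex numbers: the steps \<open>s = 1\<close> and
  \<open>s = \<i>\<close> separate the two mixed terms.\<close>

lemma quad_form_zero_imp_zero: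
  assumes M: "M \<in> carrier_mat n n" and z: "\<And>x. x \<in> carrier_vec n \<Longrightarrow> quad_form M x = 0"
    and x: "x \<in> carrier_vec n"
  shows "M *\<^sub>v x = 0\<^sub>v n"
proof -
  define y where "y = M *\<^sub>v x"
  have y: "y \<in> carrier_vec n" using M x by (simp add: y_def)
  have e: "cnj s * ((M *\<^sub>v x) \<bullet>c y) + s * ((M *\<^sub>v y) \<bullet>c x) = 0" for s
    using quad_form_add_smult[OF M x y, of s] z[OF x] z[OF y] z[of "x + s \<cdot>\<^sub>v y"] x y by simp
  have "(M *\<^sub>v x) \<bullet>c y = 0"
    using e[of 1] e[of \<i>] by (simp add: complex_eq_iff)
  then show ?thesis using cscalar_prod_self_eq_0[OF y] by (simp add: y_def)
qed

text \<open>In a triangular form \<open>J\<close> becomes \<open>\<mu>\<close> plus a strictly upper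
  triangular \<open>Z\<close>, nonzero because \<open>J\<close> is not scalar. Let \<open>c\<close>
  be the first nonzero column of \<open>Z\<close>, with index \<open>j\<close>. Its entries sit in
  rows before \<open>j\<close>, and the columns of \<open>Z\<close> with these indices vanish, so
  \<open>Z\<close> sends \<open>unit_vec n j\<close> to \<open>c\<close> and \<open>c\<close> to
  0.\<close>

lemma generalized_eigenvector_pair:
  fixes J :: "complex mat"
  assumes J: "J \<in> carrier_mat n n" and ev: "\<And>e. eigenvalue J e \<Longrightarrow> e = \<mu>"
    and ne: "\<not> (\<forall>x \<in> carrier_vec n. J *\<^sub>v x = \<mu> \<cdot>\<^sub>v x)"
  obtains u v where "u \<in> carrier_vec n" "v \<in> carrier_vec n" "v \<noteq> 0\<^sub>v n"
    "J *\<^sub>v v = \<mu> \<cdot>\<^sub>v v" "J *\<^sub>v u = \<mu> \<cdot>\<^sub>v u + v"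
proof -
  obtain es where es: "char_poly J = (\<Prod>a\<leftarrow>es. [:- a, 1:])" using complex_char_poly_linear[OF J] by blast
  obtain R X Y where sd: "schur_decomposition J es = (R, X, Y)" by (metis prod_cases3)
  from schur_decomposition[OF J es sd]
  have sim: "similar_mat_wit J R X Y" and ut: "upper_triangular R" and dg: "diag_mat R = es" by auto
  from similar_mat_witD2[OF J sim] have XY: "X * Y = 1\<^sub>m n" "Y * X = 1\<^sub>m n" and JR: "J = X * R * Y"
    and R: "R \<in> carrier_mat n n" and X: "X \<in> carrier_mat n n" and Y: "Y \<in> carrier_mat n n" by auto
  have diag: "R $$ (i,i) = \<mu>" if "i < n" for i
  proof -
    have "R $$ (i,i) \<in> set es" using that R unfolding dg[symmetric] diag_mat_def by auto
    then have "poly (char_poly J) (R $$ (i,i)) = 0"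
      unfolding es by (auto simp: poly_prod_list prod_list_zero_iff)
    then show ?thesis using ev eigenvalue_root_char_poly[OF J] by blast
  qed
  have low: "R $$ (i,j) = 0" if "j < i" "i < n" for i j
    using ut R that unfolding upper_triangular_def by auto
  define Z where "Z = R - \<mu> \<cdot>\<^sub>m 1\<^sub>m n"
  have Z: "Z \<in> carrier_mat n n" using R by (auto simp: Z_def)
  have Zlow: "Z $$ (i,j) = 0" if "j \<le> i" "i < n" for i j
    using that diag low R by (cases "i = j") (auto simp: Z_def)
  have Rx: "R *\<^sub>v x = \<mu> \<cdot>\<^sub>v x + Z *\<^sub>v x" if x: "x \<in> carrier_vec n" for x
  proof -
    have "R = \<mu> \<cdot>\<^sub>m 1\<^sub>m n + Z" using R unfolding Z_def by (intro eq_matI) auto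
    then have "R *\<^sub>v x = (\<mu> \<cdot>\<^sub>m 1\<^sub>m n + Z) *\<^sub>v x" by simp
    also have "\<dots> = (\<mu> \<cdot>\<^sub>m 1\<^sub>m n) *\<^sub>v x + Z *\<^sub>v x" using Z x by (intro add_mult_distrib_mat_vec[of _ n n]) auto
    finally show ?thesis using x by (simp add: smult_mat_vec[of _ n n])
  qed
  have Jx: "J *\<^sub>v (X *\<^sub>v x) = \<mu> \<cdot>\<^sub>v (X *\<^sub>v x) + X *\<^sub>v (Z *\<^sub>v x)" if x: "x \<in> carrier_vec n" for x
  proof -
    have "J *\<^sub>v (X *\<^sub>v x) = (J * X) *\<^sub>v x" using J X x by (simp add: mult_vec_assoc_dim)
    also have "J * X = X * R" unfolding JR using X R Y XY by (simp add: mult_assoc_dim)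
    also have "(X * R) *\<^sub>v x = X *\<^sub>v (R *\<^sub>v x)" using X R x by (simp add: mult_vec_assoc_dim)
    also have "\<dots> = X *\<^sub>v (\<mu> \<cdot>\<^sub>v x + Z *\<^sub>v x)" using Rx[OF x] by simp
    also have "\<dots> = \<mu> \<cdot>\<^sub>v (X *\<^sub>v x) + X *\<^sub>v (Z *\<^sub>v x)"
      using X x Z by (simp add: mult_add_distrib_mat_vec[of _ n n] mult_mat_vec[of _ n n])
    finally show ?thesis .
  qed
  have "\<exists>j<n. \<exists>i<n. Z $$ (i,j) \<noteq> 0"
  proof (rule ccontr)
    assume "\<not> ?thesis"
    then have Z0: "Z = 0\<^sub>m n n" using Z by (intro eq_matI) auto
    have "J *\<^sub>v x = \<mu> \<cdot>\<^sub>v x" if x: "x \<in> carrier_vec n" for x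
    proof -
      have "X *\<^sub>v (Y *\<^sub>v x) = (X * Y) *\<^sub>v x"
        by (intro mult_vec_assoc_dim[symmetric]) (use X Y x in auto)
      then have XYx: "X *\<^sub>v (Y *\<^sub>v x) = x" using XY x by simp
      have "J *\<^sub>v x = \<mu> \<cdot>\<^sub>v x + X *\<^sub>v (Z *\<^sub>v (Y *\<^sub>v x))"
        using Jx[of "Y *\<^sub>v x"] XYx Y x by simp
      also have "X *\<^sub>v (Z *\<^sub>v (Y *\<^sub>v x)) = 0\<^sub>v n"
      proof -
        have "Z *\<^sub>v (Y *\<^sub>v x) = 0\<^sub>v n" unfolding Z0 using Y x by (intro eq_vecI) auto
        then show ?thesis using X mult_mat_vec_zero[of X n] by simp
      qed
      finally show ?thesis using x by simp
    qed
    then show False using ne by blast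
  qed
  then obtain j0 where j0: "j0 < n" "\<exists>i<n. Z $$ (i,j0) \<noteq> 0" by blast
  define j where "j = (LEAST j. \<exists>i<n. Z $$ (i,j) \<noteq> 0)"
  have j: "\<exists>i<n. Z $$ (i,j) \<noteq> 0" and jn: "j < n" and jmin: "\<And>l i. l < j \<Longrightarrow> i < n \<Longrightarrow> Z $$ (i,l) = 0"
  proof -
    show "\<exists>i<n. Z $$ (i,j) \<noteq> 0" unfolding j_def using j0(2) by (rule LeastI)
    have "j \<le> j0" unfolding j_def using j0(2) by (rule Least_le)
    then show "j < n" using j0 by simp
    show "Z $$ (i,l) = 0" if "l < j" "i < n" for l i
      using not_less_Least[OF that(1)[unfolded j_def]] that(2) by blast
  qed
  define c where "c = col Z j"
  have c: "c \<in> carrier_vec n" using Z jn by (auto simp: c_def)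
  have c0: "c \<noteq> 0\<^sub>v n"
  proof
    assume "c = 0\<^sub>v n"
    then have "\<forall>i<n. c $ i = 0" by simp
    then show False using j Z jn by (auto simp: c_def)
  qed
  have Zc: "Z *\<^sub>v c = 0\<^sub>v n"
  proof (rule eq_vecI)
    fix i assume i: "i < dim_vec (0\<^sub>v n :: complex vec)"
    have "(Z *\<^sub>v c) $ i = (\<Sum>l<n. Z $$ (i,l) * Z $$ (l,j))"
      using i Z jn by (auto simp: scalar_prod_def c_def lessThan_atLeast0 intro!: sum.cong)
    also have "\<dots> = 0"
    proof (intro sum.neutral ballI)
      fix l assume "l \<in> {..<n}"
      then show "Z $$ (i,l) * Z $$ (l,j) = 0" using jmin[of l i] Zlow[of j l] i
        by (cases "l < j") auto
    qed
    finally show "(Z *\<^sub>v c) $ i = 0\<^sub>v n $ i" using i by simp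
  qed (use Z in auto)
  have Ze: "Z *\<^sub>v unit_vec n j = c"
    unfolding c_def using Z jn by (intro eq_vecI) auto
  show thesis
  proof (rule that[of "X *\<^sub>v unit_vec n j" "X *\<^sub>v c"])
    show "X *\<^sub>v c \<noteq> 0\<^sub>v n"
    proof
      assume "X *\<^sub>v c = 0\<^sub>v n"
      then show False using det_nonzeroD[OF X det_inverse[OF X Y XY(1)] c] c0 by simp
    qed
    show "J *\<^sub>v (X *\<^sub>v c) = \<mu> \<cdot>\<^sub>v (X *\<^sub>v c)"
      using Jx[OF c] Zc X c mult_mat_vec_zero[of X n] by simp
    show "J *\<^sub>v (X *\<^sub>v unit_vec n j) = \<mu> \<cdot>\<^sub>v (X *\<^sub>v unit_vec n j) + X *\<^sub>v c"
      using Jx[of "unit_vec n j"] Ze by simp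
  qed (use X c in auto)
qed

section \<open>Sesquilinear identities and auxiliary facts for the splitting of blocks\<close>

lemma eq_mat_2:
  assumes "A \<in> carrier_mat 2 2" "B \<in> carrier_mat 2 2" "A $$ (0,0) = B $$ (0,0)" "A $$ (0,1) = B $$ (0,1)"
    "A $$ (1,0) = B $$ (1,0)" "A $$ (1,1) = B $$ (1,1)"
  shows "A = B"
proof (rule eq_matI)
  fix i j assume "i < dim_row B" "j < dim_col B"
  then have "i = 0 \<or> i = 1" "j = 0 \<or> j = 1" using assms by auto
  then show "A $$ (i,j) = B $$ (i,j)" using assms by auto
qed (use assms in auto)

lemma cscalar_prod_add_left:
  fixes x y z :: "complex vec"
  assumes "x \<in> carrier_vec n" "y \<in> carrier_vec n" "z \<in> carrier_vec n"
  shows "(x + s \<cdot>\<^sub>v y) \<bullet>c z = x \<bullet>c z + s * (y \<bullet>c z)"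
  using assms by (subst add_scalar_prod_distrib[of _ n]) auto

lemma cscalar_prod_add_right:
  fixes x y z :: "complex vec"
  assumes "x \<in> carrier_vec n" "y \<in> carrier_vec n" "z \<in> carrier_vec n"
  shows "z \<bullet>c (x + s \<cdot>\<^sub>v y) = z \<bullet>c x + cnj s * (z \<bullet>c y)"
proof -
  have "conjugate (x + s \<cdot>\<^sub>v y) = conjugate x + cnj s \<cdot>\<^sub>v conjugate y"
    using assms by (simp add: conjugate_add_vec[of _ n] conjugate_smult_vec)
  then show ?thesis
    by (simp only:) (subst scalar_prod_add_distrib[of _ n], use assms in auto)
qed

lemma cscalar_prod_smult:
  fixes x y :: "complex vec"
  assumes "x \<in> carrier_vec n" "y \<in> carrier_vec n"
  shows "(s \<cdot>\<^sub>v x) \<bullet>c y = s * (x \<bullet>c y)" "x \<bullet>c (s \<cdot>\<^sub>v y) = cnj s * (x \<bullet>c y)"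
  using assms by (simp_all add: conjugate_smult_vec smult_scalar_prod_distrib[of _ n] scalar_prod_smult_distrib[of _ n])

lemma smult_vec_eq_zero:
  fixes x :: "complex vec"
  assumes "x \<in> carrier_vec n"
  shows "c \<cdot>\<^sub>v x = 0\<^sub>v n \<longleftrightarrow> c = 0 \<or> x = 0\<^sub>v n"
proof
  assume e: "c \<cdot>\<^sub>v x = 0\<^sub>v n"
  have "c * x $ i = 0" if "i < n" for i
  proof -
    have "(c \<cdot>\<^sub>v x) $ i = 0" using e that by simp
    then show ?thesis using that assms by simp
  qed
  then show "c = 0 \<or> x = 0\<^sub>v n" using assms by (auto intro!: eq_vecI)
next
  assume "c = 0 \<or> x = 0\<^sub>v n"
  then show "c \<cdot>\<^sub>v x = 0\<^sub>v n" using assms by (auto intro!: eq_vecI)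
qed

lemma congruent_det:
  assumes "congruent_mat A B"
  shows "\<exists>c>0. det A = of_real c * det B"
proof -
  obtain n T where 1: "A \<in> carrier_mat n n" "B \<in> carrier_mat n n" "T \<in> carrier_mat n n" "det T \<noteq> 0"
    "A = adj T * B * T" using assms by (rule congruent_matE)
  have "det A = cnj (det T) * det B * det T"
    unfolding 1(5) using det_mult[OF mult_carrier_mat[OF adj_carrier[OF 1(3)] 1(2)] 1(3)]
      det_mult[OF adj_carrier[OF 1(3)] 1(2)] det_adj[OF 1(3)] by simp
  also have "\<dots> = of_real ((cmod (det T))\<^sup>2) * det B"
    using complex_norm_square[of "det T"] by (simp add: mult_ac)
  finally show ?thesis using 1(4) by (intro exI[of _ "(cmod (det T))\<^sup>2"]) auto
qed

lemma abs_Arg_le_pi_half: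
  assumes "z \<noteq> 0" "0 \<le> Re z"
  shows "\<bar>Arg z\<bar> \<le> pi / 2"
  using assms Re_Ln_pos_le[of z] Arg_eq_Im_Ln[of z] by simp

lemma det_jordan_block2: "det jordan_block2 = 1"
proof -
  have "upper_triangular jordan_block2"
    unfolding upper_triangular_def using jordan_block2_index(6)
    by (auto simp: carrier_matD[OF jordan_block2_carrier] less_2_cases_iff)
  then have "det jordan_block2 = prod_list (diag_mat jordan_block2)"
    by (rule det_upper_triangular[OF _ jordan_block2_carrier])
  also have "diag_mat jordan_block2 = [1, 1]"
    unfolding diag_mat_def carrier_matD[OF jordan_block2_carrier]
    by (simp add: jordan_block2_index numeral_2_eq_2[symmetric] upt_rec)
  finally show ?thesis by simp
qed

text \<open>The equation between \<open>adj M v\<close> and \<open>M v\<close> makes the left and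
  right complements of the line of \<open>v\<close> agree, as \<open>congruence_split\<close>
  requires, and the nonzero value of the form makes the compression to this line nondegenerate.
  Accretivity bounds the argument of that value.\<close>

lemma split_scalar_block:
  assumes M: "M \<in> carrier_mat n n" and det: "det M \<noteq> 0" and acc: "accretive 0 M"
    and v: "v \<in> carrier_vec n" "v \<noteq> 0\<^sub>v n" and ev: "adj M *\<^sub>v v = \<mu> \<cdot>\<^sub>v (M *\<^sub>v v)"
    and q: "quad_form M v \<noteq> 0"
  obtains \<theta> m Q where "n = 1 + m" "\<theta> \<in> {- pi / 2..pi / 2}" "Q \<in> carrier_mat n m"
    "congruent_mat M (block_sum (scalar_mat1 (cis \<theta>)) (adj Q * M * Q))"
proof -
  have Mv: "M *\<^sub>v v \<in> carrier_vec n" using M v by simp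
  have \<mu>: "\<mu> \<noteq> 0"
  proof
    assume "\<mu> = 0"
    then have "adj M *\<^sub>v v = 0\<^sub>v n" using ev smult_vec_eq_zero[OF Mv] by simp
    then show False using det_nonzeroD[of "adj M" n v] M v det det_adj[OF M] by simp
  qed
  define z where "z = quad_form M v"
  define \<theta> where "\<theta> = Arg z"
  have z: "z \<noteq> 0" "0 \<le> Re z" using q acc v M by (auto simp: z_def accretive_def)
  have \<theta>: "\<theta> \<in> {- pi / 2..pi / 2}" using abs_Arg_le_pi_half[OF z] by (auto simp: \<theta>_def)
  \<comment> \<open>Scaling by \<open>a\<close> multiplies the form by \<open>1 / cmod z\<close>,
    which leaves the unit number \<open>cis \<theta>\<close>.\<close>
  define a where "a = complex_of_real (1 / sqrt (cmod z))"
  have a: "a * cnj a = of_real (1 / cmod z)" using z by (simp add: a_def flip: of_real_mult)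
  define x where "x = a \<cdot>\<^sub>v v"
  have x: "x \<in> carrier_vec n" using v by (simp add: x_def)
  have qx: "quad_form M x = cis \<theta>"
    unfolding x_def using quad_form_smult_vec[OF M v(1)] a z
    by (simp add: \<theta>_def cis_Arg sgn_div_norm scaleR_conv_of_real z_def[symmetric] divide_inverse mult.commute)
  define P where "P = mat_of_cols n [x]"
  have P: "P \<in> carrier_mat n 1" using x mat_of_cols_carrier(1)[of n "[x]"] by (simp add: P_def)
  have P0: "col P 0 = x" using x by (simp add: P_def)
  have G: "adj P * M * P = scalar_mat1 (cis \<theta>)"
  proof (rule eq_matI)
    fix i j assume "i < dim_row (scalar_mat1 (cis \<theta>))" "j < dim_col (scalar_mat1 (cis \<theta>))"
    then have ij: "i = 0" "j = 0" by auto
    show "(adj P * M * P) $$ (i,j) = scalar_mat1 (cis \<theta>) $$ (i,j)"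
      unfolding ij using gram_index[OF P M, of 0 0] P0 qx by (simp add: quad_form_def)
  qed (use P in auto)
  have xev: "adj M *\<^sub>v x = \<mu> \<cdot>\<^sub>v (M *\<^sub>v x)"
  proof -
    have "adj M *\<^sub>v x = a \<cdot>\<^sub>v (adj M *\<^sub>v v)" unfolding x_def using M v by (intro mult_mat_vec[of _ n n]) auto
    moreover have "M *\<^sub>v x = a \<cdot>\<^sub>v (M *\<^sub>v v)" unfolding x_def using M v by (intro mult_mat_vec[of _ n n]) auto
    ultimately show ?thesis using ev Mv by (simp add: smult_smult_assoc mult.commute)
  qed
  have dG: "det (adj P * M * P) \<noteq> 0" unfolding G by (simp add: det_single)
  \<comment> \<open>The inner product of \<open>M w\<close> with \<open>x\<close> is
    \<open>cnj \<mu>\<close> times that of \<open>adj M w\<close> with \<open>x\<close>, and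
    \<open>\<mu>\<close> is nonzero.\<close>
  have two: "adj P *\<^sub>v (adj M *\<^sub>v w) = 0\<^sub>v 1"
    if w: "w \<in> carrier_vec n" and z: "adj P *\<^sub>v (M *\<^sub>v w) = 0\<^sub>v 1" for w
  proof -
    have Mw: "M *\<^sub>v w \<in> carrier_vec n" "adj M *\<^sub>v w \<in> carrier_vec n" "M *\<^sub>v x \<in> carrier_vec n"
      using M w x mult_mat_vec_carrier[OF adj_carrier[OF M] w] by auto
    have "(M *\<^sub>v w) \<bullet>c x = (adj P *\<^sub>v (M *\<^sub>v w)) $ 0"
      using adj_mult_vec_index[OF P Mw(1)] P0 by simp
    then have "(M *\<^sub>v w) \<bullet>c x = 0" using z by simp
    then have "w \<bullet>c (adj M *\<^sub>v x) = 0" using cscalar_prod_adj[OF M w x] by simp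
    then have "w \<bullet>c (M *\<^sub>v x) = 0" unfolding xev using \<mu> cscalar_prod_smult(2)[OF w Mw(3)] by simp
    then have "(adj M *\<^sub>v w) \<bullet>c x = 0" using cscalar_prod_adj[of "adj M" n n w x] M w x by simp
    then have "(adj P *\<^sub>v (adj M *\<^sub>v w)) $ 0 = 0"
      using adj_mult_vec_index[OF P Mw(2)] P0 by simp
    then show ?thesis using P by (intro eq_vecI) (auto simp del: index_mult_mat_vec)
  qed
  obtain m Q where "n = 1 + m" "Q \<in> carrier_mat n m"
    "congruent_mat M (block_sum (adj P * M * P) (adj Q * M * Q))"
    by (rule congruence_split[OF M P dG two])
  then show thesis using that \<theta> G by simp
qed

text \<open>On the chain the sesquilinear form \<open>f\<close> satisfies \<open>f v v = 0\<close>
  and \<open>f u v = 2 * h = - f v u\<close>, where \<open>h\<close> is the real part of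
  \<open>f u u\<close>. If \<open>h\<close> were 0, the kernel equation at \<open>u\<close> would
  read \<open>M v = 0\<close>. A change of basis then brings the Gram matrix to \<open>h\<close>
  times \<open>jordan_block2\<close>.\<close>

lemma split_jordan_block:
  assumes M: "M \<in> carrier_mat n n" and det: "det M \<noteq> 0" and acc: "accretive 0 M"
    and u: "u \<in> carrier_vec n" and v: "v \<in> carrier_vec n" "v \<noteq> 0\<^sub>v n"
    and Fv: "adj M *\<^sub>v v = (- 1) \<cdot>\<^sub>v (M *\<^sub>v v)" and Fu: "adj M *\<^sub>v u = (- 1) \<cdot>\<^sub>v (M *\<^sub>v u) + M *\<^sub>v v"
    and qv: "quad_form M v = 0"
  obtains m Q where "n = 2 + m" "Q \<in> carrier_mat n m"
    "congruent_mat M (block_sum jordan_block2 (adj Q * M * Q))"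
proof -
  have aM: "adj M \<in> carrier_mat n n" using M by simp
  have Mc [simp]: "M *\<^sub>v b \<in> carrier_vec n" "adj M *\<^sub>v b \<in> carrier_vec n" if "b \<in> carrier_vec n" for b
    using mult_mat_vec_carrier[OF M that] mult_mat_vec_carrier[OF aM that] by auto
  define f where "f = (\<lambda>a b. (M *\<^sub>v b) \<bullet>c a)"
  define h where "h = Re (f u u)"
  have Mv0: "M *\<^sub>v v \<noteq> 0\<^sub>v n" using det_nonzeroD[OF M det v(1)] v(2) by auto
  have fvv: "f v v = 0" using qv by (simp add: f_def quad_form_def)
  have fuv: "f u v = of_real (2 * h)"
  proof -
    have "(adj M *\<^sub>v u) \<bullet>c u = cnj (f u u)"
      using quad_form_adj[OF M u] by (simp add: f_def quad_form_def)
    moreover have "(adj M *\<^sub>v u) \<bullet>c u = - f u u + f u v"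
      unfolding Fu f_def using u v
      by (subst add_scalar_prod_distrib[of _ n]) (auto simp: cscalar_prod_smult[of _ n])
    ultimately have "f u v = f u u + cnj (f u u)" by (simp add: algebra_simps)
    then show ?thesis by (simp add: h_def complex_add_cnj)
  qed
  have fvu: "f v u = - of_real (2 * h)"
  proof -
    have "f v u = u \<bullet>c (adj M *\<^sub>v v)" unfolding f_def by (rule cscalar_prod_adj[OF M u v(1)])
    also have "\<dots> = - (u \<bullet>c (M *\<^sub>v v))" unfolding Fv using u v by (simp add: cscalar_prod_smult[of _ n])
    also have "u \<bullet>c (M *\<^sub>v v) = cnj (f u v)" unfolding f_def using u v by (intro cscalar_prod_swap[of _ n]) auto
    finally show ?thesis using fuv by simp
  qed
  have "h \<ge> 0" using acc u M by (auto simp: h_def f_def accretive_def quad_form_def)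
  moreover have "h \<noteq> 0"
  proof
    assume "h = 0"
    then have "M *\<^sub>v u + adj M *\<^sub>v u = 0\<^sub>v n"
      using accretive_isotropic[OF M acc u] by (simp add: h_def f_def quad_form_def)
    moreover have "M *\<^sub>v u + adj M *\<^sub>v u = M *\<^sub>v v"
      unfolding Fu using u v M by (intro eq_vecI) (auto simp del: index_mult_mat_vec)
    ultimately show False using Mv0 by simp
  qed
  ultimately have h: "h > 0" by simp
  \<comment> \<open>Adding \<open>t\<close> times \<open>v\<close> to \<open>u\<close> changes
    \<open>f u u\<close> by \<open>2 * h * (t - cnj t)\<close>; this purely imaginary
    \<open>t\<close> cancels the imaginary part of \<open>f u u\<close>.\<close>
  define t where "t = - \<i> * of_real (Im (f u u) / (4 * h))"
  define u' where "u' = u + t \<cdot>\<^sub>v v"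
  have u': "u' \<in> carrier_vec n" using u v by (simp add: u'_def)
  have fuu': "f u' u' = of_real h"
  proof -
    have "f u' u' = f u u + cnj t * f v u + t * f u v + t * cnj t * f v v"
      using quad_form_add_smult[OF M u v(1), of t] by (simp add: f_def u'_def quad_form_def)
    also have "\<dots> = f u u + of_real (2 * h) * (t - cnj t)"
      unfolding fvv fuv fvu by (simp add: algebra_simps)
    also have "of_real (2 * h) * (t - cnj t) = - \<i> * Im (f u u)"
      using h by (simp add: t_def field_simps)
    finally show ?thesis by (simp add: h_def complex_eq_iff)
  qed
  have Mu': "M *\<^sub>v u' = M *\<^sub>v u + t \<cdot>\<^sub>v (M *\<^sub>v v)" unfolding u'_def by (rule mult_mat_vec_add[OF M u v(1)])
  have fuv': "f u' v = of_real (2 * h)"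
    using cscalar_prod_add_right[of u n v "M *\<^sub>v v" t] u v fuv fvv by (simp add: f_def u'_def)
  have fvu': "f v u' = - of_real (2 * h)"
    using cscalar_prod_add_left[of "M *\<^sub>v u" n "M *\<^sub>v v" v t] u v fvu fvv by (simp add: f_def Mu')
  define a where "a = complex_of_real (1 / sqrt h)"
  have a: "a * cnj a = of_real (1 / h)" "a \<noteq> 0" using h by (simp_all add: a_def flip: of_real_mult)
  have aa: "a * cnj a * of_real h = 1" "a * (cnj a * of_real h) = 1" using a h by (simp_all flip: mult.assoc)
  \<comment> \<open>The coefficient \<open>1/2\<close> gives \<open>f y' u' = h - h = 0\<close> and
    \<open>f u' y' = h + h\<close>, the off-diagonal pattern of \<open>jordan_block2\<close> up to
    the factor \<open>h\<close>.\<close>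
  define y' where "y' = u' + (1/2) \<cdot>\<^sub>v v"
  have y': "y' \<in> carrier_vec n" using u' v by (simp add: y'_def)
  have My': "M *\<^sub>v y' = M *\<^sub>v u' + (1/2) \<cdot>\<^sub>v (M *\<^sub>v v)" unfolding y'_def by (rule mult_mat_vec_add[OF M u' v(1)])
  have fuy: "f u' y' = of_real (2 * h)"
    using cscalar_prod_add_left[of "M *\<^sub>v u'" n "M *\<^sub>v v" u' "1/2"] u' v fuu' fuv' by (simp add: f_def My')
  have fvy: "f v y' = - of_real (2 * h)"
    using cscalar_prod_add_left[of "M *\<^sub>v u'" n "M *\<^sub>v v" v "1/2"] u' v fvu' fvv by (simp add: f_def My')
  have fyu: "f y' u' = 0"
    using cscalar_prod_add_right[of u' n v "M *\<^sub>v u'" "1/2"] u' v fuu' fvu' by (simp add: f_def y'_def)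
  have fyy: "f y' y' = of_real h"
    using cscalar_prod_add_right[of u' n v "M *\<^sub>v y'" "1/2"] u' v y' fuy fvy by (simp add: f_def y'_def)
  define P where "P = mat_of_cols n [a \<cdot>\<^sub>v u', a \<cdot>\<^sub>v y']"
  have P: "P \<in> carrier_mat n 2" using mat_of_cols_carrier(1)[of n "[a \<cdot>\<^sub>v u', a \<cdot>\<^sub>v y']"] by (simp add: P_def numeral_2_eq_2)
  have P0: "col P 0 = a \<cdot>\<^sub>v u'" and P1: "col P 1 = a \<cdot>\<^sub>v y'"
    unfolding P_def using u' y' by (subst col_mat_of_cols; auto)+
  have fs: "(M *\<^sub>v (a \<cdot>\<^sub>v c)) \<bullet>c (a \<cdot>\<^sub>v b) = (a * cnj a) * f b c" if "b \<in> carrier_vec n" "c \<in> carrier_vec n" for b c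
  proof -
    have "M *\<^sub>v (a \<cdot>\<^sub>v c) = a \<cdot>\<^sub>v (M *\<^sub>v c)" by (rule mult_mat_vec[OF M that(2)])
    then show ?thesis using that by (simp add: cscalar_prod_smult[of _ n] f_def)
  qed
  have G: "adj P * M * P = jordan_block2"
  proof (rule eq_mat_2)
    show "adj P * M * P \<in> carrier_mat 2 2" using P M by auto
  next
    show "(adj P * M * P) $$ (0,0) = jordan_block2 $$ (0,0)"
      using gram_index[OF P M, of 0 0] fs[OF u' u'] fuu' aa by (simp add: P0 jordan_block2_index)
    show "(adj P * M * P) $$ (0,1) = jordan_block2 $$ (0,1)"
      using gram_index[OF P M, of 0 1] fs[OF u' y'] fuy aa by (simp add: P0 P1[simplified] jordan_block2_index)
    show "(adj P * M * P) $$ (1,0) = jordan_block2 $$ (1,0)"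
      using gram_index[OF P M, of 1 0] fs[OF y' u'] fyu aa by (simp add: P0 P1[simplified] jordan_block2_index)
    show "(adj P * M * P) $$ (1,1) = jordan_block2 $$ (1,1)"
      using gram_index[OF P M, of 1 1] fs[OF y' y'] fyy aa by (simp add: P0 P1[simplified] jordan_block2_index)
  qed simp
  have dG: "det (adj P * M * P) \<noteq> 0" unfolding G by (simp add: det_jordan_block2)
  \<comment> \<open>By the chain equations \<open>M\<close> and \<open>adj M\<close> map the span of
    \<open>u\<close> and \<open>v\<close> onto the same subspace, so orthogonality of
    \<open>w\<close> to the image under \<open>adj M\<close> is orthogonality to the image under
    \<open>M\<close>.\<close>
  have two: "adj P *\<^sub>v (adj M *\<^sub>v w) = 0\<^sub>v 2"
    if w: "w \<in> carrier_vec n" and z: "adj P *\<^sub>v (M *\<^sub>v w) = 0\<^sub>v 2" for w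
  proof -
    have p: "(M *\<^sub>v w) \<bullet>c b = w \<bullet>c (adj M *\<^sub>v b)" if "b \<in> carrier_vec n" for b
      by (rule cscalar_prod_adj[OF M w that])
    have r: "(adj M *\<^sub>v w) \<bullet>c b = w \<bullet>c (M *\<^sub>v b)" if "b \<in> carrier_vec n" for b
      using cscalar_prod_adj[OF aM w that] by simp
    have "(M *\<^sub>v w) \<bullet>c (a \<cdot>\<^sub>v u') = (adj P *\<^sub>v (M *\<^sub>v w)) $ 0"
      using adj_mult_vec_index[OF P Mc(1)[OF w], of 0] P0 by simp
    then have pu': "(M *\<^sub>v w) \<bullet>c u' = 0" using z a w u' by (simp add: cscalar_prod_smult[of _ n])
    have "(M *\<^sub>v w) \<bullet>c (a \<cdot>\<^sub>v y') = (adj P *\<^sub>v (M *\<^sub>v w)) $ 1"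
      using adj_mult_vec_index[OF P Mc(1)[OF w], of 1] P1 by simp
    then have py: "(M *\<^sub>v w) \<bullet>c y' = 0" using z a w y' by (simp add: cscalar_prod_smult[of _ n])
    have pv: "(M *\<^sub>v w) \<bullet>c v = 0"
      using py pu' cscalar_prod_add_right[of u' n v "M *\<^sub>v w" "1/2"] u' v w by (simp add: y'_def)
    have pu: "(M *\<^sub>v w) \<bullet>c u = 0"
      using pv pu' cscalar_prod_add_right[of u n v "M *\<^sub>v w" t] u v w by (simp add: u'_def)
    have "w \<bullet>c (M *\<^sub>v v) = - (w \<bullet>c (adj M *\<^sub>v v))" unfolding Fv using w v by (simp add: cscalar_prod_smult[of _ n])
    then have rv: "w \<bullet>c (M *\<^sub>v v) = 0" using pv p[OF v(1)] by simp
    have "w \<bullet>c (adj M *\<^sub>v u) = w \<bullet>c (M *\<^sub>v v + (- 1) \<cdot>\<^sub>v (M *\<^sub>v u))"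
      unfolding Fu using u v by (simp add: comm_add_vec[of _ n])
    also have "\<dots> = w \<bullet>c (M *\<^sub>v v) - w \<bullet>c (M *\<^sub>v u)"
      using cscalar_prod_add_right[of "M *\<^sub>v v" n "M *\<^sub>v u" w "- 1"] u v w by simp
    finally have ru: "w \<bullet>c (M *\<^sub>v u) = 0" using rv pu p[OF u] by simp
    have ru': "w \<bullet>c (M *\<^sub>v u') = 0"
      using cscalar_prod_add_right[of "M *\<^sub>v u" n "M *\<^sub>v v" w t] u v w ru rv by (simp add: Mu')
    have ry': "w \<bullet>c (M *\<^sub>v y') = 0"
      using cscalar_prod_add_right[of "M *\<^sub>v u'" n "M *\<^sub>v v" w "1/2"] u' v w ru' rv by (simp add: My')
    have "(adj P *\<^sub>v (adj M *\<^sub>v w)) $ 0 = 0"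
      using adj_mult_vec_index[OF P Mc(2)[OF w], of 0] P0 r[OF u'] ru' u' w by (simp add: cscalar_prod_smult[of _ n])
    moreover have "(adj P *\<^sub>v (adj M *\<^sub>v w)) $ 1 = 0"
      using adj_mult_vec_index[OF P Mc(2)[OF w], of 1] P1 r[OF y'] ry' y' w by (simp add: cscalar_prod_smult[of _ n])
    ultimately have "(adj P *\<^sub>v (adj M *\<^sub>v w)) $ i = 0" if "i < 2" for i
      using that by (auto simp: less_2_cases_iff)
    then show ?thesis using P by (intro eq_vecI) (auto simp del: index_mult_mat_vec)
  qed
  obtain m Q where "n = 2 + m" "Q \<in> carrier_mat n m"
    "congruent_mat M (block_sum (adj P * M * P) (adj Q * M * Q))"
    by (rule congruence_split[OF M P dG two])
  then show thesis using that G by simp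
qed

text \<open>If some eigenvector of \<open>M\<^sup>-\<^sup>1 M\<^sup>*\<close> is not isotropic, it splits off a scalar block. Otherwise \<open>- 1\<close> is the
  only eigenvalue, and a Jordan chain of length two spans a block congruent to \<open>[[1, 2], [0, 1]]\<close>.\<close>

lemma accretive_canonical_blocks:
  assumes "M \<in> carrier_mat n n" "det M \<noteq> 0" "accretive 0 M"
  shows "\<exists>\<theta>s k. set \<theta>s \<subseteq> {- pi / 2..pi / 2} \<and>
    congruent_mat M (diag_block_mat (map (\<lambda>\<theta>. scalar_mat1 (cis \<theta>)) \<theta>s @ replicate k jordan_block2))"
  using assms
proof (induction n arbitrary: M rule: less_induct)
  case (less n M)
  note M = less.prems(1) and det = less.prems(2) and acc = less.prems(3)
  have IH: "\<exists>\<theta>s k. set \<theta>s \<subseteq> {- pi / 2..pi / 2} \<and> congruent_mat (adj Q * M * Q)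
      (diag_block_mat (map (\<lambda>\<theta>. scalar_mat1 (cis \<theta>)) \<theta>s @ replicate k jordan_block2))"
    if Q: "Q \<in> carrier_mat n m" and m: "m < n" and G: "G \<in> carrier_mat p p"
      and c: "congruent_mat M (block_sum G (adj Q * M * Q))" for m Q p G
  proof (rule less.IH[OF m])
    show M': "adj Q * M * Q \<in> carrier_mat m m" using M Q by auto
    show "accretive 0 (adj Q * M * Q)" by (rule accretive_compression[OF M acc Q])
    show "det (adj Q * M * Q) \<noteq> 0"
      using congruent_det[OF c] det det_block_sum[OF G M'] by auto
  qed
  show ?case
  proof (cases "n = 0")
    case True
    then have "M = diag_block_mat []" using M by (intro eq_matI) auto
    then show ?thesis using congruent_mat_refl[OF M] by (intro exI[of _ "[]"] exI[of _ 0]) auto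
  next
    case n0: False
    show ?thesis
    proof (cases "\<exists>\<mu> v. v \<in> carrier_vec n \<and> v \<noteq> 0\<^sub>v n \<and> adj M *\<^sub>v v = \<mu> \<cdot>\<^sub>v (M *\<^sub>v v) \<and> quad_form M v \<noteq> 0")
      case True
      then obtain \<mu> v where "v \<in> carrier_vec n" "v \<noteq> 0\<^sub>v n" "adj M *\<^sub>v v = \<mu> \<cdot>\<^sub>v (M *\<^sub>v v)" "quad_form M v \<noteq> 0"
        by blast
      from split_scalar_block[OF M det acc this] obtain \<theta> m Q where
        *: "n = 1 + m" "\<theta> \<in> {- pi / 2..pi / 2}" "Q \<in> carrier_mat n m"
          "congruent_mat M (block_sum (scalar_mat1 (cis \<theta>)) (adj Q * M * Q))" by blast
      have "m < n" using * by simp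
      from IH[OF *(3) this _ *(4), of 1] obtain \<theta>s k where
        **: "set \<theta>s \<subseteq> {- pi / 2..pi / 2}" "congruent_mat (adj Q * M * Q)
          (diag_block_mat (map (\<lambda>\<theta>. scalar_mat1 (cis \<theta>)) \<theta>s @ replicate k jordan_block2))" by auto
      have "congruent_mat M (diag_block_mat (map (\<lambda>\<theta>. scalar_mat1 (cis \<theta>)) (\<theta> # \<theta>s) @ replicate k jordan_block2))"
        unfolding list.map append_Cons diag_block_mat_Cons
        by (rule congruent_mat_trans[OF *(4) congruent_block_sum[OF congruent_mat_refl[of _ 1] **(2)]]) auto
      moreover have "set (\<theta> # \<theta>s) \<subseteq> {- pi / 2..pi / 2}" using * ** by auto
      ultimately show ?thesis by blast
    next
      case False
      then have iso: "quad_form M v = 0"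
        if "v \<in> carrier_vec n" "v \<noteq> 0\<^sub>v n" "adj M *\<^sub>v v = \<mu> \<cdot>\<^sub>v (M *\<^sub>v v)" for \<mu> v using that by blast
      obtain M' where M': "M' \<in> carrier_mat n n" "M * M' = 1\<^sub>m n" "M' * M = 1\<^sub>m n"
        using det_nonzero_inverse[OF M det] .
      define J where "J = M' * adj M"
      have J: "J \<in> carrier_mat n n" using M M' by (auto simp: J_def)
      have MJ: "M *\<^sub>v (J *\<^sub>v x) = adj M *\<^sub>v x" if "x \<in> carrier_vec n" for x
      proof -
        have "M *\<^sub>v (J *\<^sub>v x) = (M * J) *\<^sub>v x"
          by (rule mult_vec_assoc_dim[symmetric]) (use M J that in auto)
        also have "M * J = adj M"
          unfolding J_def by (rule mult_cancel_inverse[OF M'(2)]) (use M M'(1) in auto)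
        finally show ?thesis .
      qed
      \<comment> \<open>Isotropy gives \<open>M v + adj M v = 0\<close>, while the eigenvalue
        equation makes this sum \<open>1 + e\<close> times the nonzero vector
        \<open>M v\<close>.\<close>
      have ev: "e = - 1" if e: "eigenvalue J e" for e
      proof -
        obtain v where v: "v \<in> carrier_vec n" "v \<noteq> 0\<^sub>v n" "J *\<^sub>v v = e \<cdot>\<^sub>v v"
          using e J unfolding eigenvalue_def eigenvector_def by auto
        have av: "adj M *\<^sub>v v = e \<cdot>\<^sub>v (M *\<^sub>v v)"
          using MJ[OF v(1)] v(3) mult_mat_vec[OF M v(1)] by simp
        have "M *\<^sub>v v + adj M *\<^sub>v v = 0\<^sub>v n"
          using accretive_isotropic[OF M acc v(1)] iso[OF v(1,2) av] by simp
        moreover have "M *\<^sub>v v + adj M *\<^sub>v v = (1 + e) \<cdot>\<^sub>v (M *\<^sub>v v)"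
          unfolding av using M by (intro eq_vecI) (auto simp: algebra_simps simp del: index_mult_mat_vec)
        ultimately have z: "(1 + e) \<cdot>\<^sub>v (M *\<^sub>v v) = 0\<^sub>v n" by simp
        have "M *\<^sub>v v \<noteq> 0\<^sub>v n" using det_nonzeroD[OF M det v(1)] v(2) by auto
        then have "1 + e = 0" using z smult_vec_eq_zero[of "M *\<^sub>v v" n "1 + e"] M v(1) by simp
        then show ?thesis by (simp add: add_eq_0_iff)
      qed
      \<comment> \<open>If \<open>J\<close> were \<open>- 1\<close>, every nonzero vector would be
        an eigenvector, hence isotropic, and a matrix whose form vanishes identically is 0.\<close>
      have ne: "\<not> (\<forall>x \<in> carrier_vec n. J *\<^sub>v x = (- 1) \<cdot>\<^sub>v x)"
      proof
        assume all: "\<forall>x \<in> carrier_vec n. J *\<^sub>v x = (- 1) \<cdot>\<^sub>v x"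
        have q0: "quad_form M x = 0" if x: "x \<in> carrier_vec n" for x
        proof (cases "x = 0\<^sub>v n")
          case True
          then show ?thesis using M by (simp add: quad_form_def mult_mat_vec_zero)
        next
          case False
          have "adj M *\<^sub>v x = (- 1) \<cdot>\<^sub>v (M *\<^sub>v x)"
            using MJ[OF x] all x mult_mat_vec[OF M x, of "- 1"] by simp
          then show ?thesis using iso[OF x False] by blast
        qed
        have "unit_vec n 0 = (0\<^sub>v n :: complex vec)"
          by (rule det_nonzeroD[OF M det]) (auto intro: quad_form_zero_imp_zero[OF M q0])
        then have "unit_vec n 0 $ 0 = (0\<^sub>v n :: complex vec) $ 0" by simp
        then show False using n0 by simp
      qed
      obtain u v where uv: "u \<in> carrier_vec n" "v \<in> carrier_vec n" "v \<noteq> 0\<^sub>v n"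
        "J *\<^sub>v v = (- 1) \<cdot>\<^sub>v v" "J *\<^sub>v u = (- 1) \<cdot>\<^sub>v u + v"
        by (rule generalized_eigenvector_pair[OF J ev ne])
      have Fv: "adj M *\<^sub>v v = (- 1) \<cdot>\<^sub>v (M *\<^sub>v v)"
        using MJ[OF uv(2)] uv(4) mult_mat_vec[OF M uv(2), of "- 1"] by simp
      have Fu: "adj M *\<^sub>v u = (- 1) \<cdot>\<^sub>v (M *\<^sub>v u) + M *\<^sub>v v"
        using MJ[OF uv(1)] uv(5) mult_mat_vec[OF M uv(1), of "- 1"]
          mult_add_distrib_mat_vec[OF M, of "(- 1) \<cdot>\<^sub>v u" v] uv(1,2) by simp
      obtain m Q where *: "n = 2 + m" "Q \<in> carrier_mat n m"
        "congruent_mat M (block_sum jordan_block2 (adj Q * M * Q))"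
        by (rule split_jordan_block[OF M det acc uv(1,2,3) Fv Fu iso[OF uv(2,3) Fv]])
      have "m < n" using * by simp
      from IH[OF *(2) this jordan_block2_carrier *(3)] obtain \<theta>s k where
        **: "set \<theta>s \<subseteq> {- pi / 2..pi / 2}" "congruent_mat (adj Q * M * Q)
          (diag_block_mat (map (\<lambda>\<theta>. scalar_mat1 (cis \<theta>)) \<theta>s @ replicate k jordan_block2))" by blast
      have "congruent_mat M (diag_block_mat (jordan_block2 # map (\<lambda>\<theta>. scalar_mat1 (cis \<theta>)) \<theta>s @ replicate k jordan_block2))"
        unfolding diag_block_mat_Cons
        by (rule congruent_mat_trans[OF *(3) congruent_block_sum[OF congruent_mat_refl[of _ 2] **(2)]]) auto
      moreover have "congruent_mat (diag_block_mat (jordan_block2 # map (\<lambda>\<theta>. scalar_mat1 (cis \<theta>)) \<theta>s @ replicate k jordan_block2))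
        (diag_block_mat (map (\<lambda>\<theta>. scalar_mat1 (cis \<theta>)) \<theta>s @ replicate (Suc k) jordan_block2))"
        by (rule congruent_diag_block_perm) (auto simp: carrier_matD[OF jordan_block2_carrier])
      ultimately show ?thesis using **(1) congruent_mat_trans by blast
    qed
  qed
qed

subsection \<open>Phases and inertia\<close>

text \<open>The nonsingular part common to all decompositions that define phases;
  \<open>k = 0\<close> covers the sectorial and the rotated Hermitian ones.\<close>

definition phase_blocks :: "real \<Rightarrow> real list \<Rightarrow> nat \<Rightarrow> complex mat" where
  "phase_blocks \<gamma> \<theta> k =
    diag_block_mat (map (\<lambda>t. scalar_mat1 (cis t)) \<theta> @ replicate k (cis \<gamma> \<cdot>\<^sub>m jordan_block2))"

text \<open>The centre \<open>\<gamma>\<close> of the half-plane is prescribed and need not be the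
  midpoint of the extreme phases. A compression can thus keep the centre of the original matrix,
  which makes the two lists of phases comparable.\<close>

definition canonical_phases :: "real \<Rightarrow> complex mat \<Rightarrow> real list \<Rightarrow> bool" where
  "canonical_phases \<gamma> M \<phi> \<longleftrightarrow> (\<exists>\<theta> k. sorted_wrt (\<ge>) \<theta> \<and> set \<theta> \<subseteq> {\<gamma> - pi / 2..\<gamma> + pi / 2} \<and>
    \<phi> = replicate k (\<gamma> + pi / 2) @ \<theta> @ replicate k (\<gamma> - pi / 2) \<and>
    congruent_mat M (phase_blocks \<gamma> \<theta> k))"

lemma smult_diag_block_mat:
  fixes c :: complex
  shows "c \<cdot>\<^sub>m diag_block_mat As = diag_block_mat (map (\<lambda>A. c \<cdot>\<^sub>m A) As)"
proof (induction As)
  case (Cons A As)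
  have "c \<cdot>\<^sub>m block_sum A (diag_block_mat As) = block_sum (c \<cdot>\<^sub>m A) (c \<cdot>\<^sub>m diag_block_mat As)"
    unfolding block_sum_def by (intro eq_matI) (auto simp: Let_def)
  then show ?case using Cons by (simp add: diag_block_mat_Cons del: diag_block_mat.simps)
qed (auto intro!: eq_matI)

lemma congruent_smult:
  assumes "congruent_mat A B"
  shows "congruent_mat (c \<cdot>\<^sub>m A) (c \<cdot>\<^sub>m B)"
proof -
  obtain n T where 1: "A \<in> carrier_mat n n" "B \<in> carrier_mat n n" "T \<in> carrier_mat n n" "det T \<noteq> 0"
    "A = adj T * B * T" using assms by (rule congruent_matE)
  have "c \<cdot>\<^sub>m A = adj T * (c \<cdot>\<^sub>m B) * T"
    unfolding 1(5) using mult_smult_distrib[OF adj_carrier[OF 1(3)] 1(2), of c]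
      mult_smult_assoc_mat[OF mult_carrier_mat[OF adj_carrier[OF 1(3)] 1(2)] 1(3), of c] by simp
  then show ?thesis using 1(1-4) by (intro congruent_matI[of _ n _ T]) auto
qed

lemma accretive_canonical_phases:
  assumes M: "M \<in> carrier_mat n n" and det: "det M \<noteq> 0" and acc: "accretive \<gamma> M"
  obtains \<phi> where "canonical_phases \<gamma> M \<phi>"
proof -
  define N where "N = cis (- \<gamma>) \<cdot>\<^sub>m M"
  have N: "N \<in> carrier_mat n n" using M by (simp add: N_def)
  have NM: "cis \<gamma> \<cdot>\<^sub>m N = M" unfolding N_def by (intro eq_matI) (auto simp: cis_mult simp flip: mult.assoc)
  have "accretive 0 N"
    using acc M unfolding accretive_def N_def by (simp add: quad_form_smult_mat[OF M])
  moreover have "det N \<noteq> 0" using det unfolding N_def by (simp add: det_smult)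
  ultimately obtain \<theta>s k where *: "set \<theta>s \<subseteq> {- pi / 2..pi / 2}"
    "congruent_mat N (diag_block_mat (map (\<lambda>\<theta>. scalar_mat1 (cis \<theta>)) \<theta>s @ replicate k jordan_block2))"
    using accretive_canonical_blocks[OF N] by blast
  define \<theta> where "\<theta> = rev (sort (map ((+) \<gamma>) \<theta>s))"
  have "congruent_mat M (cis \<gamma> \<cdot>\<^sub>m diag_block_mat (map (\<lambda>\<theta>. scalar_mat1 (cis \<theta>)) \<theta>s @ replicate k jordan_block2))"
    using congruent_smult[OF *(2), of "cis \<gamma>"] NM by simp
  also have "cis \<gamma> \<cdot>\<^sub>m diag_block_mat (map (\<lambda>\<theta>. scalar_mat1 (cis \<theta>)) \<theta>s @ replicate k jordan_block2) =
    diag_block_mat (map (\<lambda>t. scalar_mat1 (cis t)) (map ((+) \<gamma>) \<theta>s) @ replicate k (cis \<gamma> \<cdot>\<^sub>m jordan_block2))"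
    unfolding smult_diag_block_mat
    by (intro arg_cong[of _ _ diag_block_mat]) (auto intro!: eq_matI simp: cis_mult)
  finally have c1: "congruent_mat M (diag_block_mat (map (\<lambda>t. scalar_mat1 (cis t)) (map ((+) \<gamma>) \<theta>s) @
    replicate k (cis \<gamma> \<cdot>\<^sub>m jordan_block2)))" .
  have "congruent_mat (diag_block_mat (map (\<lambda>t. scalar_mat1 (cis t)) (map ((+) \<gamma>) \<theta>s) @
    replicate k (cis \<gamma> \<cdot>\<^sub>m jordan_block2))) (phase_blocks \<gamma> \<theta> k)"
    unfolding phase_blocks_def
  proof (rule congruent_diag_block_perm)
    have "mset \<theta> = mset (map ((+) \<gamma>) \<theta>s)" by (simp add: \<theta>_def)
    then show "mset (map (\<lambda>t. scalar_mat1 (cis t)) (map ((+) \<gamma>) \<theta>s) @ replicate k (cis \<gamma> \<cdot>\<^sub>m jordan_block2)) =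
      mset (map (\<lambda>t. scalar_mat1 (cis t)) \<theta> @ replicate k (cis \<gamma> \<cdot>\<^sub>m jordan_block2))"
      by (simp only: mset_append mset_map)
  qed (auto simp: carrier_matD[OF jordan_block2_carrier])
  then have "congruent_mat M (phase_blocks \<gamma> \<theta> k)" using c1 congruent_mat_trans by blast
  moreover have "sorted_wrt (\<ge>) \<theta>" unfolding \<theta>_def by (simp add: sorted_wrt_rev)
  moreover have "set \<theta> \<subseteq> {\<gamma> - pi / 2..\<gamma> + pi / 2}" using *(1) by (auto simp: \<theta>_def)
  ultimately show thesis using that unfolding canonical_phases_def by blast
qed

lemma canonical_phases_sorted:
  assumes "canonical_phases \<gamma> M \<phi>"
  shows "sorted_wrt (\<ge>) \<phi>" "set \<phi> \<subseteq> {\<gamma> - pi / 2..\<gamma> + pi / 2}"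
proof -
  have r: "sorted_wrt (\<ge>) (replicate k x)" for k and x :: real
    by (induction k) auto
  show "sorted_wrt (\<ge>) \<phi>" "set \<phi> \<subseteq> {\<gamma> - pi / 2..\<gamma> + pi / 2}"
    using assms unfolding canonical_phases_def by (fastforce simp: sorted_wrt_append r)+
qed

lemma scalar_mat1_carrier [simp]: "scalar_mat1 z \<in> carrier_mat 1 1"
  by simp

lemma replicate_block_carrier:
  fixes A :: "complex mat"
  assumes "A \<in> carrier_mat m m"
  shows "diag_block_mat (replicate k A) \<in> carrier_mat (k * m) (k * m)"
proof (induction k)
  case (Suc k)
  from block_sum_carrier[OF assms this] show ?case by (simp add: diag_block_mat_Cons del: diag_block_mat.simps)
qed simp

lemma phase_blocks_Nil: "phase_blocks \<gamma> [] k = diag_block_mat (replicate k (cis \<gamma> \<cdot>\<^sub>m jordan_block2))"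
  by (simp add: phase_blocks_def)

lemma phase_blocks_Cons: "phase_blocks \<gamma> (t # \<theta>) k = block_sum (scalar_mat1 (cis t)) (phase_blocks \<gamma> \<theta> k)"
  by (simp add: phase_blocks_def diag_block_mat_Cons del: diag_block_mat.simps)

lemma phase_blocks_carrier: "phase_blocks \<gamma> \<theta> k \<in> carrier_mat (length \<theta> + 2 * k) (length \<theta> + 2 * k)"
proof (induction \<theta>)
  case Nil
  show ?case using replicate_block_carrier[of "cis \<gamma> \<cdot>\<^sub>m jordan_block2" 2 k]
    by (simp add: phase_blocks_Nil mult.commute)
next
  case (Cons t \<theta>)
  from block_sum_carrier[OF scalar_mat1_carrier this] show ?case by (simp add: phase_blocks_Cons)
qed

lemma canonical_phases_length:
  assumes "canonical_phases \<gamma> M \<phi>" "M \<in> carrier_mat n n"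
  shows "length \<phi> = n"
proof -
  obtain \<theta> k where *: "\<phi> = replicate k (\<gamma> + pi / 2) @ \<theta> @ replicate k (\<gamma> - pi / 2)"
    "congruent_mat M (phase_blocks \<gamma> \<theta> k)" using assms unfolding canonical_phases_def by blast
  obtain m where "M \<in> carrier_mat m m" "phase_blocks \<gamma> \<theta> k \<in> carrier_mat m m"
    using *(2) by (meson congruent_matE)
  then have "n = length \<theta> + 2 * k" using phase_blocks_carrier[of \<gamma> \<theta> k] assms(2) by (metis carrier_matD(1))
  then show ?thesis using * by simp
qed

text \<open>A Jordan block contributes \<open>cis (2 * \<gamma>)\<close>, the product of the unit
  numbers at its two phases \<open>\<gamma> + pi / 2\<close> and
  \<open>\<gamma> - pi / 2\<close>.\<close>

lemma phase_blocks_det: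
  "det (phase_blocks \<gamma> \<theta> k) = cis (sum_list (replicate k (\<gamma> + pi / 2) @ \<theta> @ replicate k (\<gamma> - pi / 2)))"
proof -
  have J: "cis \<gamma> \<cdot>\<^sub>m jordan_block2 \<in> carrier_mat 2 2" by simp
  have dJ: "det (cis \<gamma> \<cdot>\<^sub>m jordan_block2) = cis (2 * \<gamma>)"
    by (simp add: det_smult det_jordan_block2 carrier_matD[OF jordan_block2_carrier] power2_eq_square cis_mult)
  have 1: "det (diag_block_mat (replicate k (cis \<gamma> \<cdot>\<^sub>m jordan_block2))) = cis (k * (2 * \<gamma>))" for k
  proof (induction k)
    case (Suc k)
    from det_block_sum[OF J replicate_block_carrier[OF J, of k]] show ?case
      using Suc dJ by (simp add: diag_block_mat_Cons cis_mult algebra_simps del: diag_block_mat.simps)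
  qed (simp add: det_dim_zero)
  have "det (phase_blocks \<gamma> \<theta> k) = cis (sum_list \<theta> + k * (2 * \<gamma>))"
  proof (induction \<theta>)
    case (Cons t \<theta>)
    have "det (phase_blocks \<gamma> (t # \<theta>) k) = cis t * det (phase_blocks \<gamma> \<theta> k)"
      using det_block_sum[OF scalar_mat1_carrier phase_blocks_carrier, of "cis t" \<gamma> \<theta> k]
      by (simp add: det_single phase_blocks_Cons)
    then show ?case using Cons by (simp add: cis_mult add.assoc)
  qed (simp add: phase_blocks_Nil 1)
  then show ?thesis by (simp add: sum_list_replicate algebra_simps)
qed

lemma canonical_phases_det:
  assumes "canonical_phases \<gamma> M \<phi>"
  shows "\<exists>c>0. det M = of_real c * cis (sum_list \<phi>)"
proof -
  obtain \<theta> k where "\<phi> = replicate k (\<gamma> + pi / 2) @ \<theta> @ replicate k (\<gamma> - pi / 2)"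
    "congruent_mat M (phase_blocks \<gamma> \<theta> k)" using assms unfolding canonical_phases_def by blast
  then show ?thesis using congruent_det phase_blocks_det by metis
qed

text \<open>The columns of \<open>P\<close> span a subspace on which the rotated form is definite;
  strict positivity already makes \<open>P\<close> injective. The number \<open>p\<close> is only a
  lower bound for the index of inertia, and lower bounds for \<open>z\<close> and \<open>- z\<close>
  are all that the dimension count uses.\<close>

definition positive_index :: "complex \<Rightarrow> complex mat \<Rightarrow> nat \<Rightarrow> bool" where
  "positive_index z M p \<longleftrightarrow> (\<exists>P \<in> carrier_mat (dim_row M) p.
    \<forall>x \<in> carrier_vec p. x \<noteq> 0\<^sub>v p \<longrightarrow> 0 < Re (z * quad_form M (P *\<^sub>v x)))"

lemma positive_index_0: "positive_index z M 0"
  unfolding positive_index_def by (intro bexI[of _ "0\<^sub>m (dim_row M) 0"]) auto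

lemma Re_complex_of_real_mult: "Re (complex_of_real r * w) = r * Re w"
  by simp

lemma positive_index_1:
  assumes M: "M \<in> carrier_mat n n" and x: "x \<in> carrier_vec n" "0 < Re (z * quad_form M x)"
  shows "positive_index z M 1"
  unfolding positive_index_def
proof (intro bexI[of _ "mat_of_cols n [x]"] ballI impI)
  show "mat_of_cols n [x] \<in> carrier_mat (dim_row M) 1"
    using M mat_of_cols_carrier(1)[of n "[x]"] by simp
  fix y :: "complex vec" assume y: "y \<in> carrier_vec 1" "y \<noteq> 0\<^sub>v 1"
  have y0: "y $ 0 \<noteq> 0"
  proof
    assume "y $ 0 = 0"
    then have "y = 0\<^sub>v 1" using y(1) by (intro eq_vecI) auto
    then show False using y(2) by simp
  qed
  have "mat_of_cols n [x] *\<^sub>v y = y $ 0 \<cdot>\<^sub>v x"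
    using x y(1) by (intro eq_vecI) (auto simp: scalar_prod_def mat_of_cols_index)
  then have "z * quad_form M (mat_of_cols n [x] *\<^sub>v y) = y $ 0 * cnj (y $ 0) * (z * quad_form M x)"
    using quad_form_smult_vec[OF M x(1), of "y $ 0"] by simp
  then have "Re (z * quad_form M (mat_of_cols n [x] *\<^sub>v y)) = (cmod (y $ 0))\<^sup>2 * Re (z * quad_form M x)"
    unfolding complex_norm_square[symmetric] by (simp only: Re_complex_of_real_mult)
  then show "0 < Re (z * quad_form M (mat_of_cols n [x] *\<^sub>v y))" using x(2) y0 by simp
qed

lemma zero_append_vec: "0\<^sub>v (p + q) = (0\<^sub>v p @\<^sub>v 0\<^sub>v q :: complex vec)"
  by (intro eq_vecI) auto

lemma positive_index_block_sum:
  assumes A: "A \<in> carrier_mat n n" "positive_index z A p" and B: "B \<in> carrier_mat m m" "positive_index z B q"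
  shows "positive_index z (block_sum A B) (p + q)"
proof -
  obtain P where P: "P \<in> carrier_mat n p"
    "\<And>x. x \<in> carrier_vec p \<Longrightarrow> x \<noteq> 0\<^sub>v p \<Longrightarrow> 0 < Re (z * quad_form A (P *\<^sub>v x))"
    using A by (auto simp: positive_index_def)
  obtain Q where Q: "Q \<in> carrier_mat m q"
    "\<And>x. x \<in> carrier_vec q \<Longrightarrow> x \<noteq> 0\<^sub>v q \<Longrightarrow> 0 < Re (z * quad_form B (Q *\<^sub>v x))"
    using B by (auto simp: positive_index_def)
  show ?thesis unfolding positive_index_def
  proof (intro bexI[of _ "block_sum P Q"] ballI impI)
    fix w :: "complex vec" assume w: "w \<in> carrier_vec (p + q)" "w \<noteq> 0\<^sub>v (p + q)"
    define x y where "x = vec_first w p" and "y = vec_last w q"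
    have xy: "x \<in> carrier_vec p" "y \<in> carrier_vec q" and wxy: "w = x @\<^sub>v y"
      using w(1) by (auto simp: x_def y_def)
    have "quad_form (block_sum A B) (block_sum P Q *\<^sub>v w) = quad_form A (P *\<^sub>v x) + quad_form B (Q *\<^sub>v y)"
      unfolding wxy using P(1) Q(1) xy A(1) B(1)
      by (simp add: block_sum_mult_vec[OF P(1) Q(1) xy] quad_form_block_sum[OF A(1) B(1)])
    then have e: "Re (z * quad_form (block_sum A B) (block_sum P Q *\<^sub>v w)) =
      Re (z * quad_form A (P *\<^sub>v x)) + Re (z * quad_form B (Q *\<^sub>v y))" by (simp add: algebra_simps)
    have zz: "quad_form A (P *\<^sub>v 0\<^sub>v p) = 0" "quad_form B (Q *\<^sub>v 0\<^sub>v q) = 0"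
      using P(1) Q(1) A(1) B(1) by (simp_all add: mult_mat_vec_zero quad_form_def)
    have "x \<noteq> 0\<^sub>v p \<or> y \<noteq> 0\<^sub>v q" using w(2) wxy zero_append_vec by metis
    then show "0 < Re (z * quad_form (block_sum A B) (block_sum P Q *\<^sub>v w))"
      unfolding e using P(2)[OF xy(1)] Q(2)[OF xy(2)] zz
      by (cases "x = 0\<^sub>v p"; cases "y = 0\<^sub>v q") (auto simp: add_pos_pos)
  next
    show "block_sum P Q \<in> carrier_mat (dim_row (block_sum A B)) (p + q)"
      using block_sum_carrier[OF P(1) Q(1)] block_sum_carrier[OF A(1) B(1)] by simp
  qed
qed

lemma positive_index_compression:
  assumes M: "M \<in> carrier_mat n n" and S: "S \<in> carrier_mat n m"
    and pos: "positive_index z (adj S * M * S) p"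
  shows "positive_index z M p"
proof -
  obtain P where P: "P \<in> carrier_mat m p"
    "\<And>x. x \<in> carrier_vec p \<Longrightarrow> x \<noteq> 0\<^sub>v p \<Longrightarrow> 0 < Re (z * quad_form (adj S * M * S) (P *\<^sub>v x))"
    using pos S by (auto simp: positive_index_def)
  show ?thesis unfolding positive_index_def
  proof (intro bexI[of _ "S * P"] ballI impI)
    fix x :: "complex vec" assume x: "x \<in> carrier_vec p" "x \<noteq> 0\<^sub>v p"
    have "quad_form (adj S * M * S) (P *\<^sub>v x) = quad_form M ((S * P) *\<^sub>v x)"
      using quad_form_congruence[OF S M, of "P *\<^sub>v x"] P(1) S x(1) by (simp add: mult_vec_assoc_dim)
    then show "0 < Re (z * quad_form M ((S * P) *\<^sub>v x))" using P(2)[OF x] by simp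
  qed (use M S P(1) in auto)
qed

lemma positive_index_congruent:
  assumes c: "congruent_mat M D" and pos: "positive_index z D p"
  shows "positive_index z M p"
proof -
  obtain n T where 1: "M \<in> carrier_mat n n" "D \<in> carrier_mat n n" "T \<in> carrier_mat n n" "det T \<noteq> 0"
    "M = adj T * D * T" using c by (rule congruent_matE)
  obtain S where S: "S \<in> carrier_mat n n" "T * S = 1\<^sub>m n" using det_nonzero_inverse[OF 1(3,4)] by blast
  have ST: "adj S * adj T = 1\<^sub>m n" using adj_mult[of T S] S 1(3) by simp
  have "adj S * M * S = adj S * (adj T * (D * (T * S)))"
    unfolding 1(5) using 1(2,3) S(1) by (simp add: mult_assoc_dim)
  also have "\<dots> = D"
    unfolding S(2) using mult_cancel_inverse[OF ST, of D] 1(2,3) S(1) by simp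
  finally have "adj S * M * S = D" .
  then show ?thesis using positive_index_compression[OF 1(1) S(1)] pos by simp
qed

text \<open>With more than \<open>n\<close> columns in total, \<open>[P Q]\<close> has a kernel
  vector. It yields \<open>Q y = - P x\<close>, and the form takes the same value at both vectors,
  against the opposite signs.\<close>

lemma positive_index_conflict:
  assumes M: "M \<in> carrier_mat n n" and p: "positive_index z M p" and q: "positive_index (- z) M q"
  shows "p + q \<le> n"
proof (rule ccontr)
  obtain P where P: "P \<in> carrier_mat n p"
    "\<And>x. x \<in> carrier_vec p \<Longrightarrow> x \<noteq> 0\<^sub>v p \<Longrightarrow> 0 < Re (z * quad_form M (P *\<^sub>v x))"
    using p M by (auto simp: positive_index_def)
  obtain Q where Q: "Q \<in> carrier_mat n q"
    "\<And>x. x \<in> carrier_vec q \<Longrightarrow> x \<noteq> 0\<^sub>v q \<Longrightarrow> Re (z * quad_form M (Q *\<^sub>v x)) < 0"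
    using q M by (auto simp: positive_index_def)
  assume "\<not> p + q \<le> n"
  moreover have S: "four_block_mat P Q (0\<^sub>m 0 p) (0\<^sub>m 0 q) \<in> carrier_mat (n + 0) (p + q)"
    using P(1) Q(1) by (intro four_block_carrier_mat) auto
  ultimately obtain w where w: "w \<in> carrier_vec (p + q)" "w \<noteq> 0\<^sub>v (p + q)"
    "four_block_mat P Q (0\<^sub>m 0 p) (0\<^sub>m 0 q) *\<^sub>v w = 0\<^sub>v (n + 0)"
    using wide_mat_kernel[OF S] by auto
  define x y where "x = vec_first w p" and "y = vec_last w q"
  have xy: "x \<in> carrier_vec p" "y \<in> carrier_vec q" and wxy: "w = x @\<^sub>v y"
    using w(1) by (auto simp: x_def y_def)
  have Px: "P *\<^sub>v x \<in> carrier_vec n" and Qy: "Q *\<^sub>v y \<in> carrier_vec n" using P Q xy by auto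
  have app: "four_block_mat P Q (0\<^sub>m 0 p) (0\<^sub>m 0 q) *\<^sub>v w = (P *\<^sub>v x + Q *\<^sub>v y) @\<^sub>v (0\<^sub>m 0 p *\<^sub>v x + 0\<^sub>m 0 q *\<^sub>v y)"
    unfolding wxy using P(1) Q(1) xy by (intro four_block_mat_mult_vec) auto
  have e: "(P *\<^sub>v x + Q *\<^sub>v y) $ i = 0" if "i < n" for i
  proof -
    have "((P *\<^sub>v x + Q *\<^sub>v y) @\<^sub>v (0\<^sub>m 0 p *\<^sub>v x + 0\<^sub>m 0 q *\<^sub>v y)) $ i = 0"
      unfolding app[symmetric] using w(3) that by simp
    then show ?thesis using that Px Qy P(1) Q(1) by (simp add: index_append_vec del: index_mult_mat_vec)
  qed
  have "Q *\<^sub>v y = (- 1) \<cdot>\<^sub>v (P *\<^sub>v x)"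
  proof (rule eq_vecI)
    fix i assume "i < dim_vec ((- 1) \<cdot>\<^sub>v (P *\<^sub>v x))"
    then have i: "i < n" using P(1) by simp
    show "(Q *\<^sub>v y) $ i = ((- 1) \<cdot>\<^sub>v (P *\<^sub>v x)) $ i"
      using e[OF i] i P(1) Q(1) by (simp add: add_eq_0_iff del: index_mult_mat_vec)
  qed (use P Q in auto)
  then have qq: "quad_form M (Q *\<^sub>v y) = quad_form M (P *\<^sub>v x)"
    using quad_form_smult_vec[OF M Px, of "- 1"] by simp
  have zz: "quad_form M (P *\<^sub>v 0\<^sub>v p) = 0" "quad_form M (Q *\<^sub>v 0\<^sub>v q) = 0"
    using P(1) Q(1) M by (simp_all add: mult_mat_vec_zero quad_form_def)
  have "x \<noteq> 0\<^sub>v p \<or> y \<noteq> 0\<^sub>v q" using w(2) wxy zero_append_vec by metis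
  then show False
    using P(2)[OF xy(1)] Q(2)[OF xy(2)] qq zz by (cases "x = 0\<^sub>v p"; cases "y = 0\<^sub>v q") auto
qed

section \<open>Definite subspaces of the canonical blocks\<close>

lemma mult_mat_vec_index_2:
  fixes M :: "complex mat"
  assumes "M \<in> carrier_mat 2 2" "x \<in> carrier_vec 2" "i < 2"
  shows "(M *\<^sub>v x) $ i = M $$ (i,0) * x $ 0 + M $$ (i,1) * x $ 1"
  using assms by (simp add: scalar_prod_def numeral_2_eq_2)

lemma quad_form_2:
  assumes J: "J \<in> carrier_mat 2 2"
  shows "quad_form J (vec 2 (\<lambda>i. if i = 0 then x else y)) =
    J $$ (0,0) * x * cnj x + J $$ (0,1) * y * cnj x + J $$ (1,0) * x * cnj y + J $$ (1,1) * y * cnj y"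
proof -
  define v where "v = vec 2 (\<lambda>i. if i = 0 then x else y)"
  have v: "v \<in> carrier_vec 2" by (simp add: v_def)
  have "quad_form J v = (\<Sum>i<2. (J *\<^sub>v v) $ i * cnj (v $ i))"
    unfolding quad_form_def using v J by (simp add: scalar_prod_def lessThan_atLeast0)
  also have "\<dots> = (J *\<^sub>v v) $ 0 * cnj (v $ 0) + (J *\<^sub>v v) $ 1 * cnj (v $ 1)"
    by (simp only: lessThan_Suc numeral_2_eq_2) simp
  finally show ?thesis
    unfolding v_def[symmetric] using mult_mat_vec_index_2[OF J v, of 0] mult_mat_vec_index_2[OF J v, of 1]
    by (simp add: v_def algebra_simps)
qed

text \<open>At \<open>(1, -1 + \<i> * t)\<close> the form equals \<open>t^2 + 2 * \<i> * t\<close>.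
  Its first-order part is imaginary and takes either sign, so every half-plane not bounded by the
  imaginary axis is reached from both sides.\<close>

lemma positive_index_jordan_block:
  assumes "Im c \<noteq> 0"
  obtains x where "x \<in> carrier_vec 2" "0 < Re (c * quad_form jordan_block2 x)"
proof -
  \<comment> \<open>The real part of \<open>c\<close> times the form is
    \<open>t^2 * Re c - 2 * t * Im c\<close>. With \<open>t = - e * Im c\<close> it becomes
    \<open>e * (Im c)^2 * (e * Re c + 2)\<close>, and \<open>e\<close> is chosen to keep
    \<open>e * Re c > - 1\<close>.\<close>
  define e where "e = 1 / (1 + \<bar>Re c\<bar>)"
  define t where "t = - e * Im c"
  \<comment> \<open>a small perturbation of the isotropic vector \<open>(1, -1)\<close>\<close>
  define x where "x = vec 2 (\<lambda>i. if i = 0 then 1 else - 1 + \<i> * complex_of_real t)"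
  have x: "x \<in> carrier_vec 2" by (simp add: x_def)
  have q: "quad_form jordan_block2 x = of_real (t * t) + 2 * \<i> * of_real t"
    unfolding x_def quad_form_2[OF jordan_block2_carrier]
    by (simp add: jordan_block2_index complex_eq_iff)
  have e: "e > 0" "e * Re c > - 1"
  proof -
    show "e > 0" by (simp add: e_def add_pos_nonneg)
    have "e * \<bar>Re c\<bar> < 1" by (simp add: e_def divide_less_eq)
    moreover have "e * Re c \<ge> - (e * \<bar>Re c\<bar>)" using \<open>e > 0\<close>
      by (metis abs_ge_minus_self abs_mult abs_of_pos minus_le_iff)
    ultimately show "e * Re c > - 1" by linarith
  qed
  have "Re (c * quad_form jordan_block2 x) = e * (Im c)\<^sup>2 * (e * Re c + 2)"
    unfolding q by (simp add: t_def algebra_simps power2_eq_square)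
  also have "\<dots> > 0" using e assms by simp
  finally show thesis using that x by blast
qed

text \<open>Each Jordan block contributes one dimension, for \<open>z\<close> as well as for
  \<open>- z\<close>. This agrees with its two phases, of which one lies on either side of every
  direction strictly inside the half-plane.\<close>

lemma positive_index_phase_blocks:
  assumes "Im (z * cis \<gamma>) \<noteq> 0"
  shows "positive_index z (phase_blocks \<gamma> \<theta> k) (length (filter (\<lambda>t. 0 < Re (z * cis t)) \<theta>) + k)"
proof (induction \<theta>)
  case Nil
  have J: "cis \<gamma> \<cdot>\<^sub>m jordan_block2 \<in> carrier_mat 2 2" by simp
  obtain x where x: "x \<in> carrier_vec 2" "0 < Re (z * cis \<gamma> * quad_form jordan_block2 x)"
    using positive_index_jordan_block[OF assms] by blast
  have 1: "positive_index z (cis \<gamma> \<cdot>\<^sub>m jordan_block2) 1"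
    by (rule positive_index_1[OF J x(1)])
      (use x in \<open>simp add: quad_form_smult_mat[OF jordan_block2_carrier x(1)] mult.assoc\<close>)
  have "positive_index z (diag_block_mat (replicate k (cis \<gamma> \<cdot>\<^sub>m jordan_block2))) k"
  proof (induction k)
    case 0
    show ?case by (rule positive_index_0)
  next
    case (Suc k)
    from positive_index_block_sum[OF J 1 replicate_block_carrier[OF J] Suc] show ?case
      by (simp add: diag_block_mat_Cons del: diag_block_mat.simps)
  qed
  then show ?case by (simp add: phase_blocks_Nil)
next
  case (Cons t \<theta>)
  have "positive_index z (scalar_mat1 (cis t)) (if 0 < Re (z * cis t) then 1 else 0)"
  proof (cases "0 < Re (z * cis t)")
    case True
    have "quad_form (scalar_mat1 (cis t)) (unit_vec 1 0) = cis t"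
      by (simp add: quad_form_def scalar_prod_def)
    then have "positive_index z (scalar_mat1 (cis t)) 1"
      using True by (intro positive_index_1[OF scalar_mat1_carrier, of "unit_vec 1 0"]) auto
    then show ?thesis using True by simp
  qed (simp add: positive_index_0)
  from positive_index_block_sum[OF scalar_mat1_carrier this phase_blocks_carrier Cons]
  show ?case unfolding phase_blocks_Cons by (simp split: if_splits)
qed

subsection \<open>Interlacing of phases and leading minors\<close>

lemma sorted_desc_nth:
  fixes xs :: "real list"
  assumes "sorted_wrt (\<ge>) xs" "i \<le> j" "j < length xs"
  shows "xs ! j \<le> xs ! i"
  using assms sorted_wrt_nth_less[OF assms(1), of i j] by (cases "i = j") auto

lemma count_greater:
  fixes xs :: "real list"
  assumes "sorted_wrt (\<ge>) xs" "j < length xs" "a < xs ! j"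
  shows "Suc j \<le> length (filter (\<lambda>t. a < t) xs)"
proof -
  have "{..j} \<subseteq> {i. i < length xs \<and> a < xs ! i}"
    using sorted_desc_nth[OF assms(1), of _ j] assms(2,3) by fastforce
  then have "card {..j} \<le> card {i. i < length xs \<and> a < xs ! i}" by (intro card_mono) auto
  then show ?thesis by (simp add: length_filter_conv_card)
qed

lemma count_less:
  fixes xs :: "real list"
  assumes "sorted_wrt (\<ge>) xs" "j < length xs" "xs ! j < a"
  shows "length xs - j \<le> length (filter (\<lambda>t. t < a) xs)"
proof -
  have "{j..<length xs} \<subseteq> {i. i < length xs \<and> xs ! i < a}"
    using sorted_desc_nth[OF assms(1), of j] assms(2,3) by fastforce
  then have "card {j..<length xs} \<le> card {i. i < length xs \<and> xs ! i < a}" by (intro card_mono) auto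
  then show ?thesis by (simp add: length_filter_conv_card)
qed

text \<open>Rotating by \<open>- \<i> * cis (- a)\<close> gives a unit number at phase
  \<open>t\<close> the real part \<open>sin (t - a)\<close>. Because \<open>a\<close> is strictly
  inside the window, \<open>t - a\<close> stays strictly between \<open>- pi\<close> and
  \<open>pi\<close>, so the sign of the sine decides the order, and
  \<open>cos (\<gamma> - a) > 0\<close> lets the Jordan blocks count on both sides.\<close>

lemma canonical_phases_positive_index:
  assumes can: "canonical_phases \<gamma> M \<phi>" and a: "\<gamma> - pi / 2 < a" "a < \<gamma> + pi / 2"
  shows "positive_index (- \<i> * cis (- a)) M (length (filter (\<lambda>t. a < t) \<phi>))" (is ?P)
    and "positive_index (\<i> * cis (- a)) M (length (filter (\<lambda>t. t < a) \<phi>))" (is ?Q)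
proof -
  obtain \<theta> k where \<theta>: "set \<theta> \<subseteq> {\<gamma> - pi / 2..\<gamma> + pi / 2}"
    and \<phi>: "\<phi> = replicate k (\<gamma> + pi / 2) @ \<theta> @ replicate k (\<gamma> - pi / 2)"
    and c: "congruent_mat M (phase_blocks \<gamma> \<theta> k)"
    using can unfolding canonical_phases_def by blast
  have im: "Im (\<i> * cis (- a) * cis \<gamma>) = cos (\<gamma> - a)"
    by (simp add: mult.assoc cis_mult)
  have cp: "cos (\<gamma> - a) > 0" using a by (intro cos_gt_zero_pi) auto
  have re: "Re (\<i> * cis (- a) * cis t) = sin (a - t)" for t
    by (simp add: mult.assoc cis_mult) (metis minus_diff_eq sin_minus)
  have e1: "filter (\<lambda>t. 0 < Re (- \<i> * cis (- a) * cis t)) \<theta> = filter (\<lambda>t. a < t) \<theta>"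
  proof (rule filter_cong[OF refl])
    fix t assume "t \<in> set \<theta>"
    then have t: "\<gamma> - pi / 2 \<le> t" "t \<le> \<gamma> + pi / 2" using \<theta> by auto
    have "Re (- \<i> * cis (- a) * cis t) = sin (t - a)" using re[of t] by (simp add: sin_diff)
    moreover have "0 < sin (t - a) \<longleftrightarrow> a < t"
      using t a sin_gt_zero[of "t - a"] sin_ge_zero[of "a - t"] sin_minus[of "t - a"]
      by (cases "a < t") (auto simp: not_less)
    ultimately show "(0 < Re (- \<i> * cis (- a) * cis t)) = (a < t)" by simp
  qed
  have e2: "filter (\<lambda>t. 0 < Re (\<i> * cis (- a) * cis t)) \<theta> = filter (\<lambda>t. t < a) \<theta>"
  proof (rule filter_cong[OF refl])
    fix t assume "t \<in> set \<theta>"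
    then have t: "\<gamma> - pi / 2 \<le> t" "t \<le> \<gamma> + pi / 2" using \<theta> by auto
    have "0 < sin (a - t) \<longleftrightarrow> t < a"
      using t a sin_gt_zero[of "a - t"] sin_ge_zero[of "t - a"] sin_minus[of "a - t"]
      by (cases "t < a") (auto simp: not_less)
    then show "(0 < Re (\<i> * cis (- a) * cis t)) = (t < a)" using re[of t] by simp
  qed
  have f: "length (filter (\<lambda>t. a < t) \<phi>) = length (filter (\<lambda>t. a < t) \<theta>) + k"
    "length (filter (\<lambda>t. t < a) \<phi>) = length (filter (\<lambda>t. t < a) \<theta>) + k"
    using a by (auto simp: \<phi> filter_replicate)
  show ?P unfolding f e1[symmetric]
    by (rule positive_index_congruent[OF c positive_index_phase_blocks]) (use im cp in auto)
  show ?Q unfolding f e2[symmetric]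
    by (rule positive_index_congruent[OF c positive_index_phase_blocks]) (use im cp in auto)
qed

text \<open>If \<open>\<psi> ! j\<close> exceeded \<open>\<phi> ! j\<close>, a direction between
  them would have \<open>j + 1\<close> phases of the compression above it and
  \<open>r + 1 - j\<close> phases of \<open>M\<close> below it, in dimension \<open>r + 1\<close>.
  In the second inequality the counts are \<open>j + 2\<close> and \<open>r - j\<close>, again one
  too many.\<close>

lemma phases_interlacing:
  assumes M: "M \<in> carrier_mat (Suc r) (Suc r)" and S: "S \<in> carrier_mat (Suc r) r"
    and \<phi>: "canonical_phases \<gamma> M \<phi>" and \<psi>: "canonical_phases \<gamma> (adj S * M * S) \<psi>" and j: "j < r"
  shows "\<psi> ! j \<le> \<phi> ! j" "\<phi> ! Suc j \<le> \<psi> ! j"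
proof -
  have N: "adj S * M * S \<in> carrier_mat r r" using M S by auto
  have len: "length \<phi> = Suc r" "length \<psi> = r"
    using canonical_phases_length[OF \<phi> M] canonical_phases_length[OF \<psi> N] .
  note s = canonical_phases_sorted[OF \<phi>] canonical_phases_sorted[OF \<psi>]
  have rng: "\<phi> ! i \<in> {\<gamma> - pi / 2..\<gamma> + pi / 2}" if "i < Suc r" for i
    using subsetD[OF s(2) nth_mem[of i \<phi>]] len that by simp
  have rng': "\<psi> ! i \<in> {\<gamma> - pi / 2..\<gamma> + pi / 2}" if "i < r" for i
    using subsetD[OF s(4) nth_mem[of i \<psi>]] len that by simp
  show "\<psi> ! j \<le> \<phi> ! j"
  proof (rule ccontr)
    assume "\<not> ?thesis"
    then obtain a where a: "\<phi> ! j < a" "a < \<psi> ! j" using dense by (meson not_le)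
    have ab: "\<gamma> - pi / 2 < a" "a < \<gamma> + pi / 2" using a rng[of j] rng'[of j] j by auto
    have "length (filter (\<lambda>t. a < t) \<psi>) + length (filter (\<lambda>t. t < a) \<phi>) \<le> Suc r"
      by (rule positive_index_conflict[OF M
          positive_index_compression[OF M S canonical_phases_positive_index(1)[OF \<psi> ab]]])
        (use canonical_phases_positive_index(2)[OF \<phi> ab] in simp)
    moreover have "Suc j \<le> length (filter (\<lambda>t. a < t) \<psi>)" using count_greater[OF s(3)] j len a by simp
    moreover have "Suc r - j \<le> length (filter (\<lambda>t. t < a) \<phi>)" using count_less[OF s(1), of j a] j len a by simp
    ultimately show False using j by linarith
  qed
  show "\<phi> ! Suc j \<le> \<psi> ! j"
  proof (rule ccontr)
    assume "\<not> ?thesis"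
    then obtain a where a: "\<psi> ! j < a" "a < \<phi> ! Suc j" using dense by (meson not_le)
    have ab: "\<gamma> - pi / 2 < a" "a < \<gamma> + pi / 2" using a rng[of "Suc j"] rng'[of j] j by auto
    have "length (filter (\<lambda>t. t < a) \<psi>) + length (filter (\<lambda>t. a < t) \<phi>) \<le> Suc r"
      by (rule positive_index_conflict[OF M
          positive_index_compression[OF M S canonical_phases_positive_index(2)[OF \<psi> ab]]])
        (use canonical_phases_positive_index(1)[OF \<phi> ab] in simp)
    moreover have "Suc (Suc j) \<le> length (filter (\<lambda>t. a < t) \<phi>)" using count_greater[OF s(1)] j len a by simp
    moreover have "r - j \<le> length (filter (\<lambda>t. t < a) \<psi>)" using count_less[OF s(3), of j a] j len a by simp
    ultimately show False using j by linarith
  qed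
qed

text \<open>With the first columns of the identity, leading blocks become compressions and so
  inherit accretivity and interlacing.\<close>

definition leading_columns :: "nat \<Rightarrow> nat \<Rightarrow> complex mat" where
  "leading_columns n k = mat n k (\<lambda>(i,j). if i = j then 1 else 0)"

lemma leading_columns_carrier [simp]: "leading_columns n k \<in> carrier_mat n k"
  by (simp add: leading_columns_def)

lemma mult_leading_columns:
  assumes "M \<in> carrier_mat m n" "k \<le> n"
  shows "M * leading_columns n k = mat m k (\<lambda>(i,j). M $$ (i,j))"
proof (rule eq_matI)
  fix i j assume "i < dim_row (mat m k (\<lambda>(i,j). M $$ (i,j)))" "j < dim_col (mat m k (\<lambda>(i,j). M $$ (i,j)))"
  then have ij: "i < m" "j < k" by auto
  have "(M * leading_columns n k) $$ (i,j) = (\<Sum>l<n. M $$ (i,l) * leading_columns n k $$ (l,j))"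
    using assms ij by (intro index_mult_sum) auto
  also have "\<dots> = (\<Sum>l<n. if l = j then M $$ (i,l) else 0)"
    using ij assms by (intro sum.cong) (auto simp: leading_columns_def)
  also have "\<dots> = M $$ (i,j)" using ij assms by (subst sum.delta) auto
  finally show "(M * leading_columns n k) $$ (i,j) = mat m k (\<lambda>(i,j). M $$ (i,j)) $$ (i,j)" using ij by simp
qed (use assms in \<open>auto simp: leading_columns_def\<close>)

lemma adj_leading_columns_mult:
  assumes "M \<in> carrier_mat n m" "k \<le> n"
  shows "adj (leading_columns n k) * M = mat k m (\<lambda>(i,j). M $$ (i,j))"
proof -
  have "adj (adj M * leading_columns n k) = adj (leading_columns n k) * M"
    using assms by (simp add: adj_mult carrier_matD[OF leading_columns_carrier])
  moreover have "adj (adj M * leading_columns n k) = mat k m (\<lambda>(i,j). M $$ (i,j))"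
    unfolding mult_leading_columns[OF adj_carrier[OF assms(1)] assms(2)] using assms
    by (intro eq_matI) auto
  ultimately show ?thesis by simp
qed

definition leading_block :: "nat \<Rightarrow> complex mat \<Rightarrow> complex mat" where
  "leading_block k M = mat k k (\<lambda>(i,j). M $$ (i,j))"

lemma leading_block_carrier [simp]: "leading_block k M \<in> carrier_mat k k"
  by (simp add: leading_block_def)

lemma leading_block_eq:
  assumes M: "M \<in> carrier_mat n n" and k: "k \<le> n"
  shows "leading_block k M = adj (leading_columns n k) * M * leading_columns n k"
proof -
  have "adj (leading_columns n k) * M * leading_columns n k = mat k n (\<lambda>(i,j). M $$ (i,j)) * leading_columns n k"
    using adj_leading_columns_mult[OF M k] by simp
  also have "\<dots> = mat k k (\<lambda>(i,j). mat k n (\<lambda>(i,j). M $$ (i,j)) $$ (i,j))"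
    by (rule mult_leading_columns[OF _ k]) simp
  also have "\<dots> = leading_block k M" unfolding leading_block_def using k by (intro eq_matI) auto
  finally show ?thesis by simp
qed

lemma leading_block_leading_block: "j \<le> k \<Longrightarrow> leading_block j (leading_block k M) = leading_block j M"
  unfolding leading_block_def by (intro eq_matI) auto

lemma leading_block_self: "M \<in> carrier_mat n n \<Longrightarrow> leading_block n M = M"
  unfolding leading_block_def by (intro eq_matI) auto

lemma sum_list_take_nth: "k \<le> length xs \<Longrightarrow> sum_list (take k xs) = (\<Sum>i<k. xs ! i)" for xs :: "real list"
  by (simp add: sum_list_sum_nth lessThan_atLeast0)

text \<open>The entries of \<open>\<sigma>\<close> are the increments of the sums of phases along
  the leading blocks, in the order of the rows and in general unsorted. Each step strips the last
  row and column of \<open>M\<close>.\<close>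

lemma leading_minor_args:
  assumes "M \<in> carrier_mat r r" "accretive \<gamma> M" "\<And>k. k \<le> r \<Longrightarrow> det (leading_block k M) \<noteq> 0"
    "canonical_phases \<gamma> M \<phi>"
  shows "\<exists>\<sigma>. length \<sigma> = r \<and> set \<sigma> \<subseteq> {last \<phi>..hd \<phi>} \<and> sum_list \<sigma> = sum_list \<phi> \<and>
    (\<forall>k\<le>r. (\<exists>c>0. det (leading_block k M) = of_real c * cis (sum_list (take k \<sigma>))) \<and>
      sum_list (take k \<sigma>) \<le> sum_list (take k \<phi>))"
  using assms
proof (induction r arbitrary: M \<phi>)
  case (0 M \<phi>)
  have "length \<phi> = 0" using canonical_phases_length[OF 0(4,1)] .
  then show ?case by (intro exI[of _ "[]"]) (auto simp: leading_block_def det_dim_zero intro: exI[of _ 1])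
next
  case (Suc r M \<phi>)
  note M = Suc.prems(1) and acc = Suc.prems(2) and minors = Suc.prems(3) and \<phi> = Suc.prems(4)
  define N where "N = leading_block r M"
  have N: "N \<in> carrier_mat r r" by (simp add: N_def)
  have NS: "N = adj (leading_columns (Suc r) r) * M * leading_columns (Suc r) r"
    unfolding N_def by (rule leading_block_eq[OF M]) simp
  have accN: "accretive \<gamma> N" unfolding NS by (rule accretive_compression[OF M acc leading_columns_carrier])
  have lbN: "leading_block k N = leading_block k M" if "k \<le> r" for k
    unfolding N_def by (rule leading_block_leading_block[OF that])
  have minN: "det (leading_block k N) \<noteq> 0" if "k \<le> r" for k
    using minors[of k] lbN[OF that] that by simp
  have "det N \<noteq> 0" using minors[of r] by (simp add: N_def)
  then obtain \<psi> where \<psi>: "canonical_phases \<gamma> N \<psi>" by (rule accretive_canonical_phases[OF N _ accN])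
  from Suc.IH[OF N accN minN \<psi>] obtain \<sigma> where \<sigma>: "length \<sigma> = r" "set \<sigma> \<subseteq> {last \<psi>..hd \<psi>}"
    "sum_list \<sigma> = sum_list \<psi>" 
    "\<And>k. k \<le> r \<Longrightarrow> \<exists>c>0. det (leading_block k N) = of_real c * cis (sum_list (take k \<sigma>))"
    "\<And>k. k \<le> r \<Longrightarrow> sum_list (take k \<sigma>) \<le> sum_list (take k \<psi>)" by blast
  have len: "length \<phi> = Suc r" "length \<psi> = r"
    using canonical_phases_length[OF \<phi> M] canonical_phases_length[OF \<psi> N] .
  have il: "\<psi> ! j \<le> \<phi> ! j" "\<phi> ! Suc j \<le> \<psi> ! j" if "j < r" for j
    using phases_interlacing[OF M leading_columns_carrier \<phi> \<psi>[unfolded NS] that] by auto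
  have ends: "hd \<phi> = \<phi> ! 0" "last \<phi> = \<phi> ! r"
    using len hd_conv_nth[of \<phi>] last_conv_nth[of \<phi>] by fastforce+
  have s\<phi>: "sum_list \<phi> = (\<Sum>i<Suc r. \<phi> ! i)" using sum_list_take_nth[of "Suc r" \<phi>] len by simp
  have s\<psi>: "sum_list \<psi> = (\<Sum>i<r. \<psi> ! i)" using sum_list_take_nth[of r \<psi>] len by simp
  \<comment> \<open>Interlacing bounds \<open>t\<close> in two ways: it is \<open>\<phi> ! r\<close>
    plus the nonnegative differences \<open>\<phi> ! i - \<psi> ! i\<close>, and
    \<open>\<phi> ! 0\<close> plus the nonpositive differences
    \<open>\<phi> ! Suc i - \<psi> ! i\<close>.\<close>
  define t where "t = sum_list \<phi> - sum_list \<psi>"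
  have t1: "last \<phi> \<le> t"
  proof -
    have "(\<Sum>i<r. \<psi> ! i) \<le> (\<Sum>i<r. \<phi> ! i)" by (intro sum_mono) (use il in auto)
    then show ?thesis unfolding t_def s\<phi> s\<psi> ends by simp
  qed
  have t2: "t \<le> hd \<phi>"
  proof -
    have "(\<Sum>i<r. \<phi> ! Suc i) \<le> (\<Sum>i<r. \<psi> ! i)" by (intro sum_mono) (use il in auto)
    then show ?thesis unfolding t_def s\<phi> s\<psi> ends by (simp add: sum.lessThan_Suc_shift del: sum.lessThan_Suc)
  qed
  \<comment> \<open>For \<open>r = 0\<close> the list \<open>\<psi>\<close> is empty and its
    \<open>hd\<close> and \<open>last\<close> are unspecified; \<open>\<sigma>\<close> is then empty
    too.\<close>
  have sub: "{last \<psi>..hd \<psi>} \<subseteq> {last \<phi>..hd \<phi>}" if "r > 0"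
  proof -
    have "hd \<psi> = \<psi> ! 0" "last \<psi> = \<psi> ! (r - 1)"
      using len that hd_conv_nth[of \<psi>] last_conv_nth[of \<psi>] by fastforce+
    then show ?thesis using il(1)[of 0] il(2)[of "r - 1"] that ends by auto
  qed
  show ?case
  proof (intro exI[of _ "\<sigma> @ [t]"] conjI allI impI)
    show "set (\<sigma> @ [t]) \<subseteq> {last \<phi>..hd \<phi>}"
      using \<sigma>(1,2) sub t1 t2 by (cases "r = 0") auto
    show "sum_list (\<sigma> @ [t]) = sum_list \<phi>" using \<sigma>(3) by (simp add: t_def)
    fix k assume k: "k \<le> Suc r"
    show "\<exists>c>0. det (leading_block k M) = of_real c * cis (sum_list (take k (\<sigma> @ [t])))"
    proof (cases "k = Suc r")
      case True
      then show ?thesis using canonical_phases_det[OF \<phi>] \<sigma>(1,3) leading_block_self[OF M] by (simp add: t_def)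
    next
      case False
      then show ?thesis using k \<sigma>(4)[of k] lbN[of k] \<sigma>(1) by simp
    qed
    show "sum_list (take k (\<sigma> @ [t])) \<le> sum_list (take k \<phi>)"
    proof (cases "k = Suc r")
      case True
      then show ?thesis using \<sigma>(1,3) len by (simp add: t_def)
    next
      case False
      then have kr: "k \<le> r" using k by simp
      have "sum_list (take k \<psi>) \<le> sum_list (take k \<phi>)"
        using kr len il(1) by (auto simp: sum_list_take_nth intro!: sum_mono)
      then show ?thesis using \<sigma>(5)[OF kr] kr \<sigma>(1) by simp
    qed
  qed (use \<sigma>(1) in simp)
qed

subsection \<open>Arguments of the eigenvalues of a product\<close>

lemma canonical_phases_congruence:
  assumes M: "M \<in> carrier_mat r r" and S: "S \<in> carrier_mat r r" "det S \<noteq> 0"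
    and can: "canonical_phases \<gamma> M \<phi>"
  shows "canonical_phases \<gamma> (adj S * M * S) \<phi>"
proof -
  have "congruent_mat (adj S * M * S) M"
    using M S by (intro congruent_matI[of _ r _ S]) auto
  then show ?thesis using can congruent_mat_trans unfolding canonical_phases_def by blast
qed

lemma is_Arg_cis: "0 < c \<Longrightarrow> is_Arg (complex_of_real c * cis t) t"
  by (simp add: is_Arg_def norm_mult cis_conv_exp)

text \<open>Conjugating \<open>g k\<close> turns division by it into addition of its argument, so
  the product of the first \<open>k\<close> numbers has the partial sums of \<open>\<sigma>\<close>
  and \<open>\<tau>\<close> as argument. Consecutive products isolate one number.\<close>

lemma eigenvalue_args_of_ratios:
  fixes es :: "complex list" and \<sigma> \<tau> :: "real list"
  assumes len: "length \<sigma> = r" "length \<tau> = r" "length es = r"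
    and H: "\<And>k. k \<le> r \<Longrightarrow> \<exists>c>0. h k = complex_of_real c * cis (sum_list (take k \<sigma>))"
    and G: "\<And>k. k \<le> r \<Longrightarrow> \<exists>c>0. g k = complex_of_real c * cis (sum_list (take k \<tau>))"
    and rel: "\<And>k. k \<le> r \<Longrightarrow> h k = cnj (g k) * prod_list (take k es)"
    and i: "i < r"
  shows "is_Arg (es ! i) (\<sigma> ! i + \<tau> ! i)"
proof -
  have pr: "\<exists>c>0. prod_list (take k es) = complex_of_real c * cis (sum_list (take k \<sigma>) + sum_list (take k \<tau>))"
    if k: "k \<le> r" for k
  proof -
    obtain c d where cd: "c > 0" "d > 0" "h k = complex_of_real c * cis (sum_list (take k \<sigma>))"
      "g k = complex_of_real d * cis (sum_list (take k \<tau>))" using H[OF k] G[OF k] by blast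
    have "complex_of_real d * cis (- sum_list (take k \<tau>)) * prod_list (take k es) =
      complex_of_real c * cis (sum_list (take k \<sigma>))"
      using rel[OF k] cd by (simp add: cis_cnj)
    then have "cis (sum_list (take k \<tau>)) * (complex_of_real d * cis (- sum_list (take k \<tau>)) * prod_list (take k es)) =
      cis (sum_list (take k \<tau>)) * (complex_of_real c * cis (sum_list (take k \<sigma>)))" by simp
    moreover have "cis (sum_list (take k \<tau>)) * (complex_of_real d * cis (- sum_list (take k \<tau>)) * prod_list (take k es)) =
      complex_of_real d * prod_list (take k es) * (cis (sum_list (take k \<tau>)) * cis (- sum_list (take k \<tau>)))"
      by (simp only: mult_ac)
    moreover have "cis (sum_list (take k \<tau>)) * (complex_of_real c * cis (sum_list (take k \<sigma>))) =
      complex_of_real c * cis (sum_list (take k \<sigma>) + sum_list (take k \<tau>))"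
      by (simp add: cis_mult[symmetric] mult_ac)
    ultimately have "complex_of_real d * prod_list (take k es) =
      complex_of_real c * cis (sum_list (take k \<sigma>) + sum_list (take k \<tau>))"
      by (simp add: cis_mult)
    then have "prod_list (take k es) = complex_of_real (c / d) * cis (sum_list (take k \<sigma>) + sum_list (take k \<tau>))"
      using cd(2) by (simp add: field_simps)
    then show ?thesis using cd(1,2) by (intro exI[of _ "c / d"]) auto
  qed
  obtain c where c: "c > 0" "prod_list (take i es) = complex_of_real c * cis (sum_list (take i \<sigma>) + sum_list (take i \<tau>))"
    using pr[of i] i by auto
  obtain d where d: "d > 0" "prod_list (take (Suc i) es) =
      complex_of_real d * cis (sum_list (take (Suc i) \<sigma>) + sum_list (take (Suc i) \<tau>))"
    using pr[of "Suc i"] i by auto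
  have t: "take (Suc i) es = take i es @ [es ! i]" "take (Suc i) \<sigma> = take i \<sigma> @ [\<sigma> ! i]"
    "take (Suc i) \<tau> = take i \<tau> @ [\<tau> ! i]" using i len by (simp_all add: take_Suc_conv_app_nth)
  define S where "S = sum_list (take i \<sigma>) + sum_list (take i \<tau>)"
  have s: "sum_list (take (Suc i) \<sigma>) + sum_list (take (Suc i) \<tau>) = S + (\<sigma> ! i + \<tau> ! i)"
    unfolding t S_def by simp
  have "complex_of_real c * cis S * es ! i = complex_of_real d * (cis S * cis (\<sigma> ! i + \<tau> ! i))"
    using d(2) c(2) unfolding s by (simp add: t(1) S_def cis_mult)
  then have "cis S * (complex_of_real c * es ! i) = cis S * (complex_of_real d * cis (\<sigma> ! i + \<tau> ! i))"
    by (simp only: mult_ac)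
  then have "complex_of_real c * es ! i = complex_of_real d * cis (\<sigma> ! i + \<tau> ! i)"
    by simp
  then have "es ! i = complex_of_real (d / c) * cis (\<sigma> ! i + \<tau> ! i)"
    using c(1) by (simp add: field_simps)
  then show ?thesis using is_Arg_cis[of "d / c"] c(1) d(1) by simp
qed

text \<open>The order of \<open>es\<close> is left open, because the partial sums are bounded in the
  order in which the eigenvalues are listed. Majorization needs the bounds for the arguments in
  non-increasing order, which are known only after a first application.\<close>

lemma product_eigenvalue_args:
  assumes A: "A \<in> carrier_mat r r" and B: "B \<in> carrier_mat r r"
    and accA: "accretive \<gamma> A" and defA: "\<forall>x \<in> carrier_vec r. quad_form A x = 0 \<longrightarrow> x = 0\<^sub>v r"
    and accB: "accretive \<delta> B" and detB: "det B \<noteq> 0"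
    and \<phi>: "canonical_phases \<gamma> A \<phi>" and \<psi>: "canonical_phases \<delta> B \<psi>"
    and es: "char_poly (A * B) = (\<Prod>a\<leftarrow>es. [:- a, 1:])"
  shows "\<exists>\<alpha>. length \<alpha> = r \<and> (\<forall>i<r. is_Arg (es ! i) (\<alpha> ! i)) \<and>
    set \<alpha> \<subseteq> {last \<phi> + last \<psi>..hd \<phi> + hd \<psi>} \<and>
    (\<forall>k\<le>r. sum_list (take k \<alpha>) \<le> sum_list (take k \<phi>) + sum_list (take k \<psi>)) \<and>
    sum_list \<alpha> = sum_list \<phi> + sum_list \<psi>"
proof -
  have AB: "A * B \<in> carrier_mat r r" using A B by auto
  obtain R X Y where sd: "schur_decomposition (A * B) es = (R, X, Y)" by (metis prod_cases3)
  from schur_decomposition[OF AB es sd]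
  have sim: "similar_mat_wit (A * B) R X Y" and ut: "upper_triangular R" and dg: "diag_mat R = es" by auto
  from similar_mat_witD2[OF AB sim] have XY: "X * Y = 1\<^sub>m r" "Y * X = 1\<^sub>m r" and ABR: "A * B = X * R * Y"
    and R: "R \<in> carrier_mat r r" and X: "X \<in> carrier_mat r r" and Y: "Y \<in> carrier_mat r r" by auto
  have detX: "det X \<noteq> 0" by (rule det_inverse[OF X Y XY(1)])
  define S where "S = B * X"
  have S: "S \<in> carrier_mat r r" using B X by (auto simp: S_def)
  have detS: "det S \<noteq> 0" using detX detB det_mult[OF B X] by (simp add: S_def)
  define G where "G = adj X * B * X"
  define H where "H = adj S * A * S"
  have G: "G \<in> carrier_mat r r" using X B by (auto simp: G_def)
  have H: "H \<in> carrier_mat r r" using S A by (auto simp: H_def)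
  \<comment> \<open>\<open>A * S = A * B * X = X * R\<close> turns \<open>adj S * A * S\<close> into
    \<open>adj X * adj B * X * R\<close>.\<close>
  have HG: "H = adj G * R"
  proof -
    have "A * S = (A * B) * X" unfolding S_def using A B X by (simp add: mult_assoc_dim)
    also have "\<dots> = X * R" unfolding ABR using X R Y XY by (simp add: mult_assoc_dim)
    finally have AS: "A * S = X * R" .
    have "H = adj S * (X * R)" unfolding H_def AS[symmetric] using S A by (simp add: mult_assoc_dim)
    also have "\<dots> = adj G * R" unfolding G_def S_def using X B R by (simp add: adj_mult mult_assoc_dim)
    finally show ?thesis .
  qed
  have lenes: "length es = r" using R unfolding dg[symmetric] diag_mat_def by simp
  have lbH: "leading_block k H = adj (leading_block k G) * leading_block k R" if k: "k \<le> r" for k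
  proof -
    define J where "J = leading_columns r k"
    have J: "J \<in> carrier_mat r k" by (simp add: J_def)
    \<comment> \<open>An upper triangular \<open>R\<close> preserves the span of the first
      \<open>k\<close> unit vectors, so the factorization of \<open>H\<close> restricts to leading
      blocks.\<close>
    have RJ: "R * J = J * leading_block k R"
    proof (rule eq_matI)
      fix i j assume "i < dim_row (J * leading_block k R)" "j < dim_col (J * leading_block k R)"
      then have ij: "i < r" "j < k" using J by (auto simp: leading_block_def)
      have "(R * J) $$ (i,j) = R $$ (i,j)" using mult_leading_columns[OF R k] ij by (simp add: J_def)
      moreover have "(J * leading_block k R) $$ (i,j) = (\<Sum>l<k. J $$ (i,l) * leading_block k R $$ (l,j))"
        by (rule index_mult_sum[OF J leading_block_carrier ij])
      moreover have "\<dots> = (\<Sum>l<k. if l = i then R $$ (l,j) else 0)"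
        using ij k by (intro sum.cong) (auto simp: J_def leading_columns_def leading_block_def)
      moreover have "\<dots> = (if i < k then R $$ (i,j) else 0)" by (subst sum.delta) auto
      moreover have "\<not> i < k \<Longrightarrow> R $$ (i,j) = 0" using ut ij R unfolding upper_triangular_def by auto
      ultimately show "(R * J) $$ (i,j) = (J * leading_block k R) $$ (i,j)" by simp
    qed (use R J in \<open>auto simp: leading_block_def\<close>)
    have "leading_block k H = adj J * H * J" unfolding J_def by (rule leading_block_eq[OF H k])
    also have "\<dots> = adj J * (adj G * (R * J))" unfolding HG using J G R by (simp add: mult_assoc_dim)
    finally have "leading_block k H = adj J * (adj G * (R * J))" .
    also have "\<dots> = adj (adj J * G * J) * leading_block k R"
      unfolding RJ using J G carrier_matD[OF leading_block_carrier[of k R]] by (simp add: adj_mult mult_assoc_dim)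
    finally show ?thesis unfolding leading_block_eq[OF G k] J_def[symmetric] .
  qed
  have dR: "det (leading_block k R) = prod_list (take k es)" if k: "k \<le> r" for k
  proof -
    have "upper_triangular (leading_block k R)"
      using ut R k unfolding upper_triangular_def leading_block_def by auto
    then have "det (leading_block k R) = prod_list (diag_mat (leading_block k R))"
      by (rule det_upper_triangular[OF _ leading_block_carrier])
    also have "diag_mat (leading_block k R) = take k es"
      using k R unfolding dg[symmetric] diag_mat_def leading_block_def
      by (intro nth_equalityI) auto
    finally show ?thesis .
  qed
  have rel: "det (leading_block k H) = cnj (det (leading_block k G)) * prod_list (take k es)" if k: "k \<le> r" for k
    unfolding lbH[OF k] using det_mult[OF adj_carrier[OF leading_block_carrier] leading_block_carrier, of k G R]
      det_adj[OF leading_block_carrier, of k G] dR[OF k] by simp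
  have minH: "det (leading_block k H) \<noteq> 0" if k: "k \<le> r" for k
  proof (rule det_nonzeroI[OF leading_block_carrier])
    fix x :: "complex vec" assume x: "x \<in> carrier_vec k" "leading_block k H *\<^sub>v x = 0\<^sub>v k"
    define J where "J = leading_columns r k"
    have J: "J \<in> carrier_mat r k" by (simp add: J_def)
    have Jx: "J *\<^sub>v x \<in> carrier_vec r" using J x(1) by simp
    have "quad_form (leading_block k H) x = quad_form H (J *\<^sub>v x)"
      unfolding leading_block_eq[OF H k] J_def[symmetric] by (rule quad_form_congruence[OF J H x(1)])
    also have "\<dots> = quad_form A (S *\<^sub>v (J *\<^sub>v x))"
      unfolding H_def by (rule quad_form_congruence[OF S A Jx])
    finally have "quad_form A (S *\<^sub>v (J *\<^sub>v x)) = 0" using x by (simp add: quad_form_def)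
    then have "S *\<^sub>v (J *\<^sub>v x) = 0\<^sub>v r"
      using defA mult_mat_vec_carrier[OF S Jx] by blast
    then have J0: "J *\<^sub>v x = 0\<^sub>v r" using det_nonzeroD[OF S detS Jx] by simp
    show "x = 0\<^sub>v k"
    proof (rule eq_vecI)
      fix i assume i: "i < dim_vec (0\<^sub>v k :: complex vec)"
      have "(J *\<^sub>v x) $ i = (\<Sum>l<k. J $$ (i,l) * x $ l)"
        using i k x(1) J by (simp add: scalar_prod_def lessThan_atLeast0)
      also have "\<dots> = (\<Sum>l<k. if l = i then x $ l else 0)"
        using i k by (intro sum.cong) (auto simp: J_def leading_columns_def)
      also have "\<dots> = x $ i" using i by (subst sum.delta) auto
      finally show "x $ i = 0\<^sub>v k $ i" using J0 i k by simp
    qed (use x in auto)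
  qed
  \<comment> \<open>The form of \<open>B\<close> may have isotropic vectors, so these minors are
    shown to be nonzero only through the nonzero minors of \<open>H\<close>.\<close>
  have minG: "det (leading_block k G) \<noteq> 0" if k: "k \<le> r" for k
    using rel[OF k] minH[OF k] by auto
  have accH: "accretive \<gamma> H" unfolding H_def by (rule accretive_compression[OF A accA S])
  have accG: "accretive \<delta> G" unfolding G_def by (rule accretive_compression[OF B accB X])
  have canH: "canonical_phases \<gamma> H \<phi>" unfolding H_def by (rule canonical_phases_congruence[OF A S detS \<phi>])
  have canG: "canonical_phases \<delta> G \<psi>" unfolding G_def by (rule canonical_phases_congruence[OF B X detX \<psi>])
  obtain \<sigma> where \<sigma>: "length \<sigma> = r" "set \<sigma> \<subseteq> {last \<phi>..hd \<phi>}" "sum_list \<sigma> = sum_list \<phi>"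
    "\<And>k. k \<le> r \<Longrightarrow> \<exists>c>0. det (leading_block k H) = of_real c * cis (sum_list (take k \<sigma>))"
    "\<And>k. k \<le> r \<Longrightarrow> sum_list (take k \<sigma>) \<le> sum_list (take k \<phi>)"
    using leading_minor_args[OF H accH minH canH] by blast
  obtain \<tau> where \<tau>: "length \<tau> = r" "set \<tau> \<subseteq> {last \<psi>..hd \<psi>}" "sum_list \<tau> = sum_list \<psi>"
    "\<And>k. k \<le> r \<Longrightarrow> \<exists>c>0. det (leading_block k G) = of_real c * cis (sum_list (take k \<tau>))"
    "\<And>k. k \<le> r \<Longrightarrow> sum_list (take k \<tau>) \<le> sum_list (take k \<psi>)"
    using leading_minor_args[OF G accG minG canG] by blast
  define \<alpha> where "\<alpha> = map2 (+) \<sigma> \<tau>"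
  have len: "length \<alpha> = r" using \<sigma>(1) \<tau>(1) by (simp add: \<alpha>_def)
  have nth: "\<alpha> ! i = \<sigma> ! i + \<tau> ! i" if "i < r" for i using that \<sigma>(1) \<tau>(1) by (simp add: \<alpha>_def)
  have sm: "sum_list (take k \<alpha>) = sum_list (take k \<sigma>) + sum_list (take k \<tau>)" if k: "k \<le> r" for k
    using k len \<sigma>(1) \<tau>(1) nth by (simp add: sum_list_take_nth sum.distrib)
  show ?thesis
  proof (intro exI[of _ \<alpha>] conjI allI impI len)
    show "is_Arg (es ! i) (\<alpha> ! i)" if "i < r" for i
      unfolding nth[OF that]
      by (rule eigenvalue_args_of_ratios[OF \<sigma>(1) \<tau>(1) lenes \<sigma>(4) \<tau>(4) rel that])
    show "set \<alpha> \<subseteq> {last \<phi> + last \<psi>..hd \<phi> + hd \<psi>}"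
    proof
      fix t assume "t \<in> set \<alpha>"
      then obtain i where i: "i < r" "t = \<alpha> ! i" using len by (metis in_set_conv_nth)
      have "\<sigma> ! i \<in> {last \<phi>..hd \<phi>}" "\<tau> ! i \<in> {last \<psi>..hd \<psi>}"
        using subsetD[OF \<sigma>(2) nth_mem] subsetD[OF \<tau>(2) nth_mem] i(1) \<sigma>(1) \<tau>(1) by auto
      then show "t \<in> {last \<phi> + last \<psi>..hd \<phi> + hd \<psi>}" using i nth by auto
    qed
    show "sum_list (take k \<alpha>) \<le> sum_list (take k \<phi>) + sum_list (take k \<psi>)" if "k \<le> r" for k
      using sm[OF that] \<sigma>(5)[OF that] \<tau>(5)[OF that] by simp
    show "sum_list \<alpha> = sum_list \<phi> + sum_list \<psi>"
      using sm[of r] len \<sigma>(1,3) \<tau>(1,3) by simp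
  qed
qed

text \<open>The window is shorter than \<open>2 \<pi>\<close>, so it contains only one argument of each eigenvalue. Hence a second
  triangularization, ordered by the arguments found in the first one, produces the same arguments.\<close>

lemma product_eigenvalue_args_sorted:
  assumes A: "A \<in> carrier_mat r r" and B: "B \<in> carrier_mat r r"
    and accA: "accretive \<gamma> A" and defA: "\<forall>x \<in> carrier_vec r. quad_form A x = 0 \<longrightarrow> x = 0\<^sub>v r"
    and accB: "accretive \<delta> B" and detB: "det B \<noteq> 0"
    and \<phi>: "canonical_phases \<gamma> A \<phi>" and \<psi>: "canonical_phases \<delta> B \<psi>"
    and width: "0 < r \<longrightarrow> (hd \<phi> + hd \<psi>) - (last \<phi> + last \<psi>) < 2 * pi"
  shows "\<exists>es \<alpha>. mset es = nonzero_eigenvalues (A * B) \<and> length es = r \<and> length \<alpha> = r \<and>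
    (\<forall>i<r. is_Arg (es ! i) (\<alpha> ! i)) \<and> sorted_wrt (\<ge>) \<alpha> \<and>
    set \<alpha> \<subseteq> {last \<phi> + last \<psi>..hd \<phi> + hd \<psi>} \<and>
    (\<forall>k\<le>r. sum_list (take k \<alpha>) \<le> sum_list (take k \<phi>) + sum_list (take k \<psi>)) \<and>
    sum_list \<alpha> = sum_list \<phi> + sum_list \<psi>"
proof -
  have AB: "A * B \<in> carrier_mat r r" using A B by auto
  have "det A \<noteq> 0"
  proof (rule det_nonzeroI[OF A])
    fix x assume x: "x \<in> carrier_vec r" "A *\<^sub>v x = 0\<^sub>v r"
    then have "quad_form A x = 0" by (simp add: quad_form_def)
    then show "x = 0\<^sub>v r" using defA x(1) by blast
  qed
  then have dAB: "det (A * B) \<noteq> 0" using det_mult[OF A B] detB by simp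
  obtain es0 where es0: "char_poly (A * B) = (\<Prod>a\<leftarrow>es0. [:- a, 1:])"
    using complex_char_poly_linear[OF AB] by blast
  note ev = nonzero_eigenvalues_invertible[OF AB dAB es0]
  obtain \<alpha>0 where \<alpha>0: "length \<alpha>0 = r" "\<forall>i<r. is_Arg (es0 ! i) (\<alpha>0 ! i)"
    "set \<alpha>0 \<subseteq> {last \<phi> + last \<psi>..hd \<phi> + hd \<psi>}"
    using product_eigenvalue_args[OF A B accA defA accB detB \<phi> \<psi> es0] by (elim exE conjE)
  define ps where "ps = rev (sort_key fst (zip \<alpha>0 es0))"
  define \<beta> where "\<beta> = map fst ps"
  define es where "es = map snd ps"
  have mps: "mset ps = mset (zip \<alpha>0 es0)" by (simp add: ps_def)
  have "mset es = mset (map snd (zip \<alpha>0 es0))" unfolding es_def using mps by (metis mset_map)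
  then have mes: "mset es = mset es0" using \<alpha>0(1) ev(2) by simp
  have len: "length es = r" "length \<beta> = r" using \<alpha>0(1) ev(2) by (simp_all add: es_def \<beta>_def ps_def)
  have srt: "sorted_wrt (\<ge>) \<beta>"
  proof -
    have "\<beta> = rev (map fst (sort_key fst (zip \<alpha>0 es0)))" unfolding \<beta>_def ps_def by (simp add: rev_map)
    then show ?thesis by (simp add: sorted_wrt_rev)
  qed
  have \<beta>: "is_Arg (es ! i) (\<beta> ! i) \<and> \<beta> ! i \<in> {last \<phi> + last \<psi>..hd \<phi> + hd \<psi>}" if i: "i < r" for i
  proof -
    have "ps ! i \<in> set ps" using i len by (simp add: es_def)
    then have "(\<beta> ! i, es ! i) \<in> set (zip \<alpha>0 es0)"
      using i len mset_eq_setD[OF mps] by (simp add: es_def \<beta>_def)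
    then obtain j where "j < r" "\<beta> ! i = \<alpha>0 ! j" "es ! i = es0 ! j"
      using \<alpha>0(1) ev(2) by (auto simp: in_set_zip)
    then show ?thesis using \<alpha>0(2) subsetD[OF \<alpha>0(3) nth_mem[of j \<alpha>0]] \<alpha>0(1) by simp
  qed
  \<comment> \<open>Schur triangularization accepts the roots in any order, in particular in the
    sorted one.\<close>
  have "(\<Prod>a\<leftarrow>es. [:- a, 1:]) = (\<Prod>a\<leftarrow>es0. [:- a, 1:])"
  proof -
    have "prod_mset (image_mset (\<lambda>a. [:- a, 1:]) (mset es)) = prod_mset (image_mset (\<lambda>a. [:- a, 1:]) (mset es0))"
      using mes by simp
    then show ?thesis by (simp only: mset_map[symmetric] prod_mset_prod_list)
  qed
  then have es: "char_poly (A * B) = (\<Prod>a\<leftarrow>es. [:- a, 1:])" using es0 by simp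
  obtain \<alpha> where \<alpha>: "length \<alpha> = r" "\<forall>i<r. is_Arg (es ! i) (\<alpha> ! i)"
    "set \<alpha> \<subseteq> {last \<phi> + last \<psi>..hd \<phi> + hd \<psi>}"
    "\<forall>k\<le>r. sum_list (take k \<alpha>) \<le> sum_list (take k \<phi>) + sum_list (take k \<psi>)"
    "sum_list \<alpha> = sum_list \<phi> + sum_list \<psi>"
    using product_eigenvalue_args[OF A B accA defA accB detB \<phi> \<psi> es] by (elim exE conjE)
  have "\<alpha> = \<beta>"
  proof (rule nth_equalityI)
    fix i assume "i < length \<alpha>"
    then have i: "i < r" using \<alpha>(1) by simp
    have "\<alpha> ! i \<in> {last \<phi> + last \<psi>..hd \<phi> + hd \<psi>}"
      using subsetD[OF \<alpha>(3) nth_mem[of i \<alpha>]] i \<alpha>(1) by simp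
    moreover have "(hd \<phi> + hd \<psi>) - (last \<phi> + last \<psi>) < 2 * pi" using width i by simp
    ultimately have "\<bar>\<alpha> ! i - \<beta> ! i\<bar> < 2 * pi"
      using \<beta>[OF i] unfolding atLeastAtMost_iff abs_less_iff by linarith
    moreover have "es ! i \<noteq> 0"
      using ev(3) mset_eq_setD[OF mes] i len(1) nth_mem by metis
    ultimately show "\<alpha> ! i = \<beta> ! i" using is_Arg_eqI[of "es ! i" "\<alpha> ! i" "\<beta> ! i"] \<alpha>(2) i \<beta>[OF i] by blast
  qed (use \<alpha>(1) len in simp)
  then have "sorted_wrt (\<ge>) \<alpha>" using srt by simp
  moreover have "mset es = nonzero_eigenvalues (A * B)" using mes ev(1) by simp
  ultimately show ?thesis using \<alpha> len(1) by blast
qed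

subsection \<open>Sectors and the field angle\<close>

text \<open>This turns sign conditions for membership in a sector into inequalities between real
  angles. The bounds on \<open>s\<close> and \<open>w\<close> keep the tested angles where the sine
  has a known sign.\<close>

lemma sin_window:
  assumes "\<bar>s\<bar> \<le> pi / 2" "0 \<le> w" "w \<le> pi / 2" "0 \<le> sin (s + w)" "sin (s - w) \<le> 0"
  shows "- w \<le> s" "s \<le> w"
proof -
  show "- w \<le> s"
  proof (rule ccontr)
    assume "\<not> ?thesis"
    then have "0 < sin (- (s + w))" using assms by (intro sin_gt_zero) auto
    then show False using assms(4) unfolding sin_minus by linarith
  qed
  show "s \<le> w"
  proof (rule ccontr)
    assume "\<not> ?thesis"
    then have "0 < sin (s - w)" using assms by (intro sin_gt_zero) auto
    then show False using assms(5) by linarith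
  qed
qed

lemma cis_mem_sector: "a \<le> t \<Longrightarrow> t \<le> b \<Longrightarrow> 0 \<le> \<rho> \<Longrightarrow> complex_of_real \<rho> * cis t \<in> sector a b"
  unfolding sector_def by auto

text \<open>A sector of angle at most pi is an intersection of half-planes, and linear inequalities
  pass to sums. The condition at the bisector excludes the opposite ray when
  \<open>a = b\<close>.\<close>

lemma mem_sector_iff:
  assumes ab: "a \<le> b" "b \<le> a + pi"
  shows "z \<in> sector a b \<longleftrightarrow>
    0 \<le> Im (z * cis (- a)) \<and> Im (z * cis (- b)) \<le> 0 \<and> 0 \<le> Re (z * cis (- ((a + b) / 2)))"
proof
  assume "z \<in> sector a b"
  then obtain \<rho> t where z: "z = of_real \<rho> * cis t" "0 \<le> \<rho>" "a \<le> t" "t \<le> b"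
    unfolding sector_def by auto
  have e: "z * cis (- c) = of_real \<rho> * cis (t - c)" for c by (simp add: z(1) cis_mult mult.assoc)
  have "0 \<le> sin (t - a)" using z ab by (intro sin_ge_zero) auto
  moreover have "0 \<le> sin (b - t)" using z ab by (intro sin_ge_zero) auto
  then have "sin (t - b) \<le> 0" using sin_minus[of "b - t"] by simp
  moreover have "0 \<le> cos (t - (a + b) / 2)" using z ab by (intro cos_ge_zero) (auto simp: field_simps)
  ultimately show "0 \<le> Im (z * cis (- a)) \<and> Im (z * cis (- b)) \<le> 0 \<and> 0 \<le> Re (z * cis (- ((a + b) / 2)))"
    unfolding e using z(2) by (simp add: mult_nonneg_nonpos)
next
  assume *: "0 \<le> Im (z * cis (- a)) \<and> Im (z * cis (- b)) \<le> 0 \<and> 0 \<le> Re (z * cis (- ((a + b) / 2)))"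
  show "z \<in> sector a b"
  proof (cases "z = 0")
    case True
    then show ?thesis unfolding sector_def using ab by (auto intro!: exI[of _ 0] exI[of _ a])
  next
    case False
    define m where "m = (a + b) / 2"
    define w where "w = (b - a) / 2"
    define u where "u = z * cis (- m)"
    define s where "s = Arg u"
    have u: "u \<noteq> 0" "0 \<le> Re u" using False * by (auto simp: u_def m_def)
    have s: "\<bar>s\<bar> \<le> pi / 2" unfolding s_def by (rule abs_Arg_le_pi_half[OF u])
    have us: "u = of_real (cmod u) * cis s"
      using cis_Arg[OF u(1)] u(1) by (simp add: s_def sgn_div_norm scaleR_conv_of_real field_simps)
    have z: "z = u * cis m" by (simp add: u_def mult.assoc cis_mult)
    then have zs: "z = of_real (cmod u) * cis (m + s)"
      by (subst (asm) us) (simp add: cis_mult mult.assoc add.commute)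
    have mw: "m - a = w" "m - b = - w" by (simp_all add: m_def w_def field_simps)
    have zc: "z * cis (- c) = of_real (cmod u) * cis (m + s - c)" for c
      by (subst zs) (simp add: mult.assoc cis_mult)
    have sw: "m + s - a = s + w" "m + s - b = s - w" using mw by linarith+
    have "z * cis (- a) = of_real (cmod u) * cis (s + w)" "z * cis (- b) = of_real (cmod u) * cis (s - w)"
      using zc[of a] zc[of b] unfolding sw .
    then have "0 \<le> cmod u * sin (s + w)" "cmod u * sin (s - w) \<le> 0" using * by auto
    then have "0 \<le> sin (s + w)" "sin (s - w) \<le> 0"
      using u(1) by (simp_all add: zero_le_mult_iff mult_le_0_iff)
    moreover have "0 \<le> w" "w \<le> pi / 2" using ab by (auto simp: w_def)
    ultimately have "- w \<le> s" "s \<le> w" using sin_window[OF s] by blast+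
    then have "a \<le> m + s" "m + s \<le> b" using mw by linarith+
    then show ?thesis using cis_mem_sector[of a "m + s" b "cmod u"] zs by simp
  qed
qed

lemma sector_add:
  assumes "a \<le> b" "b \<le> a + pi" "z \<in> sector a b" "w \<in> sector a b"
  shows "z + w \<in> sector a b"
  using assms(3,4) unfolding mem_sector_iff[OF assms(1,2)] distrib_right plus_complex.sel by linarith

lemma zero_mem_sector: "a \<le> b \<Longrightarrow> 0 \<in> sector a b"
  unfolding sector_def by (auto intro!: exI[of _ 0] exI[of _ a])

lemma sector_accretive:
  assumes ab: "a \<le> b" "b \<le> a + pi" and M: "M \<in> carrier_mat n n"
    and sec: "\<And>x. x \<in> carrier_vec n \<Longrightarrow> quad_form M x \<in> sector a b"
  shows "accretive ((a + b) / 2) M"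
  unfolding accretive_def using sec M mem_sector_iff[OF ab] by (auto simp: mult.commute)

text \<open>A sector of angle less than \<open>\<pi>\<close> lies in two half-planes with different boundaries. An isotropic
  vector satisfies the kernel equation of both, and the two equations are independent.\<close>

lemma sector_definite:
  assumes ab: "a \<le> b" "b - a < pi" and M: "M \<in> carrier_mat n n" and det: "det M \<noteq> 0"
    and sec: "\<And>x. x \<in> carrier_vec n \<Longrightarrow> quad_form M x \<in> sector a b"
    and x: "x \<in> carrier_vec n" "quad_form M x = 0"
  shows "x = 0\<^sub>v n"
proof -
  \<comment> \<open>Two half-planes containing the sector: \<open>m\<close> is the centre of the one
    symmetric to the bisector, and \<open>m'\<close> of the one bounded by the line through the ray
    at angle \<open>a\<close>.\<close>
  define m m' where "m = (a + b) / 2" and "m' = a + pi / 2"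
  have ab': "b \<le> a + pi" using ab by simp
  have acc: "accretive m M" unfolding m_def by (rule sector_accretive[OF ab(1) ab' M sec])
  have acc': "accretive m' M"
    unfolding accretive_def
  proof
    fix y :: "complex vec" assume "y \<in> carrier_vec (dim_row M)"
    then have "quad_form M y \<in> sector a b" using sec M by auto
    then have "0 \<le> Im (quad_form M y * cis (- a))" using mem_sector_iff[OF ab(1) ab'] by blast
    moreover have "cos (- a - pi / 2) = - sin a" "sin (- a - pi / 2) = - cos a"
      by (simp_all add: cos_diff sin_diff)
    then have "Re (cis (- m') * w) = Im (w * cis (- a))" for w
      unfolding m'_def by (simp add: algebra_simps)
    ultimately show "0 \<le> Re (cis (- m') * quad_form M y)" by simp
  qed
  define u w where "u = M *\<^sub>v x" and "w = adj M *\<^sub>v x"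
  have uw: "u \<in> carrier_vec n" "w \<in> carrier_vec n"
    using M x(1) mult_mat_vec_carrier[OF adj_carrier[OF M] x(1)] by (auto simp: u_def w_def)
  have 1: "cis (- m) \<cdot>\<^sub>v u + cis m \<cdot>\<^sub>v w = 0\<^sub>v n"
    unfolding u_def w_def by (rule accretive_isotropic[OF M acc x(1)]) (simp add: x(2))
  have 2: "cis (- m') \<cdot>\<^sub>v u + cis m' \<cdot>\<^sub>v w = 0\<^sub>v n"
    unfolding u_def w_def by (rule accretive_isotropic[OF M acc' x(1)]) (simp add: x(2))
  have "u = 0\<^sub>v n"
  proof (rule eq_vecI)
    fix i assume "i < dim_vec (0\<^sub>v n :: complex vec)"
    then have i: "i < n" by simp
    have "(cis (- m) \<cdot>\<^sub>v u + cis m \<cdot>\<^sub>v w) $ i = 0" "(cis (- m') \<cdot>\<^sub>v u + cis m' \<cdot>\<^sub>v w) $ i = 0"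
      using 1 2 i by simp_all
    then have e: "cis (- m) * u $ i + cis m * w $ i = 0" "cis (- m') * u $ i + cis m' * w $ i = 0"
      using i uw by simp_all
    have "cis m' * (cis (- m) * u $ i + cis m * w $ i) - cis m * (cis (- m') * u $ i + cis m' * w $ i) =
      u $ i * (cis m' * cis (- m) - cis m * cis (- m'))" by (simp add: algebra_simps)
    then have "u $ i * (cis m' * cis (- m) - cis m * cis (- m')) = 0" using e by simp
    \<comment> \<open>The determinant of the two equations in \<open>u $ i\<close> and
      \<open>w $ i\<close>. Its imaginary part is \<open>2 * sin (m' - m)\<close>, where
      \<open>m' - m\<close> is \<open>pi / 2\<close> minus half the angle of the sector.\<close>
    moreover have "cis m' * cis (- m) - cis m * cis (- m') \<noteq> 0"
    proof -
      have "Im (cis m' * cis (- m) - cis m * cis (- m')) = sin (m' - m) - sin (m - m')"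
        by (simp add: cis_mult del: cis.simps add: cis.sel)
      also have "\<dots> = 2 * sin (m' - m)" using sin_minus[of "m' - m"] by simp
      also have "\<dots> > 0" using ab by (simp add: m_def m'_def) (intro sin_gt_zero; simp add: field_simps)
      finally show ?thesis by (metis less_irrefl zero_complex.sel(2))
    qed
    ultimately show "u $ i = 0\<^sub>v n $ i" using i by simp
  qed (use uw in simp)
  then show ?thesis using det_nonzeroD[OF M det x(1)] by (simp add: u_def)
qed

section \<open>Lines in the angular numerical range and the field angle\<close>

lemma angular_numerical_range_iff:
  assumes "M \<in> carrier_mat n n"
  shows "z \<in> angular_numerical_range M \<longleftrightarrow> (\<exists>x \<in> carrier_vec n. x \<noteq> 0\<^sub>v n \<and> z = quad_form M x)"
  using assms unfolding angular_numerical_range_def quad_form_def by auto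

text \<open>If \<open>z\<close> and \<open>- z\<close> satisfy the same inequalities, these are
  equalities: \<open>z\<close> lies on the line of the boundary ray at \<open>a\<close> and is
  orthogonal to the bisector. Half the angle is therefore \<open>pi / 2\<close>, and the line is
  determined.\<close>

lemma line_in_sector:
  assumes ab: "a \<le> b" "b \<le> a + pi" and z: "z \<noteq> 0" and L: "range (\<lambda>t::real. of_real t * z) \<subseteq> sector a b"
  shows "b - a = pi" and "range (\<lambda>t::real. of_real t * z) = range (\<lambda>t::real. of_real t * (\<i> * cis ((a + b) / 2)))"
proof -
  define m where "m = (a + b) / 2"
  have "of_real 1 * z \<in> sector a b" "of_real (- 1) * z \<in> sector a b" using L by blast+
  then have zz: "z \<in> sector a b" "- z \<in> sector a b" by simp_all
  then have e: "Im (z * cis (- a)) = 0" "Re (z * cis (- m)) = 0"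
    unfolding mem_sector_iff[OF ab] m_def by auto
  define p where "p = Re (z * cis (- a))"
  have "z * cis (- a) = of_real p" using e(1) by (simp add: p_def complex_eq_iff)
  then have "z * cis (- a) * cis a = of_real p * cis a" by simp
  then have zp: "z = of_real p * cis a" by (simp add: mult.assoc cis_mult)
  then have "z * cis (- m) = of_real p * cis (a - m)" by (simp add: mult.assoc cis_mult)
  then have "p * cos (a - m) = 0" using e(2) by simp
  moreover have "p \<noteq> 0" using zp z by auto
  ultimately have c: "cos (a - m) = 0" by simp
  have am: "a - m = - ((b - a) / 2)" by (simp add: m_def field_simps)
  have c': "cos ((b - a) / 2) = 0" using c unfolding am by simp
  show "b - a = pi"
  proof (rule ccontr)
    assume "b - a \<noteq> pi"
    then have "0 < cos ((b - a) / 2)" using ab by (intro cos_gt_zero_pi) (auto simp: field_simps)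
    then show False using c' by simp
  qed
  define q where "q = Im (z * cis (- m))"
  have "z * cis (- m) = \<i> * of_real q" using e(2) by (simp add: q_def complex_eq_iff)
  then have "z * cis (- m) * cis m = \<i> * of_real q * cis m" by simp
  then have zq: "z = of_real q * (\<i> * cis m)" by (simp add: mult.assoc cis_mult mult.left_commute)
  then have q: "q \<noteq> 0" using z by auto
  show "range (\<lambda>t::real. of_real t * z) = range (\<lambda>t::real. of_real t * (\<i> * cis ((a + b) / 2)))"
    unfolding m_def[symmetric]
  proof (intro equalityI subsetI)
    fix y assume "y \<in> range (\<lambda>t::real. of_real t * z)"
    then obtain t :: real where "y = of_real t * z" by auto
    then have "y = of_real (t * q) * (\<i> * cis m)" by (subst (asm) zq) (simp add: mult.assoc)
    then show "y \<in> range (\<lambda>t::real. of_real t * (\<i> * cis m))" by blast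
  next
    fix y assume "y \<in> range (\<lambda>t::real. of_real t * (\<i> * cis m))"
    then obtain t :: real where "y = of_real t * (\<i> * cis m)" by auto
    then have "y = of_real (t / q) * z" using q by (subst zq) simp
    then show "y \<in> range (\<lambda>t::real. of_real t * z)" by blast
  qed
qed

lemma subtended_angle_le:
  assumes "a \<le> b" "K \<subseteq> sector a b"
  shows "subtended_angle K \<le> b - a"
  unfolding subtended_angle_def
  by (rule cInf_lower) (use assms in \<open>auto intro!: bdd_belowI[of _ 0]\<close>)

text \<open>A sector of angle at most pi contains at most one line, which excludes the value
  \<open>2 * pi\<close>. A field angle below pi excludes lines altogether, so it is the infimum over
  sectors, and some sector comes close enough to stay below pi.\<close>

lemma field_angle_sector:
  assumes ab: "a \<le> b" "b \<le> a + pi" and W: "angular_numerical_range M \<subseteq> sector a b"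
  shows "field_angle M \<le> pi" and "b - a < pi \<Longrightarrow> field_angle M < pi"
    and "field_angle M < pi \<Longrightarrow> \<exists>a' b'. a' \<le> b' \<and> b' - a' < pi \<and> angular_numerical_range M \<subseteq> sector a' b'"
proof -
  let ?W = "angular_numerical_range M"
  let ?P = "\<lambda>L. line_through_origin L \<and> L \<subseteq> ?W"
  have uniq: "L = range (\<lambda>t::real. of_real t * (\<i> * cis ((a + b) / 2)))" "b - a = pi" if "?P L" for L
  proof -
    have "\<exists>z. z \<noteq> 0 \<and> L = range (\<lambda>t::real. of_real t * z)"
      using that unfolding line_through_origin_def by (rule conjunct1)
    then obtain z where z: "z \<noteq> 0" "L = range (\<lambda>t::real. of_real t * z)" by (elim exE conjE)
    have "L \<subseteq> sector a b" using that W by (meson subset_trans)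
    then have "range (\<lambda>t::real. of_real t * z) \<subseteq> sector a b" unfolding z(2) .
    from line_in_sector[OF ab z(1) this]
    show "L = range (\<lambda>t::real. of_real t * (\<i> * cis ((a + b) / 2)))" "b - a = pi"
      unfolding z(2) by simp_all
  qed
  have sub: "subtended_angle ?W \<le> b - a" by (rule subtended_angle_le[OF ab(1) W])
  have fa: "field_angle M = (if \<not> (\<exists>L. ?P L) then subtended_angle ?W else if \<exists>!L. ?P L then pi else 2 * pi)"
    unfolding field_angle_def Let_def ..
  have ex1: "\<exists>!L. ?P L" if "\<exists>L. ?P L" using that uniq(1) by metis
  show "field_angle M \<le> pi" unfolding fa using sub ab ex1 by auto
  show "field_angle M < pi" if "b - a < pi"
  proof -
    have "\<not> (\<exists>L. ?P L)" using uniq(2) that less_irrefl by metis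
    then show ?thesis unfolding fa using sub that by simp
  qed
  show "\<exists>a' b'. a' \<le> b' \<and> b' - a' < pi \<and> ?W \<subseteq> sector a' b'" if "field_angle M < pi"
  proof -
    have "\<not> (\<exists>L. ?P L)" using that pi_gt_zero unfolding fa by (auto split: if_splits)
    then have "subtended_angle ?W < pi" using that unfolding fa by simp
    then have "\<exists>x\<in>{b - a | a b. a \<le> b \<and> ?W \<subseteq> sector a b}. x < pi"
      unfolding subtended_angle_def using ab(1) W
      by (subst (asm) cInf_less_iff) (auto intro!: bdd_belowI[of _ 0])
    then show ?thesis by blast
  qed
qed

lemma angular_numerical_range_congruent:
  assumes "congruent_mat M D"
  shows "angular_numerical_range D \<subseteq> angular_numerical_range M"
proof
  obtain n T where 1: "M \<in> carrier_mat n n" "D \<in> carrier_mat n n" "T \<in> carrier_mat n n" "det T \<noteq> 0"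
    "M = adj T * D * T" using assms by (rule congruent_matE)
  obtain S where S: "S \<in> carrier_mat n n" "T * S = 1\<^sub>m n" "S * T = 1\<^sub>m n" using det_nonzero_inverse[OF 1(3,4)] .
  fix z assume "z \<in> angular_numerical_range D"
  then obtain y where y: "y \<in> carrier_vec n" "y \<noteq> 0\<^sub>v n" "z = quad_form D y"
    using angular_numerical_range_iff[OF 1(2)] by blast
  have Sy: "S *\<^sub>v y \<in> carrier_vec n" using S(1) y(1) by simp
  have "T *\<^sub>v (S *\<^sub>v y) = (T * S) *\<^sub>v y"
    by (rule mult_vec_assoc_dim[symmetric]) (use 1(3) S(1) y(1) in auto)
  then have TSy: "T *\<^sub>v (S *\<^sub>v y) = y" using S(2) y(1) by simp
  have "quad_form M (S *\<^sub>v y) = quad_form D (T *\<^sub>v (S *\<^sub>v y))"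
    unfolding 1(5) by (rule quad_form_congruence[OF 1(3,2) Sy])
  then have "z = quad_form M (S *\<^sub>v y)" using y(3) TSy by simp
  moreover have "S *\<^sub>v y \<noteq> 0\<^sub>v n"
    using y det_nonzeroD[OF S(1) det_inverse[OF S(1) 1(3) S(3)] y(1)] by blast
  ultimately show "z \<in> angular_numerical_range M"
    using Sy angular_numerical_range_iff[OF 1(1)] by blast
qed

section \<open>Values attained by the forms of block sums and canonical blocks\<close>

lemma append_vec_zero_iff:
  assumes "x \<in> carrier_vec n" "y \<in> carrier_vec m"
  shows "x @\<^sub>v y = 0\<^sub>v (n + m) \<longleftrightarrow> x = 0\<^sub>v n \<and> y = (0\<^sub>v m :: complex vec)"
  unfolding zero_append_vec using assms by (simp add: append_vec_eq[of _ n])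

lemma angular_numerical_range_block_sum:
  assumes A: "A \<in> carrier_mat n n" and B: "B \<in> carrier_mat m m"
  shows "angular_numerical_range A \<subseteq> angular_numerical_range (block_sum A B)"
    and "angular_numerical_range B \<subseteq> angular_numerical_range (block_sum A B)"
    and "z \<in> angular_numerical_range A \<Longrightarrow> w \<in> angular_numerical_range B \<Longrightarrow>
      z + w \<in> angular_numerical_range (block_sum A B)"
proof -
  note AB = block_sum_carrier[OF A B]
  have mem: "quad_form A x + quad_form B y \<in> angular_numerical_range (block_sum A B)"
    if "x \<in> carrier_vec n" "y \<in> carrier_vec m" "\<not> (x = 0\<^sub>v n \<and> y = 0\<^sub>v m)" for x y
  proof -
    have "x @\<^sub>v y \<noteq> 0\<^sub>v (n + m)" using append_vec_zero_iff[OF that(1,2)] that(3) by simp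
    then show ?thesis
      using angular_numerical_range_iff[OF AB] quad_form_block_sum[OF A B that(1,2)] append_carrier_vec[OF that(1,2)]
      by metis
  qed
  have z: "quad_form A (0\<^sub>v n) = 0" "quad_form B (0\<^sub>v m) = 0"
    using A B by (simp_all add: quad_form_def mult_mat_vec_zero)
  show "angular_numerical_range A \<subseteq> angular_numerical_range (block_sum A B)"
  proof
    fix v assume "v \<in> angular_numerical_range A"
    then obtain x where "x \<in> carrier_vec n" "x \<noteq> 0\<^sub>v n" "v = quad_form A x"
      using angular_numerical_range_iff[OF A] by blast
    then show "v \<in> angular_numerical_range (block_sum A B)" using mem[of x "0\<^sub>v m"] z by simp
  qed
  show "angular_numerical_range B \<subseteq> angular_numerical_range (block_sum A B)"
  proof
    fix v assume "v \<in> angular_numerical_range B"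
    then obtain x where "x \<in> carrier_vec m" "x \<noteq> 0\<^sub>v m" "v = quad_form B x"
      using angular_numerical_range_iff[OF B] by blast
    then show "v \<in> angular_numerical_range (block_sum A B)" using mem[of "0\<^sub>v n" x] z by simp
  qed
  show "z + w \<in> angular_numerical_range (block_sum A B)"
    if "z \<in> angular_numerical_range A" "w \<in> angular_numerical_range B"
    using that angular_numerical_range_iff[OF A] angular_numerical_range_iff[OF B] mem by metis
qed

lemma scalar_mat1_range: "z \<in> angular_numerical_range (scalar_mat1 z)"
proof -
  have "quad_form (scalar_mat1 z) (unit_vec 1 0) = z"
    by (simp add: quad_form_def scalar_prod_def)
  moreover have "unit_vec 1 0 \<noteq> (0\<^sub>v 1 :: complex vec)"
  proof
    assume "unit_vec 1 0 = (0\<^sub>v 1 :: complex vec)"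
    then have "unit_vec 1 0 $ 0 = (0\<^sub>v 1 :: complex vec) $ 0" by simp
    then show False by simp
  qed
  ultimately show ?thesis
    using angular_numerical_range_iff[OF scalar_mat1_carrier[of z], of z] unit_vec_carrier[of 1 0] by metis
qed

text \<open>The witnesses are \<open>(1, -1)\<close> for 0 and \<open>(1, 0)\<close> for
  \<open>cis \<gamma>\<close>.\<close>

lemma jordan_block_range: "z \<in> {0, cis \<gamma>} \<Longrightarrow> z \<in> angular_numerical_range (cis \<gamma> \<cdot>\<^sub>m jordan_block2)"
proof -
  have J: "cis \<gamma> \<cdot>\<^sub>m jordan_block2 \<in> carrier_mat 2 2" by simp
  define v where "v = (\<lambda>y::complex. vec 2 (\<lambda>i. if i = 0 then 1 else y))"
  have v: "v y \<in> carrier_vec 2" "v y \<noteq> 0\<^sub>v 2" for y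
  proof -
    show "v y \<noteq> 0\<^sub>v 2"
    proof
      assume "v y = 0\<^sub>v 2"
      then have "v y $ 0 = 0\<^sub>v 2 $ 0" by simp
      then show False by (simp add: v_def)
    qed
  qed (simp add: v_def)
  have q: "quad_form jordan_block2 (v y) = 1 + 2 * y + y * cnj y" for y
    unfolding v_def quad_form_2[OF jordan_block2_carrier] by (simp add: jordan_block2_index)
  have "quad_form (cis \<gamma> \<cdot>\<^sub>m jordan_block2) (v (- 1)) = 0" "quad_form (cis \<gamma> \<cdot>\<^sub>m jordan_block2) (v 0) = cis \<gamma>"
    using v(1) by (simp_all add: quad_form_smult_mat[of _ 2] q)
  then show "z \<in> angular_numerical_range (cis \<gamma> \<cdot>\<^sub>m jordan_block2)" if "z \<in> {0, cis \<gamma>}"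
    using that v angular_numerical_range_iff[OF J, of z] by (metis insert_iff empty_iff)
qed

text \<open>The two values serve to exclude Jordan blocks: 0 when the form is definite, and
  \<open>cis \<gamma>\<close> when the range lies on the line orthogonal to it.\<close>

lemma phase_blocks_range_jordan:
  assumes "k > 0" "z \<in> {0, cis \<gamma>}"
  shows "z \<in> angular_numerical_range (phase_blocks \<gamma> \<theta> k)"
proof (induction \<theta>)
  case Nil
  obtain l where k: "k = Suc l" using assms(1) by (cases k) auto
  have J: "cis \<gamma> \<cdot>\<^sub>m jordan_block2 \<in> carrier_mat 2 2" by simp
  show ?case unfolding phase_blocks_Nil k
    using angular_numerical_range_block_sum(1)[OF J replicate_block_carrier[OF J, of l]]
      jordan_block_range[OF assms(2)] by (simp add: diag_block_mat_Cons subsetD del: diag_block_mat.simps)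
next
  case (Cons t \<theta>)
  then show ?case unfolding phase_blocks_Cons
    using angular_numerical_range_block_sum(2)[OF scalar_mat1_carrier phase_blocks_carrier] by blast
qed

lemma phase_blocks_range:
  "t \<in> set \<theta> \<Longrightarrow> cis t \<in> angular_numerical_range (phase_blocks \<gamma> \<theta> k)"
proof (induction \<theta>)
  case (Cons s \<theta>)
  show ?case
  proof (cases "t = s")
    case True
    then show ?thesis unfolding phase_blocks_Cons
      using angular_numerical_range_block_sum(1)[OF scalar_mat1_carrier phase_blocks_carrier] scalar_mat1_range by blast
  next
    case False
    then show ?thesis unfolding phase_blocks_Cons
      using subsetD[OF angular_numerical_range_block_sum(2)[OF scalar_mat1_carrier phase_blocks_carrier]]
        Cons.IH Cons.prems by simp
  qed
qed simp

text \<open>For two phases that differ by pi the sum is 0, so a definite form cannot have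
  both.\<close>

lemma phase_blocks_range_sum:
  assumes "s \<in> set \<theta>" "t \<in> set \<theta>" "s \<noteq> t"
  shows "cis s + cis t \<in> angular_numerical_range (phase_blocks \<gamma> \<theta> k)"
  using assms
proof (induction \<theta>)
  case (Cons u \<theta>)
  note bs = angular_numerical_range_block_sum[OF scalar_mat1_carrier[of "cis u"] phase_blocks_carrier[of \<gamma> \<theta> k]]
  consider "s = u" "t \<in> set \<theta>" | "t = u" "s \<in> set \<theta>" | "s \<in> set \<theta>" "t \<in> set \<theta>" using Cons.prems by auto
  then show ?case
  proof cases
    case 1
    then show ?thesis unfolding phase_blocks_Cons
      using bs(3)[OF scalar_mat1_range phase_blocks_range[of t \<theta> \<gamma> k]] by simp
  next
    case 2
    then show ?thesis unfolding phase_blocks_Cons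
      using bs(3)[OF scalar_mat1_range phase_blocks_range[of s \<theta> \<gamma> k]] by (simp add: add.commute)
  next
    case 3
    then show ?thesis unfolding phase_blocks_Cons using bs(2) Cons by blast
  qed
qed simp

section \<open>Sectors that contain the forms of canonical blocks\<close>

lemma quad_form_jordan_nonneg:
  assumes "x \<in> carrier_vec 2"
  shows "0 \<le> Re (quad_form jordan_block2 x)"
proof -
  have "x = vec 2 (\<lambda>i. if i = 0 then x $ 0 else x $ 1)"
    using assms by (intro eq_vecI) (auto simp: less_2_cases_iff)
  then have "quad_form jordan_block2 x = x $ 0 * cnj (x $ 0) + 2 * x $ 1 * cnj (x $ 0) + x $ 1 * cnj (x $ 1)"
    using quad_form_2[OF jordan_block2_carrier, of "x $ 0" "x $ 1"]
    by (simp add: jordan_block2_index)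
  then have "Re (quad_form jordan_block2 x) = (Re (x $ 0) + Re (x $ 1))\<^sup>2 + (Im (x $ 0) + Im (x $ 1))\<^sup>2"
    by (simp add: power2_eq_square algebra_simps)
  then show ?thesis by simp
qed

lemma quad_form_block_sum_sector:
  assumes ab: "a \<le> b" "b \<le> a + pi" and A: "A \<in> carrier_mat n n" and B: "B \<in> carrier_mat m m"
    and sA: "\<And>x. x \<in> carrier_vec n \<Longrightarrow> quad_form A x \<in> sector a b"
    and sB: "\<And>x. x \<in> carrier_vec m \<Longrightarrow> quad_form B x \<in> sector a b"
    and w: "w \<in> carrier_vec (n + m)"
  shows "quad_form (block_sum A B) w \<in> sector a b"
proof -
  have v: "vec_first w n \<in> carrier_vec n" "vec_last w m \<in> carrier_vec m" by auto
  have "w = vec_first w n @\<^sub>v vec_last w m" using w by simp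
  then have "quad_form (block_sum A B) w = quad_form A (vec_first w n) + quad_form B (vec_last w m)"
    using quad_form_block_sum[OF A B v] by metis
  then show ?thesis using sector_add[OF ab] sA[OF v(1)] sB[OF v(2)] by simp
qed

text \<open>The form is a sum of contributions of the blocks, and sectors of angle at most pi are
  closed under addition. A Jordan block has values in directions arbitrarily close to both boundary
  rays of its half-plane, so with \<open>k > 0\<close> the sector has to be this half-plane.\<close>

lemma quad_form_phase_blocks_sector:
  assumes ab: "a \<le> b" "b \<le> a + pi" and \<theta>: "set \<theta> \<subseteq> {a..b}"
    and k: "k > 0 \<Longrightarrow> a = \<gamma> - pi / 2 \<and> b = \<gamma> + pi / 2"
    and x: "x \<in> carrier_vec (length \<theta> + 2 * k)"
  shows "quad_form (phase_blocks \<gamma> \<theta> k) x \<in> sector a b"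
  using \<theta> x
proof (induction \<theta> arbitrary: x)
  case Nil
  have J: "cis \<gamma> \<cdot>\<^sub>m jordan_block2 \<in> carrier_mat 2 2" by simp
  have "\<forall>x \<in> carrier_vec (k * 2). quad_form (diag_block_mat (replicate k (cis \<gamma> \<cdot>\<^sub>m jordan_block2))) x \<in> sector a b"
    using k
  proof (induction k)
    case 0
    show ?case using zero_mem_sector[OF ab(1)] by (auto simp: quad_form_def scalar_prod_def)
  next
    case (Suc k)
    have ge: "a = \<gamma> - pi / 2" "b = \<gamma> + pi / 2" using Suc.prems by auto
    have m: "(a + b) / 2 = \<gamma>" by (simp add: ge)
    have "quad_form (cis \<gamma> \<cdot>\<^sub>m jordan_block2) y \<in> sector a b" if y: "y \<in> carrier_vec 2" for y
    proof -
      define z where "z = quad_form jordan_block2 y"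
      have z: "0 \<le> Re z" using quad_form_jordan_nonneg[OF y] by (simp add: z_def)
      have c: "cis \<gamma> * z * cis (- c) = z * cis (\<gamma> - c)" for c
        by (simp add: cis_mult[symmetric] mult_ac cis_mult[of \<gamma> "- c", simplified])
      have e1: "cis \<gamma> * z * cis (- a) = z * \<i>" unfolding c by (simp add: ge)
      have e2: "cis \<gamma> * z * cis (- b) = z * - \<i>" unfolding c by (simp add: ge)
      have e3: "cis \<gamma> * z * cis (- ((a + b) / 2)) = z" unfolding c m by simp
      have "cis \<gamma> * z \<in> sector a b" unfolding mem_sector_iff[OF ab] e1 e2 e3 using z by simp
      then show ?thesis using y by (simp add: quad_form_smult_mat[of _ 2] z_def)
    qed
    moreover have "\<forall>x\<in>carrier_vec (k * 2). quad_form (diag_block_mat (replicate k (cis \<gamma> \<cdot>\<^sub>m jordan_block2))) x \<in> sector a b"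
      using Suc.IH ge by blast
    ultimately show ?case
      using quad_form_block_sum_sector[OF ab J replicate_block_carrier[OF J, of k]]
      by (simp add: diag_block_mat_Cons del: diag_block_mat.simps)
  qed
  then show ?case using Nil by (simp add: phase_blocks_Nil mult.commute)
next
  case (Cons t \<theta>)
  have t: "quad_form (scalar_mat1 (cis t)) y \<in> sector a b" if y: "y \<in> carrier_vec 1" for y
  proof -
    have "quad_form (scalar_mat1 (cis t)) y = of_real ((cmod (y $ 0))\<^sup>2) * cis t"
      unfolding complex_norm_square using y by (simp add: quad_form_def scalar_prod_def mult_ac)
    then show ?thesis using cis_mem_sector[of a t b "(cmod (y $ 0))\<^sup>2"] Cons.prems(1) by simp
  qed
  have th: "\<And>y. y \<in> carrier_vec (length \<theta> + 2 * k) \<Longrightarrow> quad_form (phase_blocks \<gamma> \<theta> k) y \<in> sector a b"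
    using Cons.IH Cons.prems(1) by simp
  show ?case unfolding phase_blocks_Cons
    by (rule quad_form_block_sum_sector[OF ab scalar_mat1_carrier phase_blocks_carrier t th])
      (use Cons.prems(2) in simp_all)
qed

subsection \<open>Existence and location of phases\<close>

lemma mk_diagonal_phase_blocks: "mk_diagonal (map cis \<theta>) = phase_blocks \<gamma> \<theta> 0"
  by (simp add: phase_blocks_def mk_diagonal_def o_def)

lemma diag_block_phase_blocks:
  "diag_block_mat ([0\<^sub>m z z, mk_diagonal (map cis \<theta>)] @ replicate k (cis \<gamma> \<cdot>\<^sub>m jordan_block2)) =
    block_sum (0\<^sub>m z z) (phase_blocks \<gamma> \<theta> k)"
proof -
  have "phase_blocks \<gamma> \<theta> k = block_sum (mk_diagonal (map cis \<theta>)) (diag_block_mat (replicate k (cis \<gamma> \<cdot>\<^sub>m jordan_block2)))"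
    unfolding mk_diagonal_phase_blocks[of \<theta> \<gamma>] by (simp add: phase_blocks_def diag_block_mat_app)
  then show ?thesis by (simp add: diag_block_mat_Cons del: diag_block_mat.simps)
qed

lemma block_sum_empty: "A \<in> carrier_mat n n \<Longrightarrow> block_sum (0\<^sub>m 0 0) A = A"
  unfolding block_sum_def by (intro eq_matI) auto

lemma sorted_desc_bounds:
  fixes xs :: "real list"
  assumes "sorted_wrt (\<ge>) xs"
  shows "set xs \<subseteq> {last xs..hd xs}"
proof
  fix x assume "x \<in> set xs"
  then obtain i where i: "i < length xs" "x = xs ! i" by (metis in_set_conv_nth)
  then have "xs \<noteq> []" by auto
  then show "x \<in> {last xs..hd xs}"
    using i sorted_desc_nth[OF assms, of 0 i] sorted_desc_nth[OF assms, of i "length xs - 1"]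
    by (simp add: hd_conv_nth last_conv_nth)
qed

lemma sorted_desc_replicate: "sorted_wrt (\<ge>) (replicate n (x::real))"
  by (induction n) auto

text \<open>The three kinds of phases are brought to one normal form. The centre
  \<open>\<delta>\<close> of the half-plane is kept apart from the phase centre: the extreme phases
  of the list need not be symmetric about \<open>\<theta>\<^sub>0\<close> in the definition.\<close>

lemma has_phases_congruent:
  assumes "has_phases M \<gamma> \<phi>"
  obtains z \<delta> \<theta> k where "sorted_wrt (\<ge>) \<phi>" "set \<phi> \<subseteq> {\<delta> - pi / 2..\<delta> + pi / 2}"
    "\<phi> = replicate k (\<delta> + pi / 2) @ \<theta> @ replicate k (\<delta> - pi / 2)"
    "congruent_mat M (block_sum (0\<^sub>m z z) (phase_blocks \<delta> \<theta> k))"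
    "field_angle M < pi \<longrightarrow> (\<forall>s \<in> set \<phi>. \<forall>t \<in> set \<phi>. s - t < pi)"
proof -
  consider (quasi) "field_angle M < pi" "quasi_sectorial_phases M \<phi>"
    | (rotated) "field_angle M = pi" "rotated_hermitian_phases M \<phi>"
    | (general) "field_angle M = pi" "general_semi_sectorial_phases M \<phi>"
    using assms unfolding has_phases_def by (auto split: if_splits)
  then show thesis
  proof cases
    case quasi
    then obtain n r U Cs where *: "r \<le> n" "M \<in> carrier_mat n n" "U \<in> carrier_mat n n" "isometry U"
      "Cs \<in> carrier_mat r r" "sectorial_phases Cs \<phi>"
      "M = U * diag_block_mat [0\<^sub>m (n - r) (n - r), Cs] * adj U"
      unfolding quasi_sectorial_phases_def by blast
    have \<phi>: "sorted_wrt (\<ge>) \<phi>" "\<forall>s \<in> set \<phi>. \<forall>t \<in> set \<phi>. s - t < pi" "congruent_mat Cs (mk_diagonal (map cis \<phi>))"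
      using *(6) unfolding sectorial_phases_def by auto
    \<comment> \<open>A spread below pi keeps all phases within \<open>pi / 2\<close> of the
      midpoint of the extreme ones. For an empty list the value is arbitrary.\<close>
    define \<delta> where "\<delta> = (hd \<phi> + last \<phi>) / 2"
    have D: "diag_block_mat [0\<^sub>m (n - r) (n - r), Cs] = block_sum (0\<^sub>m (n - r) (n - r)) Cs"
      unfolding diag_block_mat_Cons[of "0\<^sub>m (n - r) (n - r)"] diag_block_mat_singleton ..
    have Dc: "block_sum (0\<^sub>m (n - r) (n - r)) Cs \<in> carrier_mat n n"
      using block_sum_carrier[OF zero_carrier_mat[of "n - r" "n - r"] *(5)] *(1) by simp
    have "adj U * U = 1\<^sub>m n" using *(3,4) by (simp add: isometry_def)
    \<comment> \<open>For a unitary \<open>U\<close> the unitary similarity is a congruence, with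
      \<open>adj U\<close> as transforming matrix.\<close>
    then have "det (adj U) \<noteq> 0" by (rule det_inverse[OF adj_carrier[OF *(3)] *(3)])
    then have "congruent_mat M (block_sum (0\<^sub>m (n - r) (n - r)) Cs)"
      using *(7) unfolding D by (intro congruent_matI[OF *(2) Dc adj_carrier[OF *(3)]]) auto
    moreover have "congruent_mat (block_sum (0\<^sub>m (n - r) (n - r)) Cs) (block_sum (0\<^sub>m (n - r) (n - r)) (phase_blocks \<delta> \<phi> 0))"
      using \<phi>(3) unfolding mk_diagonal_phase_blocks[of \<phi> \<delta>]
      by (intro congruent_block_sum congruent_mat_refl[of _ "n - r"]) auto
    ultimately have c: "congruent_mat M (block_sum (0\<^sub>m (n - r) (n - r)) (phase_blocks \<delta> \<phi> 0))"
      by (rule congruent_mat_trans)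
    have "set \<phi> \<subseteq> {\<delta> - pi / 2..\<delta> + pi / 2}"
    proof (cases "\<phi> = []")
      case False
      then have "hd \<phi> - last \<phi> < pi" using \<phi>(2) by simp
      then have "\<delta> - pi / 2 \<le> last \<phi>" "hd \<phi> \<le> \<delta> + pi / 2" by (simp_all add: \<delta>_def field_simps)
      then show ?thesis using sorted_desc_bounds[OF \<phi>(1)] by (meson atLeastatMost_subset_iff order_trans)
    qed simp
    then show thesis using that[of \<delta> 0 \<phi> "n - r"] \<phi> c by simp
  next
    case rotated
    from rotated(2)[unfolded rotated_hermitian_phases_def] obtain \<theta>0 z p q where *: "\<phi> = replicate p (\<theta>0 + pi / 2) @ replicate q (\<theta>0 - pi / 2)"
      "congruent_mat M (diag_block_mat [0\<^sub>m z z, mk_diagonal (map cis \<phi>)])"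
      by (elim exE conjE)
    have "congruent_mat M (block_sum (0\<^sub>m z z) (phase_blocks \<theta>0 \<phi> 0))"
      using *(2) diag_block_phase_blocks[of z \<phi> 0 \<theta>0] by simp
    moreover have "sorted_wrt (\<ge>) \<phi>" unfolding *(1) by (auto simp: sorted_wrt_append sorted_desc_replicate)
    moreover have "set \<phi> \<subseteq> {\<theta>0 - pi / 2..\<theta>0 + pi / 2}" unfolding *(1) by auto
    ultimately show thesis using that[of \<theta>0 0 \<phi> z] rotated(1) by simp
  next
    case general
    from general(2)[unfolded general_semi_sectorial_phases_def] obtain \<theta>0 z \<theta> k where *: "sorted_wrt (\<ge>) \<theta>" "set \<theta> \<subseteq> {\<theta>0 - pi / 2 .. \<theta>0 + pi / 2}"
      "\<phi> = replicate k (\<theta>0 + pi / 2) @ \<theta> @ replicate k (\<theta>0 - pi / 2)"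
      "congruent_mat M (diag_block_mat ([0\<^sub>m z z, mk_diagonal (map cis \<theta>)] @ replicate k (cis \<theta>0 \<cdot>\<^sub>m jordan_block2)))"
      by (elim exE conjE)
    have "congruent_mat M (block_sum (0\<^sub>m z z) (phase_blocks \<theta>0 \<theta> k))"
      using *(4) unfolding diag_block_phase_blocks .
    moreover have "sorted_wrt (\<ge>) \<phi>"
    proof -
      have "\<theta>0 - pi / 2 \<le> t \<and> t \<le> \<theta>0 + pi / 2" if "t \<in> set \<theta>" for t using *(2) that by auto
      then show ?thesis unfolding *(3) using *(1) by (auto simp: sorted_wrt_append sorted_desc_replicate)
    qed
    moreover have "set \<phi> \<subseteq> {\<theta>0 - pi / 2..\<theta>0 + pi / 2}" unfolding *(3) using *(2) by auto
    ultimately show thesis using that[of \<theta>0 k \<theta> z] general(1) *(3) by simp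
  qed
qed

text \<open>The sector spanned by the extreme phases has \<open>\<gamma>\<close> as its centre.
  Without phases the form is 0, \<open>hd\<close> and \<open>last\<close> say nothing, and the
  degenerate sector at the given \<open>\<gamma>\<close> is taken.\<close>

lemma has_phases_sector:
  assumes M: "M \<in> carrier_mat n n" and ph: "has_phases M \<gamma> \<phi>"
  obtains a b where "a \<le> b" "b \<le> a + pi" "\<gamma> = (a + b) / 2"
    "\<And>x. x \<in> carrier_vec n \<Longrightarrow> quad_form M x \<in> sector a b"
    "field_angle M < pi \<Longrightarrow> b - a < pi"
    "\<phi> \<noteq> [] \<Longrightarrow> phase_interval \<phi> = {a..b}"
    "\<And>x. \<phi> = [] \<Longrightarrow> x \<in> carrier_vec n \<Longrightarrow> quad_form M x = 0"
proof -
  obtain z \<delta> \<theta> k where srt: "sorted_wrt (\<ge>) \<phi>" and rng: "set \<phi> \<subseteq> {\<delta> - pi / 2..\<delta> + pi / 2}"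
    and \<phi>: "\<phi> = replicate k (\<delta> + pi / 2) @ \<theta> @ replicate k (\<delta> - pi / 2)"
    and c: "congruent_mat M (block_sum (0\<^sub>m z z) (phase_blocks \<delta> \<theta> k))"
    and w: "field_angle M < pi \<longrightarrow> (\<forall>s \<in> set \<phi>. \<forall>t \<in> set \<phi>. s - t < pi)"
    by (rule has_phases_congruent[OF ph])
  note PB = phase_blocks_carrier[of \<delta> \<theta> k]
  note BC = block_sum_carrier[OF zero_carrier_mat[of z z] PB]
  obtain m T where 1: "M \<in> carrier_mat m m" "block_sum (0\<^sub>m z z) (phase_blocks \<delta> \<theta> k) \<in> carrier_mat m m"
    "T \<in> carrier_mat m m" "M = adj T * block_sum (0\<^sub>m z z) (phase_blocks \<delta> \<theta> k) * T"
    using c by (rule congruent_matE)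
  have m: "m = n" "m = z + (length \<theta> + 2 * k)"
    using 1(1,2) M BC by (metis carrier_matD(1))+
  have sec: "quad_form M x \<in> sector a b"
    if ab: "a \<le> b" "b \<le> a + pi" and \<theta>: "set \<theta> \<subseteq> {a..b}"
      and k: "k > 0 \<Longrightarrow> a = \<delta> - pi / 2 \<and> b = \<delta> + pi / 2" and x: "x \<in> carrier_vec n" for a b x
  proof -
    have "quad_form M x = quad_form (block_sum (0\<^sub>m z z) (phase_blocks \<delta> \<theta> k)) (T *\<^sub>v x)"
      unfolding 1(4) by (rule quad_form_congruence[OF 1(3,2)]) (use x m in simp)
    moreover have "quad_form (block_sum (0\<^sub>m z z) (phase_blocks \<delta> \<theta> k)) (T *\<^sub>v x) \<in> sector a b"
    proof (rule quad_form_block_sum_sector[OF ab zero_carrier_mat PB _ quad_form_phase_blocks_sector[OF ab \<theta> k]])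
      show "quad_form (0\<^sub>m z z) y \<in> sector a b" if "y \<in> carrier_vec z" for y
      proof -
        have "0\<^sub>m z z *\<^sub>v y = 0\<^sub>v z" using that by (intro eq_vecI) auto
        then show ?thesis using zero_mem_sector[OF ab(1)] that by (simp add: quad_form_def)
      qed
      show "T *\<^sub>v x \<in> carrier_vec (z + (length \<theta> + 2 * k))"
        using mult_mat_vec_carrier[OF 1(3), of x] x m by simp
    qed
    ultimately show ?thesis by simp
  qed
  show thesis
  proof (cases "\<phi> = []")
    case True
    then have e: "\<theta> = []" "k = 0" using \<phi> by auto
    have s: "quad_form M x \<in> sector c c" if "x \<in> carrier_vec n" for x c
      by (rule sec) (use e that in auto)
    \<comment> \<open>Without blocks the value lies on every ray from the origin; the rays at angles
      0 and \<open>pi\<close> meet only in 0.\<close>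
    have z: "quad_form M x = 0" if x: "x \<in> carrier_vec n" for x
    proof -
      have "Im (quad_form M x) = 0"
        using s[OF x, of 0] mem_sector_iff[of 0 0 "quad_form M x"] by auto
      moreover have "Re (quad_form M x) = 0"
        using s[OF x, of 0] s[OF x, of pi] mem_sector_iff[of 0 0 "quad_form M x"]
          mem_sector_iff[of pi pi "quad_form M x"] by auto
      ultimately show ?thesis by (simp add: complex_eq_iff)
    qed
    show thesis using that[of \<gamma> \<gamma>] s z True by auto
  next
    case False
    define a b where "a = last \<phi>" and "b = hd \<phi>"
    have mem: "a \<in> set \<phi>" "b \<in> set \<phi>" using False by (simp_all add: a_def b_def)
    have bd: "set \<phi> \<subseteq> {a..b}" unfolding a_def b_def by (rule sorted_desc_bounds[OF srt])
    have "\<delta> - pi / 2 \<le> a" "b \<le> \<delta> + pi / 2" "a \<le> b"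
      using subsetD[OF rng mem(1)] subsetD[OF rng mem(2)] subsetD[OF bd mem(1)] by simp_all
    then have ab: "a \<le> b" "b \<le> a + pi" by linarith+
    have k: "a = \<delta> - pi / 2 \<and> b = \<delta> + pi / 2" if k0: "k > 0"
    proof -
      obtain l where "k = Suc l" using k0 by (cases k) auto
      then show ?thesis unfolding a_def b_def \<phi> by (simp add: last_append)
    qed
    have \<gamma>: "\<gamma> = (a + b) / 2" using ph False unfolding has_phases_def a_def b_def by (simp add: add.commute)
    show thesis
    proof (rule that[OF ab \<gamma>])
      show "quad_form M x \<in> sector a b" if "x \<in> carrier_vec n" for x
        by (rule sec[OF ab _ _ that]) (use bd \<phi> k in auto)
      show "b - a < pi" if "field_angle M < pi" using w that mem by blast
      show "phase_interval \<phi> = {a..b}" by (simp add: phase_interval_def a_def b_def)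
    qed (use False in simp)
  qed
qed

section \<open>Rotated Hermitian matrices\<close>

lemma two_valued_sorted_desc:
  fixes xs :: "real list"
  assumes "sorted_wrt (\<ge>) xs" "set xs \<subseteq> {u, l}" "l < u"
  shows "\<exists>p q. xs = replicate p u @ replicate q l"
  using assms(1,2)
proof (induction xs)
  case (Cons x xs)
  then obtain p q where pq: "xs = replicate p u @ replicate q l" by auto
  show ?case
  proof (cases "x = u")
    case True
    then show ?thesis using pq by (intro exI[of _ "Suc p"] exI[of _ q]) simp
  next
    case False
    then have x: "x = l" using Cons.prems by auto
    have "u \<notin> set xs" using Cons.prems(1) x assms(3) by auto
    then have "p = 0" using pq by (cases p) auto
    then show ?thesis using pq x by (intro exI[of _ 0] exI[of _ "Suc q"]) simp
  qed
qed simp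

lemma numerical_range_iff:
  assumes "M \<in> carrier_mat n n"
  shows "z \<in> numerical_range M \<longleftrightarrow> (\<exists>x \<in> carrier_vec n. x \<bullet>c x = 1 \<and> z = quad_form M x)"
  using assms unfolding numerical_range_def quad_form_def by auto

text \<open>The linear functional \<open>f\<close> is nonnegative at both ends of the segment and 0
  at the origin, a relative interior point. It vanishes at both ends, hence on the whole segment,
  and by scaling on the angular numerical range.\<close>

lemma rotated_hermitian_range:
  assumes M: "M \<in> carrier_mat n n" and acc: "accretive \<gamma> M" and rot: "rotated_hermitian M"
    and y: "y \<in> angular_numerical_range M"
  shows "Re (cis (- \<gamma>) * y) = 0"
proof -
  define f where "f = (\<lambda>w. Re (cis (- \<gamma>) * w))"
  have lin: "f ((1 - t) *\<^sub>R u + t *\<^sub>R v) = (1 - t) * f u + t * f v" for t u v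
    by (simp add: f_def algebra_simps)
  obtain u v where uv: "numerical_range M = closed_segment u v" "0 \<in> open_segment u v"
    using rot unfolding rotated_hermitian_def by blast
  have ge: "0 \<le> f w" if "w \<in> numerical_range M" for w
    using that acc M unfolding numerical_range_def accretive_def f_def quad_form_def by auto
  have fuv: "0 \<le> f u" "0 \<le> f v" using ge uv(1) by auto
  obtain t where t: "0 < t" "t < 1" "0 = (1 - t) *\<^sub>R u + t *\<^sub>R v" using uv(2) by (auto simp: in_segment)
  have "(1 - t) * f u + t * f v = 0" using lin[of t u v] t(3) by (simp add: f_def)
  moreover have "0 \<le> (1 - t) * f u" "0 \<le> t * f v" using fuv t by auto
  ultimately have "(1 - t) * f u = 0" "t * f v = 0" by linarith+
  then have z: "f u = 0" "f v = 0" using t by auto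
  obtain x where x: "x \<in> carrier_vec n" "x \<noteq> 0\<^sub>v n" "y = quad_form M x"
    using y angular_numerical_range_iff[OF M] by blast
  obtain c :: real where c: "c > 0" "x \<bullet>c x = of_real c" using cscalar_prod_nonzero[OF x(1,2)] .
  define s where "s = complex_of_real (1 / sqrt c)"
  have s: "s * cnj s = of_real (1 / c)" using c by (simp add: s_def flip: of_real_mult)
  have sx: "s \<cdot>\<^sub>v x \<in> carrier_vec n" using x(1) by simp
  have "(s \<cdot>\<^sub>v x) \<bullet>c (s \<cdot>\<^sub>v x) = s * cnj s * (x \<bullet>c x)" using x(1) by (simp add: cscalar_prod_smult[of _ n])
  then have "(s \<cdot>\<^sub>v x) \<bullet>c (s \<cdot>\<^sub>v x) = 1" unfolding s c(2) using c(1) by simp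
  then have "quad_form M (s \<cdot>\<^sub>v x) \<in> numerical_range M"
    using sx M unfolding numerical_range_def quad_form_def by auto
  then obtain t' where "quad_form M (s \<cdot>\<^sub>v x) = (1 - t') *\<^sub>R u + t' *\<^sub>R v"
    unfolding uv(1) by (auto simp: in_segment)
  then have "f (quad_form M (s \<cdot>\<^sub>v x)) = 0" using lin z by simp
  moreover have "quad_form M (s \<cdot>\<^sub>v x) = of_real (1 / c) * y"
    using quad_form_smult_vec[OF M x(1), of s] x(3) unfolding s by simp
  moreover have "f (of_real (1 / c) * y) = (1 / c) * f y" by (simp add: f_def algebra_simps)
  ultimately show ?thesis using c(1) by (simp add: f_def)
qed

text \<open>Canonical phases relative to the centre of a given sector are shown to lie in
  \<open>{a..b}\<close> and to be phases in the sense of the definition. The centre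
  \<open>\<gamma>'\<close> is the midpoint of the extreme phases and may differ from that of the
  sector.\<close>

lemma phases_exist:
  assumes M: "M \<in> carrier_mat r r" and det: "det M \<noteq> 0" and ab: "a \<le> b" "b \<le> a + pi"
    and sec: "\<And>x. x \<in> carrier_vec r \<Longrightarrow> quad_form M x \<in> sector a b"
  obtains \<phi> \<gamma>' where "canonical_phases ((a + b) / 2) M \<phi>" "set \<phi> \<subseteq> {a..b}" "has_phases M \<gamma>' \<phi>" "semi_sectorial M"
proof -
  define \<gamma> where "\<gamma> = (a + b) / 2"
  have acc: "accretive \<gamma> M" unfolding \<gamma>_def by (rule sector_accretive[OF ab M sec])
  obtain \<phi> where can: "canonical_phases \<gamma> M \<phi>" by (rule accretive_canonical_phases[OF M det acc])
  then obtain \<theta> k where srt\<theta>: "sorted_wrt (\<ge>) \<theta>" and \<theta>: "set \<theta> \<subseteq> {\<gamma> - pi / 2..\<gamma> + pi / 2}"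
    and \<phi>: "\<phi> = replicate k (\<gamma> + pi / 2) @ \<theta> @ replicate k (\<gamma> - pi / 2)"
    and c: "congruent_mat M (phase_blocks \<gamma> \<theta> k)"
    unfolding canonical_phases_def by blast
  let ?W = "angular_numerical_range M"
  have W: "?W \<subseteq> sector a b"
  proof
    fix y assume "y \<in> ?W"
    then show "y \<in> sector a b" unfolding angular_numerical_range_iff[OF M] using sec by auto
  qed
  have PW: "angular_numerical_range (phase_blocks \<gamma> \<theta> k) \<subseteq> ?W" by (rule angular_numerical_range_congruent[OF c])
  have narrow: "0 \<notin> ?W" if "a' \<le> b'" "b' - a' < pi" "?W \<subseteq> sector a' b'" for a' b'
  proof
    assume "0 \<in> ?W"
    then obtain x where x: "x \<in> carrier_vec r" "x \<noteq> 0\<^sub>v r" "0 = quad_form M x"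
      unfolding angular_numerical_range_iff[OF M] by (elim bexE conjE)
    have "quad_form M y \<in> sector a' b'" if y: "y \<in> carrier_vec r" for y
    proof (cases "y = 0\<^sub>v r")
      case True
      then show ?thesis using zero_mem_sector[OF \<open>a' \<le> b'\<close>] M by (simp add: quad_form_def mult_mat_vec_zero)
    next
      case False
      then have "quad_form M y \<in> ?W" unfolding angular_numerical_range_iff[OF M] using y by (intro bexI[of _ y]) auto
      then show ?thesis using \<open>?W \<subseteq> sector a' b'\<close> by (rule rev_subsetD)
    qed
    then have "x = 0\<^sub>v r" by (rule sector_definite[OF that(1,2) M det _ x(1) x(3)[symmetric]])
    then show False using x(2) by simp
  qed
  have k0: "k = 0" if "0 \<notin> ?W" using that PW phase_blocks_range_jordan[of k 0 \<gamma> \<theta>] by (cases k) auto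
  \<comment> \<open>\<open>cis t\<close> is a value of the form, hence in the sector. As
    \<open>t\<close> is already known to lie in the window around \<open>\<gamma>\<close>, this
    locates \<open>t\<close> itself and not just its class modulo \<open>2 * pi\<close>.\<close>
  have \<theta>ab: "t \<in> {a..b}" if t: "t \<in> set \<theta>" for t
  proof -
    have "cis t \<in> sector a b" using phase_blocks_range[OF t] PW W by blast
    then have s: "0 \<le> sin (t - a)" "sin (t - b) \<le> 0"
      using mem_sector_iff[OF ab, of "cis t"] by (auto simp: cis_mult)
    define w where "w = (b - a) / 2"
    have e: "t - a = (t - \<gamma>) + w" "t - b = (t - \<gamma>) - w" by (simp_all add: \<gamma>_def w_def field_simps)
    have "\<bar>t - \<gamma>\<bar> \<le> pi / 2" using subsetD[OF \<theta> t] unfolding abs_le_iff atLeastAtMost_iff by linarith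
    moreover have "0 \<le> w" "w \<le> pi / 2" using ab by (auto simp: w_def)
    ultimately have "- w \<le> t - \<gamma>" "t - \<gamma> \<le> w" using sin_window[of "t - \<gamma>" w] s unfolding e by blast+
    then show ?thesis unfolding atLeastAtMost_iff using e by linarith
  qed
  have \<phi>ab: "set \<phi> \<subseteq> {a..b}"
  proof (cases "k = 0")
    case True
    then have "\<phi> = \<theta>" using \<phi> by simp
    then show ?thesis using \<theta>ab by blast
  next
    case False
    \<comment> \<open>A Jordan block takes the value 0 at a nonzero vector, which a sector of
      smaller angle forbids; the window of canonical phases is then \<open>{a..b}\<close>.\<close>
    then have "\<not> b - a < pi" using narrow[OF ab(1) _ W] k0 by metis
    then have "b = a + pi" using ab by linarith
    then have e: "\<gamma> - pi / 2 = a" "\<gamma> + pi / 2 = b" by (simp_all add: \<gamma>_def field_simps)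
    from canonical_phases_sorted(2)[OF can] show ?thesis unfolding e .
  qed
  note fa = field_angle_sector[OF ab W]
  have semi: "semi_sectorial M" using fa(1) by (simp add: semi_sectorial_def)
  have z0: "diag_block_mat [0\<^sub>m 0 0, mk_diagonal (map cis \<theta>)] = phase_blocks \<gamma> \<theta> 0"
    using diag_block_phase_blocks[of 0 \<theta> 0 \<gamma>]
    unfolding block_sum_empty[OF phase_blocks_carrier] replicate_0 append_Nil2 .
  have "if field_angle M < pi then quasi_sectorial_phases M \<phi>
      else field_angle M = pi \<and>
        (if rotated_hermitian M then rotated_hermitian_phases M \<phi> else general_semi_sectorial_phases M \<phi>)"
  proof (cases "field_angle M < pi")
    case True
    then obtain a' b' where ab': "a' \<le> b'" "b' - a' < pi" "?W \<subseteq> sector a' b'" using fa(3) by blast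
    have nW: "0 \<notin> ?W" by (rule narrow[OF ab'])
    have k: "k = 0" by (rule k0[OF nW])
    then have \<phi>\<theta>: "\<phi> = \<theta>" using \<phi> by simp
    have "s - t < pi" if st: "s \<in> set \<theta>" "t \<in> set \<theta>" for s t
    proof (rule ccontr)
      assume "\<not> s - t < pi"
      then have e: "s = t + pi"
        \<comment> \<open>The window has length pi, so a difference of at least pi is exactly pi,
          and two opposite unit numbers would sum to 0 in the range.\<close>
        using subsetD[OF \<theta> st(1)] subsetD[OF \<theta> st(2)] unfolding atLeastAtMost_iff by linarith
      then have "s \<noteq> t" by simp
      then have "cis s + cis t \<in> ?W" using phase_blocks_range_sum[OF st] PW by blast
      moreover have "cis s + cis t = 0" unfolding e by (simp add: complex_eq_iff)
      ultimately show False using nW by simp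
    qed
    moreover have "sectorial M"
    proof -
      have "0 \<in> ?W" if z: "0 \<in> numerical_range M"
      proof -
        from z obtain x where x: "x \<in> carrier_vec r" "x \<bullet>c x = 1" "0 = quad_form M x"
          unfolding numerical_range_iff[OF M] by (elim bexE conjE)
        have "x \<noteq> 0\<^sub>v r" using x(2) cscalar_prod_self_eq_0[OF x(1)] by auto
        then show ?thesis unfolding angular_numerical_range_iff[OF M] using x by (intro bexI[of _ x]) auto
      qed
      then show ?thesis using nW by (auto simp: sectorial_def)
    qed
    ultimately have sp: "sectorial_phases M \<phi>"
      unfolding sectorial_phases_def mk_diagonal_phase_blocks[of \<phi> \<gamma>] using srt\<theta> c[unfolded k] \<phi>\<theta> by metis
    have dec: "M = 1\<^sub>m r * diag_block_mat [0\<^sub>m (r - r) (r - r), M] * adj (1\<^sub>m r)"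
        using M block_sum_empty[OF M] diag_block_mat_Cons[of "0\<^sub>m 0 0" "[M]"]
      by (simp del: diag_block_mat.simps add: diag_block_mat_singleton)
    have "quasi_sectorial_phases M \<phi>"
      unfolding quasi_sectorial_phases_def
    proof (intro exI conjI)
      show "M = 1\<^sub>m r * diag_block_mat [0\<^sub>m (r - r) (r - r), M] * adj (1\<^sub>m r)" by (rule dec)
      show "isometry (1\<^sub>m r)" by (simp add: isometry_def)
    qed (use M sp in simp_all)
    then show ?thesis using True by simp
  next
    case False
    then have fpi: "field_angle M = pi" using fa(1) by simp
    show ?thesis
    proof (cases "rotated_hermitian M")
      case True
      have re: "Re (cis (- \<gamma>) * y) = 0" if "y \<in> angular_numerical_range (phase_blocks \<gamma> \<theta> k)" for y
        by (rule rotated_hermitian_range[OF M acc True]) (use that PW in blast)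
      \<comment> \<open>In the rotated Hermitian case all values are orthogonal to
        \<open>cis \<gamma>\<close>, but a Jordan block attains \<open>cis \<gamma>\<close>.\<close>
      have k: "k = 0"
      proof (rule ccontr)
        assume "k \<noteq> 0"
        then have "Re (cis (- \<gamma>) * cis \<gamma>) = 0" by (intro re phase_blocks_range_jordan) auto
        then show False by (simp add: cis_mult)
      qed
      then have \<phi>\<theta>: "\<phi> = \<theta>" using \<phi> by simp
      have "set \<theta> \<subseteq> {\<gamma> + pi / 2, \<gamma> - pi / 2}"
      proof
        fix t assume t: "t \<in> set \<theta>"
        have "Re (cis (- \<gamma>) * cis t) = 0" by (rule re[OF phase_blocks_range[OF t]])
        then have c0: "cos (t - \<gamma>) = 0" by (simp add: cis_mult add.commute)
        have tr: "\<gamma> - pi / 2 \<le> t" "t \<le> \<gamma> + pi / 2" using \<theta> t by auto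
        show "t \<in> {\<gamma> + pi / 2, \<gamma> - pi / 2}"
        proof (rule ccontr)
          assume "t \<notin> {\<gamma> + pi / 2, \<gamma> - pi / 2}"
          then have "0 < cos (t - \<gamma>)" using tr by (intro cos_gt_zero_pi) auto
          then show False using c0 by simp
        qed
      qed
      then have "\<exists>p q. \<theta> = replicate p (\<gamma> + pi / 2) @ replicate q (\<gamma> - pi / 2)"
        by (rule two_valued_sorted_desc[OF srt\<theta>]) simp
      moreover have "congruent_mat M (diag_block_mat [0\<^sub>m 0 0, mk_diagonal (map cis \<phi>)])"
        using c k z0 \<phi>\<theta> by simp
      ultimately have "rotated_hermitian_phases M \<phi>"
        unfolding rotated_hermitian_phases_def \<phi>\<theta> by metis
      then show ?thesis using fpi True by simp
    next
      case False
      have "congruent_mat M (diag_block_mat ([0\<^sub>m 0 0, mk_diagonal (map cis \<theta>)] @ replicate k (cis \<gamma> \<cdot>\<^sub>m jordan_block2)))"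
        unfolding diag_block_phase_blocks block_sum_empty[OF phase_blocks_carrier] by (rule c)
      then have "general_semi_sectorial_phases M \<phi>"
        unfolding general_semi_sectorial_phases_def using srt\<theta> \<theta> \<phi> by blast
      then show ?thesis using fpi False by simp
    qed
  qed
  then have "has_phases M ((hd \<phi> + last \<phi>) / 2) \<phi>" unfolding has_phases_def by simp
  then show thesis using that can \<phi>ab semi unfolding \<gamma>_def by blast
qed

subsection \<open>Compression to nonsingular factors\<close>

lemma majorized_by_sortedI:
  assumes "length x = length y" "sorted_wrt (\<ge>) x" "sorted_wrt (\<ge>) y"
    "\<And>k. k \<le> length x \<Longrightarrow> sum_list (take k x) \<le> sum_list (take k y)" "sum_list x = sum_list y"
  shows "x \<preceq>\<^sub>m y"
proof -
  have "rev (sort xs) = xs" if "sorted_wrt (\<ge>) xs" for xs :: "real list"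
  proof -
    have "sort xs = rev xs" by (rule properties_for_sort) (use that in \<open>simp_all add: sorted_wrt_rev\<close>)
    then show ?thesis by simp
  qed
  then show ?thesis using assms unfolding majorized_by_def by simp
qed

lemma sum_list_map2_add:
  "length xs = length ys \<Longrightarrow> sum_list (map2 (+) xs ys) = sum_list xs + sum_list (ys :: real list)"
  by (induction xs ys rule: list_induct2) auto

lemma sorted_desc_map2_add:
  fixes xs ys :: "real list"
  assumes "length xs = length ys" "sorted_wrt (\<ge>) xs" "sorted_wrt (\<ge>) ys"
  shows "sorted_wrt (\<ge>) (map2 (+) xs ys)"
  using assms by (auto simp: sorted_wrt_iff_nth_less add_mono)

text \<open>Moving outer factors cyclically preserves the nonzero spectrum from \<open>A * B\<close>
  to \<open>A1 * B1\<close> and on to \<open>A2 * B2\<close>. The rank is that of the square: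
  \<open>A * B\<close> ends in \<open>adj V * B\<close>, which may have larger rank than
  \<open>adj V * B * V\<close>, and only in the square does this smaller compression appear between
  the factors.\<close>

lemma product_compression_sectors:
  assumes A: "A \<in> carrier_mat n n" and B: "B \<in> carrier_mat n n"
    and abA: "aA \<le> bA" "bA - aA < pi" and sA: "\<And>x. x \<in> carrier_vec n \<Longrightarrow> quad_form A x \<in> sector aA bA"
    and accB: "accretive \<gamma>B B"
  obtains r U where "U \<in> carrier_mat n r" "adj U * U = 1\<^sub>m r"
    "\<forall>x \<in> carrier_vec r. quad_form (adj U * A * U) x = 0 \<longrightarrow> x = 0\<^sub>v r"
    "det (adj U * B * U) \<noteq> 0" "vec_space.rank n (A * B * (A * B)) = r"
    "nonzero_eigenvalues (A * B) = nonzero_eigenvalues (adj U * A * U * (adj U * B * U))"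
proof -
  have accA: "accretive ((aA + bA) / 2) A"
    by (rule sector_accretive[OF abA(1) _ A sA]) (use abA in auto)
  obtain p V A1 where V: "V \<in> carrier_mat n p" "adj V * V = 1\<^sub>m p" and A1: "A1 \<in> carrier_mat p p" "det A1 \<noteq> 0"
    and AV: "A = V * A1 * adj V"
    by (rule accretive_factorization[OF A accA])
  define B1 where "B1 = adj V * B * V"
  have B1: "B1 \<in> carrier_mat p p" using V(1) B by (auto simp: B1_def)
  have accB1: "accretive \<gamma>B B1" unfolding B1_def by (rule accretive_compression[OF B accB V(1)])
  obtain r W B2 where W: "W \<in> carrier_mat p r" "adj W * W = 1\<^sub>m r" and B2: "B2 \<in> carrier_mat r r" "det B2 \<noteq> 0"
    and BW: "B1 = W * B2 * adj W"
    by (rule accretive_factorization[OF B1 accB1])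
  define U where "U = V * W"
  have U: "U \<in> carrier_mat n r" using V(1) W(1) by (auto simp: U_def)
  have UU: "adj U * U = 1\<^sub>m r"
    unfolding U_def using V(1) W(1) by (simp add: adj_mult mult_assoc_dim mult_cancel_inverse[OF V(2)] W(2))
  have A1V: "A1 = adj V * A * V"
    unfolding AV using V(1) A1(1) by (simp add: mult_assoc_dim mult_cancel_inverse[OF V(2)] V(2))
  have UAU: "adj U * A * U = adj W * A1 * W"
    unfolding U_def A1V using V(1) W(1) A by (simp add: adj_mult mult_assoc_dim)
  have UBU: "adj U * B * U = B2"
  proof -
    have "adj U * B * U = adj W * B1 * W"
      unfolding U_def B1_def using V(1) W(1) B by (simp add: adj_mult mult_assoc_dim)
    then show ?thesis
      unfolding BW using W(1) B2(1) by (simp add: mult_assoc_dim mult_cancel_inverse[OF W(2)] W(2))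
  qed
  have defA1: "x = 0\<^sub>v p" if "x \<in> carrier_vec p" "quad_form A1 x = 0" for x
  proof (rule sector_definite[OF abA A1 _ that])
    fix y :: "complex vec" assume y: "y \<in> carrier_vec p"
    have "quad_form A1 y = quad_form A (V *\<^sub>v y)"
      unfolding A1V by (rule quad_form_congruence[OF V(1) A y])
    then show "quad_form A1 y \<in> sector aA bA" using sA V(1) y by simp
  qed
  define A2 where "A2 = adj W * A1 * W"
  have A2: "A2 \<in> carrier_mat r r" using W(1) A1(1) by (auto simp: A2_def)
  have defA2: "\<forall>x \<in> carrier_vec r. quad_form A2 x = 0 \<longrightarrow> x = 0\<^sub>v r"
  proof (intro ballI impI)
    fix x :: "complex vec" assume x: "x \<in> carrier_vec r" "quad_form A2 x = 0"
    have Wx: "W *\<^sub>v x \<in> carrier_vec p" using W(1) x(1) by simp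
    have "quad_form A1 (W *\<^sub>v x) = 0"
      using x(2) quad_form_congruence[OF W(1) A1(1) x(1)] by (simp add: A2_def)
    then have W0: "W *\<^sub>v x = 0\<^sub>v p" by (rule defA1[OF Wx])
    have "(adj W * W) *\<^sub>v x = adj W *\<^sub>v (W *\<^sub>v x)"
      by (rule mult_vec_assoc_dim) (use W(1) x(1) in auto)
    also have "\<dots> = 0\<^sub>v r" unfolding W0 using mult_mat_vec_zero[of "adj W" p] W(1) by simp
    finally show "x = 0\<^sub>v r" using W(2) x(1) by simp
  qed
  have detA2: "det A2 \<noteq> 0"
  proof (rule det_nonzeroI[OF A2])
    fix x assume x: "x \<in> carrier_vec r" "A2 *\<^sub>v x = 0\<^sub>v r"
    then have "quad_form A2 x = 0" by (simp add: quad_form_def)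
    then show "x = 0\<^sub>v r" using defA2 x(1) by blast
  qed
  define K where "K = A2 * B2"
  have K: "K \<in> carrier_mat r r" using A2 B2(1) by (auto simp: K_def)
  have "det K \<noteq> 0" using det_mult[OF A2 B2(1)] detA2 B2(2) by (simp add: K_def)
  then obtain K' where K': "K' \<in> carrier_mat r r" "K * K' = 1\<^sub>m r" "K' * K = 1\<^sub>m r"
    by (rule det_nonzero_inverse[OF K])
  have AB: "A * B = V * (A1 * adj V * B)" unfolding AV using V(1) A1(1) B by (simp add: mult_assoc_dim)
  have ev: "nonzero_eigenvalues (A * B) = nonzero_eigenvalues (A2 * B2)"
  proof -
    have "nonzero_eigenvalues (A * B) = nonzero_eigenvalues (A1 * adj V * B * V)"
      unfolding AB by (rule nonzero_eigenvalues_swap[of _ n p]) (use V(1) A1(1) B in auto)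
    also have "A1 * adj V * B * V = A1 * B1" unfolding B1_def using V(1) A1(1) B by (simp add: mult_assoc_dim)
    also have "A1 * B1 = (A1 * W * B2) * adj W" unfolding BW using W(1) A1(1) B2(1) by (simp add: mult_assoc_dim)
    also have "nonzero_eigenvalues \<dots> = nonzero_eigenvalues (adj W * (A1 * W * B2))"
      by (rule nonzero_eigenvalues_swap[of _ p r]) (use W(1) A1(1) B2(1) in auto)
    also have "adj W * (A1 * W * B2) = A2 * B2" unfolding A2_def using W(1) A1(1) B2(1) by (simp add: mult_assoc_dim)
    finally show ?thesis .
  qed
  \<comment> \<open>Splitting the middle factor \<open>B1\<close> as \<open>W * B2 * adj W\<close>
    cuts the square into \<open>F * G\<close> through dimension \<open>r\<close>. The one-sided
    inverses come from that of \<open>K = A2 * B2\<close>.\<close>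
  define F where "F = V * A1 * W * B2"
  define G where "G = adj W * A1 * adj V * B"
  have F: "F \<in> carrier_mat n r" using V(1) A1(1) W(1) B2(1) by (auto simp: F_def)
  have G: "G \<in> carrier_mat r n" using V(1) A1(1) W(1) B by (auto simp: G_def)
  have FG: "A * B * (A * B) = F * G"
  proof -
    have "A * B * (A * B) = V * A1 * (adj V * B * V) * (A1 * (adj V * B))"
      unfolding AB using V(1) A1(1) B by (simp add: mult_assoc_dim)
    also have "\<dots> = F * G"
      unfolding B1_def[symmetric] BW F_def G_def using V(1) A1(1) B W(1) B2(1) by (simp add: mult_assoc_dim)
    finally show ?thesis .
  qed
  have LF: "(K' * (adj W * adj V)) * F = 1\<^sub>m r"
  proof -
    have "(K' * (adj W * adj V)) * F = K' * K"
      unfolding F_def K_def A2_def using V(1) A1(1) W(1) B2(1) K'(1)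
      by (simp add: mult_assoc_dim mult_cancel_inverse[OF V(2)])
    then show ?thesis using K' by simp
  qed
  have GR: "G * (V * W * K') = 1\<^sub>m r"
  proof -
    have "G * (V * W * K') = adj W * A1 * (adj V * B * V) * (W * K')"
      unfolding G_def using V(1) A1(1) W(1) B K'(1) by (simp add: mult_assoc_dim)
    also have "\<dots> = K * K'"
      unfolding B1_def[symmetric] BW K_def A2_def using A1(1) W(1) B2(1) K'(1)
      by (simp add: mult_assoc_dim mult_cancel_inverse[OF W(2)])
    finally show ?thesis using K' by simp
  qed
  have "vec_space.rank n (A * B * (A * B)) = r"
    unfolding FG by (rule rank_product[OF F G _ LF _ GR]) (use V(1) W(1) K'(1) in auto)
  then show thesis
    using that[OF U UU] defA2 B2(2) ev unfolding UAU UBU A2_def by blast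
qed

text \<open>The sectors of \<open>A\<close> and \<open>B\<close> contain the forms of the
  compressions, so \<open>phases_exist\<close> yields phases that already lie in the required
  intervals.\<close>

theorem theorem5p2:
  fixes A B C :: "complex mat" and n r :: nat
    and \<gamma>A \<gamma>B :: real and \<phi>A \<phi>B :: "real list"
  assumes "A \<in> carrier_mat n n" and "B \<in> carrier_mat n n"
    and "quasi_sectorial A" and "semi_sectorial B"
    and "has_phases A \<gamma>A \<phi>A" and "has_phases B \<gamma>B \<phi>B"
    and "C = A * B"
    and "r = vec_space.rank n (C ^\<^sub>m 2)"
  shows "size (nonzero_eigenvalues C) = r \<and>
    (\<exists>\<Lambda> \<alpha>s.
      mset \<Lambda> = nonzero_eigenvalues C \<and>
      length \<alpha>s = r \<and> (\<forall>i < r. is_Arg (\<Lambda> ! i) (\<alpha>s ! i)) \<and>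
      sorted_wrt (\<ge>) \<alpha>s \<and>
      (\<forall>\<alpha> \<in> set \<alpha>s. \<gamma>A + \<gamma>B - pi < \<alpha> \<and> \<alpha> < \<gamma>A + \<gamma>B + pi) \<and>
      (\<exists>U. U \<in> carrier_mat n r \<and> isometry U \<and>
        sectorial (mat_adjoint U * A * U) \<and>
        invertible_mat (mat_adjoint U * B * U) \<and>
        semi_sectorial (mat_adjoint U * B * U) \<and>
        (\<exists>\<gamma>1 \<phi>1 \<gamma>2 \<phi>2.
          has_phases (mat_adjoint U * A * U) \<gamma>1 \<phi>1 \<and>
          set \<phi>1 \<subseteq> phase_interval \<phi>A \<and>
          has_phases (mat_adjoint U * B * U) \<gamma>2 \<phi>2 \<and>
          set \<phi>2 \<subseteq> phase_interval \<phi>B \<and>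
          \<alpha>s \<preceq>\<^sub>m map2 (+) \<phi>1 \<phi>2)))"
proof -
  note A = assms(1) and B = assms(2)
  obtain aA bA where abA: "aA \<le> bA" "bA \<le> aA + pi" "\<gamma>A = (aA + bA) / 2"
    and sA: "\<And>x. x \<in> carrier_vec n \<Longrightarrow> quad_form A x \<in> sector aA bA"
    and wA: "field_angle A < pi \<Longrightarrow> bA - aA < pi"
    and iA: "\<phi>A \<noteq> [] \<Longrightarrow> phase_interval \<phi>A = {aA..bA}"
    and nA: "\<And>x. \<phi>A = [] \<Longrightarrow> x \<in> carrier_vec n \<Longrightarrow> quad_form A x = 0"
    by (rule has_phases_sector[OF A assms(5)]) blast
  have wA: "bA - aA < pi" using wA assms(3) by (simp add: quasi_sectorial_def)
  obtain aB bB where abB: "aB \<le> bB" "bB \<le> aB + pi" "\<gamma>B = (aB + bB) / 2"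
    and sB: "\<And>x. x \<in> carrier_vec n \<Longrightarrow> quad_form B x \<in> sector aB bB"
    and iB: "\<phi>B \<noteq> [] \<Longrightarrow> phase_interval \<phi>B = {aB..bB}"
    and nB: "\<And>x. \<phi>B = [] \<Longrightarrow> x \<in> carrier_vec n \<Longrightarrow> quad_form B x = 0"
    by (rule has_phases_sector[OF B assms(6)]) blast
  have accB: "accretive \<gamma>B B" unfolding abB(3) by (rule sector_accretive[OF abB(1,2) B sB])
  obtain r' U where U: "U \<in> carrier_mat n r'" and UU: "adj U * U = 1\<^sub>m r'"
    and defA: "\<forall>x \<in> carrier_vec r'. quad_form (adj U * A * U) x = 0 \<longrightarrow> x = 0\<^sub>v r'"
    and detB: "det (adj U * B * U) \<noteq> 0" and rank: "vec_space.rank n (A * B * (A * B)) = r'"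
    and ev: "nonzero_eigenvalues (A * B) = nonzero_eigenvalues (adj U * A * U * (adj U * B * U))"
    by (rule product_compression_sectors[OF A B abA(1) wA sA accB])
  have "C ^\<^sub>m 2 = A * B * (A * B)" using A B by (simp add: assms(7) numeral_2_eq_2)
  then have r: "r' = r" using assms(8) rank by simp
  define A1 B1 where "A1 = adj U * A * U" and "B1 = adj U * B * U"
  note U = U[unfolded r] and UU = UU[unfolded r] and defA = defA[unfolded r A1_def[symmetric]]
    and detB = detB[folded B1_def] and ev = ev[folded A1_def B1_def]
  have A1: "A1 \<in> carrier_mat r r" and B1: "B1 \<in> carrier_mat r r" using A B U by (auto simp: A1_def B1_def)
  have UXU: "quad_form (adj U * X * U) x = quad_form X (U *\<^sub>v x)" "U *\<^sub>v x \<in> carrier_vec n"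
    if "X \<in> carrier_mat n n" "x \<in> carrier_vec r" for X x
    using quad_form_congruence[OF U that] U that by auto
  have sA1: "quad_form A1 x \<in> sector aA bA" if "x \<in> carrier_vec r" for x
    using UXU[OF A that] sA by (simp add: A1_def)
  have sB1: "quad_form B1 x \<in> sector aB bB" if "x \<in> carrier_vec r" for x
    using UXU[OF B that] sB by (simp add: B1_def)
  have detA: "det A1 \<noteq> 0"
  proof (rule det_nonzeroI[OF A1])
    fix x assume x: "x \<in> carrier_vec r" "A1 *\<^sub>v x = 0\<^sub>v r"
    then have "quad_form A1 x = 0" by (simp add: quad_form_def)
    then show "x = 0\<^sub>v r" using defA x(1) by blast
  qed
  obtain \<phi>1 \<gamma>1 where can1: "canonical_phases \<gamma>A A1 \<phi>1" and \<phi>1: "set \<phi>1 \<subseteq> {aA..bA}" and ph1: "has_phases A1 \<gamma>1 \<phi>1"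
    unfolding abA(3) by (rule phases_exist[OF A1 detA abA(1,2) sA1])
  obtain \<phi>2 \<gamma>2 where can2: "canonical_phases \<gamma>B B1 \<phi>2" and \<phi>2: "set \<phi>2 \<subseteq> {aB..bB}" and ph2: "has_phases B1 \<gamma>2 \<phi>2"
    and semi: "semi_sectorial B1"
    unfolding abB(3) by (rule phases_exist[OF B1 detB abB(1,2) sB1])
  have len: "length \<phi>1 = r" "length \<phi>2 = r"
    using canonical_phases_length[OF can1 A1] canonical_phases_length[OF can2 B1] .
  \<comment> \<open>If a factor has no phases, its \<open>phase_interval\<close> is unspecified, and
    the inclusion can hold only for an empty list. The form of that factor vanishes, so a
    nonsingular compression has size 0.\<close>
  have r0: "r = 0" if z: "\<And>x. x \<in> carrier_vec n \<Longrightarrow> quad_form X x = 0" and X: "X \<in> carrier_mat n n"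
    and d: "det (adj U * X * U) \<noteq> 0" for X
  proof (rule ccontr)
    assume "r \<noteq> 0"
    have c: "adj U * X * U \<in> carrier_mat r r" using X U by auto
    have "(adj U * X * U) *\<^sub>v unit_vec r 0 = 0\<^sub>v r"
    proof (rule quad_form_zero_imp_zero[OF c _ unit_vec_carrier])
      show "quad_form (adj U * X * U) x = 0" if "x \<in> carrier_vec r" for x
        using UXU[OF X that] z by simp
    qed
    then have "unit_vec r 0 = (0\<^sub>v r :: complex vec)" by (rule det_nonzeroD[OF c d unit_vec_carrier])
    then have "unit_vec r 0 $ 0 = (0\<^sub>v r :: complex vec) $ 0" by simp
    then show False using \<open>r \<noteq> 0\<close> by simp
  qed
  have sub1: "set \<phi>1 \<subseteq> phase_interval \<phi>A"
  proof (cases "\<phi>A = []")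
    case True
    then have "r = 0" using r0[OF nA[OF True] A] detA by (simp add: A1_def)
    then show ?thesis using len(1) by simp
  qed (use iA \<phi>1 in simp)
  have sub2: "set \<phi>2 \<subseteq> phase_interval \<phi>B"
  proof (cases "\<phi>B = []")
    case True
    then have "r = 0" using r0[OF nB[OF True] B] detB by (simp add: B1_def)
    then show ?thesis using len(2) by simp
  qed (use iB \<phi>2 in simp)
  have sect: "sectorial A1"
  proof -
    have False if "0 \<in> numerical_range A1"
    proof -
      from that obtain x where x: "x \<in> carrier_vec r" "x \<bullet>c x = 1" "0 = quad_form A1 x"
        unfolding numerical_range_iff[OF A1] by (elim bexE conjE)
      have "x = 0\<^sub>v r" using defA x(1) x(3)[symmetric] by blast
      then show False using x(2) cscalar_prod_self_eq_0[OF x(1)] by simp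
    qed
    then show ?thesis unfolding sectorial_def by blast
  qed
  have accA1: "accretive \<gamma>A A1" unfolding abA(3) by (rule sector_accretive[OF abA(1,2) A1 sA1])
  have accB1: "accretive \<gamma>B B1" unfolding abB(3) by (rule sector_accretive[OF abB(1,2) B1 sB1])
  have ends: "last xs \<in> {a..b} \<and> hd xs \<in> {a..b}" if "set xs \<subseteq> {a..b}" "length xs = r" "r \<noteq> 0" for xs and a b :: real
  proof -
    have "xs \<noteq> []" using that by auto
    then show ?thesis using that(1) by (meson hd_in_set last_in_set subsetD)
  qed
  have bounds: "aA + aB \<le> last \<phi>1 + last \<phi>2" "hd \<phi>1 + hd \<phi>2 \<le> bA + bB" if "0 < r"
    using ends[OF \<phi>1 len(1)] ends[OF \<phi>2 len(2)] that by auto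
  \<comment> \<open>An angle below pi from \<open>A\<close> and one of at most pi from
    \<open>B\<close> leave the sum strictly below \<open>2 * pi\<close>.\<close>
  have width: "0 < r \<longrightarrow> (hd \<phi>1 + hd \<phi>2) - (last \<phi>1 + last \<phi>2) < 2 * pi"
    using bounds wA abB(2) by fastforce
  obtain es \<alpha> where es: "mset es = nonzero_eigenvalues (A1 * B1)" "length es = r"
    and \<alpha>: "length \<alpha> = r" "\<forall>i<r. is_Arg (es ! i) (\<alpha> ! i)" "sorted_wrt (\<ge>) \<alpha>"
      "set \<alpha> \<subseteq> {last \<phi>1 + last \<phi>2..hd \<phi>1 + hd \<phi>2}"
      "\<forall>k\<le>r. sum_list (take k \<alpha>) \<le> sum_list (take k \<phi>1) + sum_list (take k \<phi>2)"
      "sum_list \<alpha> = sum_list \<phi>1 + sum_list \<phi>2"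
    using product_eigenvalue_args_sorted[OF A1 B1 accA1 defA accB1 detB can1 can2 width]
    by (elim exE conjE)
  have ms: "mset es = nonzero_eigenvalues C" using es(1) ev by (simp add: assms(7))
  \<comment> \<open>The interval of sums is centred at \<open>\<gamma>A + \<gamma>B\<close>, and
    half its length is less than pi.\<close>
  have window: "\<gamma>A + \<gamma>B - pi < t \<and> t < \<gamma>A + \<gamma>B + pi" if t: "t \<in> set \<alpha>" for t
  proof -
    have "0 < r" using t \<alpha>(1) by (cases r) auto
    from bounds[OF this] have "aA + aB \<le> t" "t \<le> bA + bB" using subsetD[OF \<alpha>(4) t] by auto
    then show ?thesis using wA abA(1) abB(1,2) unfolding abA(3) abB(3) by (simp add: field_simps)
  qed
  have maj: "\<alpha> \<preceq>\<^sub>m map2 (+) \<phi>1 \<phi>2"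
  proof (rule majorized_by_sortedI)
    show "sorted_wrt (\<ge>) (map2 (+) \<phi>1 \<phi>2)"
      using sorted_desc_map2_add canonical_phases_sorted(1)[OF can1] canonical_phases_sorted(1)[OF can2] len by simp
    show "sum_list (take k \<alpha>) \<le> sum_list (take k (map2 (+) \<phi>1 \<phi>2))" if "k \<le> length \<alpha>" for k
    proof -
      have "take k (map2 (+) \<phi>1 \<phi>2) = map2 (+) (take k \<phi>1) (take k \<phi>2)" by (simp add: take_map take_zip)
      then show ?thesis using \<alpha>(1,5) that len sum_list_map2_add[of "take k \<phi>1" "take k \<phi>2"] by simp
    qed
    show "sum_list \<alpha> = sum_list (map2 (+) \<phi>1 \<phi>2)"
      using \<alpha>(6) sum_list_map2_add[of \<phi>1 \<phi>2] len by simp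
  qed (use \<alpha>(1,3) len in simp_all)
  have iso: "isometry U" using UU U by (simp add: isometry_def)
  have inv: "invertible_mat B1" using invertible_mat_iff_det[OF B1] detB by simp
  have "size (nonzero_eigenvalues C) = r" using ms es(2) by (metis size_mset)
  then show ?thesis
    using ms \<alpha>(1,2,3) window U iso sect inv semi ph1 ph2 sub1 sub2 maj
    unfolding A1_def B1_def by blast
qed

end
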